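(* Let $n\ge m\ge 1$ be integers, let $r$ be a nonnegative integer, and let $X=\left(-\frac{\partial H}{\partial y},\frac{\partial H}{\partial x}\right)\in\mathcal{Y}_{n,m}$ be a real polynomial Hamiltonian vector field on $\mathbb{R}^2$, with $H\in\mathbb{R}[x,y]$ of degree $n+1$. Let $c(X)$ be the number of centers of $X$. If $X$ has exactly $2r$ infinite critical points, then $$c(X)\le C_{n,m}=\begin{cases}\left[\dfrac{n^2+1-r}{2}\right], & n=m,\\[2mm] \left[\dfrac{nm+1}{2}\right], & n>m.\end{cases}$$ Moreover, this bound can be realized: whenever there exist polynomial Hamiltonian vector fields in $\mathcal{Y}_{n,m}$ with exactly $2r$ infinite critical points, there is one among them having exactly $C_{n,m}$ centers.
   Context: $\mathcal{Y}_{n,m}$ (with $n\ge m$) is the set of real planar polynomial vector fields $Y=(f(x,y),g(x,y))$ with $\deg f=n$ and $\deg g=m$. $[\cdot]$ denotes the integer part. A center is a critical point $p\in\mathbb{R}^2$ of the vector field having a neighborhood filled with periodic orbits except for $p$ itself. Infinite critical points are the critical points on the equator of the Poincaré compactification. Writing $f_n,g_n$ for the degree-$n$ homogeneous parts of $f,g$, they correspond to the nonzero real solutions $(x_0,y_0)$ of $-yf_n(x,y)+xg_n(x,y)=0$ if $n=m$, or of $-yf_n(x,y)=0$ if $n>m$; each real direction (line through the origin) of solutions gives one pair of diametrically opposite infinite critical points. For the Hamiltonian field $X$, let $H_{n+1}$ be the degree-$(n+1)$ homogeneous part of $H$; the number of infinite critical points is $2r$ exactly when $H_{n+1}$ has exactly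 $r$ pairwise non-proportional real linear factors. (If $n>m$ then $H_{n+1}=ay^{n+1}$ with $a\ne0$, so $r=1$.) *)

theory Defs
  imports "HOL-Analysis.Analysis" "HOL-Computational_Algebra.Polynomial"
begin

text \<open>
  A polynomial in \<open>\<real>[x,y]\<close> is a value of type \<^typ>\<open>real poly poly\<close>; the outer
  variable is \<open>y\<close> and the inner one is \<open>x\<close>, so \<open>coeff (coeff p i) j\<close> is the coefficient of
  \<open>x^j y^i\<close>.
\<close>

type_synonym poly_xy = "real poly poly"

definition eval_xy :: "poly_xy \<Rightarrow> real \<Rightarrow> real \<Rightarrow> real" where
  "eval_xy p x y = poly (poly p [:y:]) x"

definition deriv_x :: "poly_xy \<Rightarrow> poly_xy" where
  "deriv_x p = map_poly pderiv p"

definition deriv_y :: "poly_xy \<Rightarrow> poly_xy" where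
  "deriv_y p = pderiv p"

text \<open>As for \<^const>\<open>degree\<close>, the zero polynomial gets total degree \<open>0\<close>.\<close>

definition total_degree :: "poly_xy \<Rightarrow> nat" where
  "total_degree p = (LEAST d. \<forall>i j. d < i + j \<longrightarrow> coeff (coeff p i) j = 0)"

type_synonym poly_vf = "poly_xy \<times> poly_xy"

definition vf_at :: "poly_vf \<Rightarrow> real \<times> real \<Rightarrow> real \<times> real" where
  "vf_at X p = (eval_xy (fst X) (fst p) (snd p), eval_xy (snd X) (fst p) (snd p))"

definition fields_of_degrees :: "nat \<Rightarrow> nat \<Rightarrow> poly_vf set" where
  "fields_of_degrees n m = {X. total_degree (fst X) = n \<and> total_degree (snd X) = m}"

definition hamiltonian_vf :: "poly_xy \<Rightarrow> poly_vf" where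
  "hamiltonian_vf H = (- deriv_y H, deriv_x H)"

definition critical_point :: "poly_vf \<Rightarrow> real \<times> real \<Rightarrow> bool" where
  "critical_point X p \<longleftrightarrow> vf_at X p = 0"

text \<open>Critical points are not periodic orbits: the periodic solution must be nonconstant.\<close>

definition periodic_orbit :: "poly_vf \<Rightarrow> (real \<times> real) set \<Rightarrow> bool" where
  "periodic_orbit X S \<longleftrightarrow>
     (\<exists>\<gamma> T. (\<forall>t. (\<gamma> has_vector_derivative vf_at X (\<gamma> t)) (at t)) \<and>
            0 < T \<and> (\<forall>t. \<gamma> (t + T) = \<gamma> t) \<and> (\<exists>t. \<gamma> t \<noteq> \<gamma> 0) \<and> S = range \<gamma>)"

definition center :: "poly_vf \<Rightarrow> real \<times> real \<Rightarrow> bool" where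
  "center X p \<longleftrightarrow> critical_point X p \<and>
     (\<exists>U \<P>. open U \<and> p \<in> U \<and> (\<forall>S\<in>\<P>. periodic_orbit X S) \<and> U - {p} = \<Union>\<P>)"

definition centers :: "poly_vf \<Rightarrow> (real \<times> real) set" where
  "centers X = {p. center X p}"

text \<open>
  The Poincare compactification. For \<open>d\<close> at least the total degree of \<open>p\<close>,
  \<open>homogenize d p u v w\<close> is \<open>w^d p(u/w, v/w)\<close>, extended to \<open>w = 0\<close>.
\<close>

definition homogenize :: "nat \<Rightarrow> poly_xy \<Rightarrow> real \<Rightarrow> real \<Rightarrow> real \<Rightarrow> real" where
  "homogenize d p u v w =
     (\<Sum>i\<le>d. \<Sum>j\<le>d - i. coeff (coeff p i) j * u ^ j * v ^ i * w ^ (d - i - j))"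

definition homogeneous_part :: "nat \<Rightarrow> poly_xy \<Rightarrow> real \<Rightarrow> real \<Rightarrow> real" where
  "homogeneous_part d p x y = (\<Sum>i\<le>d. coeff (coeff p i) (d - i) * x ^ (d - i) * y ^ i)"

definition vf_degree :: "poly_vf \<Rightarrow> nat" where
  "vf_degree X = max (total_degree (fst X)) (total_degree (snd X))"

text \<open>
  The plane is identified with the upper open hemisphere of the unit sphere by central projection
  from the plane \<open>w = 1\<close>. The compactified field is the pushforward of \<open>X\<close> multiplied by
  \<open>w^(d-1)\<close>, \<open>d\<close> being the degree of \<open>X\<close>; writing the pushforward in ambient coordinates gives
  the formula below (see lemma \<open>poincare_field_pushforward\<close>), which extends to the equator.
\<close>

definition central_projection :: "real \<times> real \<Rightarrow> real \<times> real \<times> real" where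
  "central_projection p =
     (let s = sqrt ((fst p)\<^sup>2 + (snd p)\<^sup>2 + 1) in (fst p / s, snd p / s, 1 / s))"

definition poincare_field :: "poly_vf \<Rightarrow> real \<times> real \<times> real \<Rightarrow> real \<times> real \<times> real" where
  "poincare_field X q =
     (case q of (u, v, w) \<Rightarrow>
        let F = homogenize (vf_degree X) (fst X) u v w;
            G = homogenize (vf_degree X) (snd X) u v w;
            s = u * F + v * G
        in (F - s * u, G - s * v, - s * w))"

definition infinite_critical_points :: "poly_vf \<Rightarrow> (real \<times> real \<times> real) set" where
  "infinite_critical_points X =
     {(u, v, w). u\<^sup>2 + v\<^sup>2 + w\<^sup>2 = 1 \<and> w = 0 \<and> poincare_field X (u, v, w) = 0}"

definition hamiltonian_fields :: "nat \<Rightarrow> nat \<Rightarrow> nat \<Rightarrow> poly_vf set" where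
  "hamiltonian_fields n m r =
     {X \<in> fields_of_degrees n m.
        (\<exists>H. total_degree H = n + 1 \<and> X = hamiltonian_vf H) \<and>
        finite (infinite_critical_points X) \<and> card (infinite_critical_points X) = 2 * r}"

definition center_bound :: "nat \<Rightarrow> nat \<Rightarrow> nat \<Rightarrow> int" where
  "center_bound n m r =
     (if n = m then \<lfloor>((real n)\<^sup>2 + 1 - real r) / 2\<rfloor> else \<lfloor>(real n * real m + 1) / 2\<rfloor>)"

lemma coeff_above_total_degree:
  assumes "total_degree p < i + j"
  shows "coeff (coeff p i) j = 0"
proof -
  let ?D = "degree p + Max ((\<lambda>i. degree (coeff p i)) ` {..degree p})"
  have "\<forall>i j. ?D < i + j \<longrightarrow> coeff (coeff p i) j = 0"
  proof (intro allI impI)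
    fix i j assume less: "?D < i + j"
    show "coeff (coeff p i) j = 0"
    proof (cases "i \<le> degree p")
      case True
      then have "degree (coeff p i) \<le> Max ((\<lambda>i. degree (coeff p i)) ` {..degree p})"
        by (intro Max_ge) auto
      with less True show ?thesis by (intro coeff_eq_0) linarith
    next
      case False
      then show ?thesis by (simp add: coeff_eq_0)
    qed
  qed
  then have "\<forall>i j. total_degree p < i + j \<longrightarrow> coeff (coeff p i) j = 0"
    unfolding total_degree_def by (rule LeastI)
  with assms show ?thesis by blast
qed

lemma eval_xy_eq_sum:
  assumes "total_degree p \<le> d"
  shows "eval_xy p x y = (\<Sum>i\<le>d. \<Sum>j\<le>d - i. coeff (coeff p i) j * x ^ j * y ^ i)"
proof -
  have dp: "degree p \<le> d"
  proof (rule degree_le, intro allI impI)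
    fix i assume "d < i"
    then show "coeff p i = 0"
      using assms by (intro poly_eqI) (simp add: coeff_above_total_degree)
  qed
  have di: "degree (coeff p i) \<le> d - i" for i
    using assms by (intro degree_le allI impI coeff_above_total_degree) linarith
  have poly_le: "poly q z = (\<Sum>i\<le>k. coeff q i * z ^ i)" if "degree q \<le> k"
    for q :: "'b::comm_ring_1 poly" and z k
    unfolding poly_altdef using that
    by (intro sum.mono_neutral_left) (auto simp: coeff_eq_0)
  have "eval_xy p x y = (\<Sum>i\<le>d. poly (coeff p i) x * y ^ i)"
    unfolding eval_xy_def poly_le[OF dp] by (simp add: poly_sum poly_power)
  also have "\<dots> = (\<Sum>i\<le>d. \<Sum>j\<le>d - i. coeff (coeff p i) j * x ^ j * y ^ i)"
    by (simp add: poly_le[OF di] sum_distrib_right)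
  finally show ?thesis .
qed

lemma homogenize_eq:
  assumes "total_degree p \<le> d" "w \<noteq> 0"
  shows "homogenize d p u v w = w ^ d * eval_xy p (u / w) (v / w)"
proof -
  have "w ^ (d - i - j) = w ^ d / w ^ j / w ^ i" if "i \<le> d" "j \<le> d - i" for i j
  proof -
    have "d = (d - i - j) + j + i" using that by linarith
    then have "w ^ d = w ^ (d - i - j) * w ^ j * w ^ i" by (metis power_add)
    then show ?thesis using assms(2) by simp
  qed
  then show ?thesis
    unfolding homogenize_def eval_xy_eq_sum[OF assms(1)] sum_distrib_left
    by (intro sum.cong refl) (simp add: power_divide)
qed

lemma homogenize_equator: "homogenize d p u v 0 = homogeneous_part d p u v"
proof -
  have "(\<Sum>j\<le>d - i. coeff (coeff p i) j * u ^ j * v ^ i * 0 ^ (d - i - j)) =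
      coeff (coeff p i) (d - i) * u ^ (d - i) * v ^ i" for i
  proof -
    have "(\<Sum>j\<le>d - i. coeff (coeff p i) j * u ^ j * v ^ i * 0 ^ (d - i - j)) =
      (\<Sum>j\<le>d - i. if j = d - i then coeff (coeff p i) j * u ^ j * v ^ i else 0)"
      by (intro sum.cong) (auto simp: power_0_left)
    then show ?thesis by simp
  qed
  then show ?thesis by (simp add: homogenize_def homogeneous_part_def)
qed

lemma homogeneous_part_above_total_degree:
  "total_degree p < d \<Longrightarrow> homogeneous_part d p x y = 0"
  by (simp add: homogeneous_part_def coeff_above_total_degree)

lemma poincare_field_pushforward:
  assumes "1 \<le> vf_degree X"
    and \<gamma>: "(\<gamma> has_vector_derivative vf_at X (\<gamma> t)) (at t)"
  defines "w \<equiv> 1 / sqrt ((fst (\<gamma> t))\<^sup>2 + (snd (\<gamma> t))\<^sup>2 + 1)"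
  shows "\<exists>V. ((\<lambda>t. central_projection (\<gamma> t)) has_vector_derivative V) (at t) \<and>
             poincare_field X (central_projection (\<gamma> t)) = w ^ (vf_degree X - 1) *\<^sub>R V"
proof -
  define x where "x = fst (\<gamma> t)"
  define y where "y = snd (\<gamma> t)"
  define a where "a = eval_xy (fst X) x y"
  define b where "b = eval_xy (snd X) x y"
  define s where "s = sqrt (x\<^sup>2 + y\<^sup>2 + 1)"
  define k where "k = (x * a + y * b) / s"
  have pos: "x\<^sup>2 + y\<^sup>2 + 1 > 0" by (smt (verit) zero_le_power2)
  then have s: "s > 0" "s \<noteq> 0" by (auto simp: s_def)
  have w: "w = 1 / s" "w \<noteq> 0" using s by (simp_all add: w_def s_def x_def y_def)
  have dx: "((\<lambda>t. fst (\<gamma> t)) has_real_derivative a) (at t)"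
    using bounded_linear.has_vector_derivative[OF bounded_linear_fst \<gamma>]
    by (simp add: has_real_derivative_iff_has_vector_derivative vf_at_def a_def x_def y_def)
  have dy: "((\<lambda>t. snd (\<gamma> t)) has_real_derivative b) (at t)"
    using bounded_linear.has_vector_derivative[OF bounded_linear_snd \<gamma>]
    by (simp add: has_real_derivative_iff_has_vector_derivative vf_at_def b_def x_def y_def)
  have ds: "((\<lambda>t. sqrt ((fst (\<gamma> t))\<^sup>2 + (snd (\<gamma> t))\<^sup>2 + 1)) has_real_derivative k) (at t)"
    using DERIV_chain2[OF DERIV_real_sqrt[OF pos[unfolded x_def y_def]]
        DERIV_add[OF DERIV_add[OF DERIV_power[OF dx, of 2] DERIV_power[OF dy, of 2]] DERIV_const[of 1]]]
    by (rule back_subst[where P = "\<lambda>D. (_ has_real_derivative D) (at t)"])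
       (simp add: k_def s_def x_def y_def divide_simps)
  have nz: "sqrt ((fst (\<gamma> t))\<^sup>2 + (snd (\<gamma> t))\<^sup>2 + 1) \<noteq> 0"
    using s by (simp add: s_def x_def y_def)
  let ?V = "((a * s - x * k) / (s * s), (b * s - y * k) / (s * s), - k / (s * s))"
  have 1: "((\<lambda>t. fst (\<gamma> t) / sqrt ((fst (\<gamma> t))\<^sup>2 + (snd (\<gamma> t))\<^sup>2 + 1))
      has_real_derivative (a * s - x * k) / (s * s)) (at t)"
    using DERIV_divide[OF dx ds nz] by (simp add: s_def x_def y_def)
  have 2: "((\<lambda>t. snd (\<gamma> t) / sqrt ((fst (\<gamma> t))\<^sup>2 + (snd (\<gamma> t))\<^sup>2 + 1))
      has_real_derivative (b * s - y * k) / (s * s)) (at t)"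
    using DERIV_divide[OF dy ds nz] by (simp add: s_def x_def y_def)
  have 3: "((\<lambda>t. 1 / sqrt ((fst (\<gamma> t))\<^sup>2 + (snd (\<gamma> t))\<^sup>2 + 1))
      has_real_derivative - k / (s * s)) (at t)"
    using DERIV_divide[OF DERIV_const ds nz, of 1] by (simp add: s_def x_def y_def)
  have V: "((\<lambda>t. central_projection (\<gamma> t)) has_vector_derivative ?V) (at t)"
    unfolding central_projection_def Let_def
    using 1 2 3
    by (intro has_vector_derivative_Pair)
       (simp_all add: has_real_derivative_iff_has_vector_derivative)
  have cp: "central_projection (\<gamma> t) = (x * w, y * w, w)"
    by (simp add: central_projection_def Let_def w s_def x_def y_def)
  obtain e where e: "vf_degree X = Suc e" using assms(1) by (cases "vf_degree X") auto
  have F: "homogenize (vf_degree X) (fst X) (x * w) (y * w) w = w ^ e * w * a"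
    using homogenize_eq[of "fst X" "vf_degree X" w "x * w" "y * w"] w(2)
    by (simp add: a_def vf_degree_def) (simp add: e vf_degree_def[symmetric])
  have G: "homogenize (vf_degree X) (snd X) (x * w) (y * w) w = w ^ e * w * b"
    using homogenize_eq[of "snd X" "vf_degree X" w "x * w" "y * w"] w(2)
    by (simp add: b_def vf_degree_def) (simp add: e vf_degree_def[symmetric])
  have "poincare_field X (central_projection (\<gamma> t)) = w ^ (vf_degree X - 1) *\<^sub>R ?V"
    unfolding cp poincare_field_def prod.case Let_def F G
    using s by (simp add: e w(1) k_def field_simps)
  with V show ?thesis by blast
qed

text \<open>
  For \<open>X = (f, g)\<close> with \<open>deg f = n = deg g\<close> the equation is
  \<open>-y f_n + x g_n = 0\<close>; if \<open>deg g < n\<close> then \<open>g_n = 0\<close> and it reduces to \<open>-y f_n = 0\<close>.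
\<close>

lemma infinite_critical_points_eq:
  "infinite_critical_points X =
     {(u, v, w). u\<^sup>2 + v\<^sup>2 = 1 \<and> w = 0 \<and>
        - v * homogeneous_part (vf_degree X) (fst X) u v
        + u * homogeneous_part (vf_degree X) (snd X) u v = 0}" (is "_ = ?R")
proof -
  have eq: "(F - (u * F + v * G) * u = 0 \<and> G - (u * F + v * G) * v = 0) \<longleftrightarrow> - v * F + u * G = 0"
    if "u\<^sup>2 + v\<^sup>2 = 1" for u v F G :: real
  proof -
    have "F - (u * F + v * G) * u = - v * (- v * F + u * G) + F * (1 - (u\<^sup>2 + v\<^sup>2))"
      "G - (u * F + v * G) * v = u * (- v * F + u * G) + G * (1 - (u\<^sup>2 + v\<^sup>2))"
      by (simp_all add: algebra_simps power2_eq_square)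
    moreover have "u \<noteq> 0 \<or> v \<noteq> 0" using that by auto
    ultimately show ?thesis using that by auto
  qed
  have "q \<in> infinite_critical_points X \<longleftrightarrow> q \<in> ?R" for q
  proof -
    obtain u v w where q: "q = (u, v, w)" by (cases q) auto
    show ?thesis
    proof (cases "w = 0 \<and> u\<^sup>2 + v\<^sup>2 = 1")
      case True
      then show ?thesis
        using eq[of u v "homogeneous_part (vf_degree X) (fst X) u v"
            "homogeneous_part (vf_degree X) (snd X) u v"]
        unfolding q infinite_critical_points_def poincare_field_def
        by (simp only: mem_Collect_eq prod.case Let_def homogenize_equator zero_prod_def
            prod.inject mult_zero_right zero_power2 add_0_right simp_thms)
    qed (auto simp: q infinite_critical_points_def)
  qed
  then show ?thesis by blast
qed

end

theory Submission
  imports Defs "HOL-Computational_Algebra.Fundamental_Theorem_Algebra" "HOL-Computational_Algebra.Polynomial_Factorial"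
    "HOL-Computational_Algebra.Field_as_Ring"
begin

text \<open>
  Call \<open>W\<close> a well of \<open>H\<close> if \<open>W\<close> is open and bounded and \<open>H\<close> takes at some point of \<open>W\<close> a value
  below, or above, all its values on the boundary. Wells survive small perturbations, and by Sard's
  theorem a generic linear perturbation gives each of them a critical point with positive Hessian
  determinant. Every neighbourhood of a center contains a well: either \<open>H\<close> minus its value at the
  center has constant sign on the boundary of a small square, or there is a small periodic orbit, whose
  interior is a well. Conversely a critical point with positive Hessian determinant is a center, the
  periodic orbits being the level curves parametrised in polar coordinates.

  For the upper bound the leading form is perturbed to be squarefree without losing real zeros. In
  \<open>\<real>[x,y] / (H_x, H_y)\<close> the form \<open>h \<mapsto> \<Lambda>(h\<^sup>2)\<close>, with \<open>\<Lambda>\<close> the residue functional determined by the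
  leading forms, is definite on the span of the idempotents of the \<open>c\<close> extrema and semidefinite of
  the opposite sign on an explicit space of polynomials of low degree. The two dimensions therefore
  add up to at most \<open>n m\<close>.

  For \<open>n > m\<close> the bound is attained by \<open>A(x) + B(y)\<close>. For \<open>n = m\<close> start from an arrangement of \<open>n\<close> lines
  and add a small multiple of a form of degree \<open>n + 1\<close>: near infinity this creates a well between any
  two consecutive zeros of the old leading form, and one at each narrow pair of complex zeros of the
  new one.
\<close>

section \<open>Bivariate polynomials\<close>

text \<open>The hypotheses allow degenerate centers and multiple zeros of the leading form; the
  quotient ring of the given \<open>H\<close> may then be infinite-dimensional, so nothing can be
  counted there directly. Wells turn centers into something that survives a passage to the generic
  case. That passage must keep the real zeros of the leading form, since the bound decreases with
  \<open>r\<close>. The quotient has dimension at most n m. For n = m the low-degree space consists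
  of all polynomials of degree below n, of dimension n (n + 1) / 2, cut down by one real condition
  for each of the at most (n + 1 - r) / 2 conjugate pairs of zeros of the leading form; what remains
  of n^2 is (n^2 + 1 - r) / 2. For n > m it is spanned by at least (n m - 1) / 2 monomials of an n
  by m box, and the form vanishes on it. In the construction for n = m, each passage from degree d
  to d + 1 gives d - 1 wells in the gaps, n (n - 1) / 2 altogether; the conjugate pairs supply the
  rest. The set of centers is not known to be finite beforehand, so the estimates are made for
  finite subsets.\<close>

definition bidegree_less :: "nat \<Rightarrow> poly_xy \<Rightarrow> bool" where
  "bidegree_less d p \<longleftrightarrow> (\<forall>i j. d \<le> i + j \<longrightarrow> coeff (coeff p i) j = 0)"

definition mono_xy :: "nat \<Rightarrow> nat \<Rightarrow> real \<Rightarrow> poly_xy" where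
  "mono_xy i j c = monom (monom c j) i"

text \<open>The reason for a strict degree bound: zero gets the bound 0, so truncated differences
  such as \<open>s - n\<close> force a multiplier to vanish exactly when its degree bound would be
  negative.\<close>

lemma bidegree_less_0_iff: "bidegree_less 0 p \<longleftrightarrow> p = 0"
  by (auto simp: bidegree_less_def intro!: poly_eqI)

lemma bidegree_less_mono: "bidegree_less d p \<Longrightarrow> d \<le> e \<Longrightarrow> bidegree_less e p"
  unfolding bidegree_less_def by (meson le_trans)

lemma bidegree_less_zero [simp]: "bidegree_less d 0"
  by (simp add: bidegree_less_def)

lemma bidegree_less_add: "bidegree_less d p \<Longrightarrow> bidegree_less d q \<Longrightarrow> bidegree_less d (p + q)"
  by (simp add: bidegree_less_def)

lemma bidegree_less_diff: "bidegree_less d p \<Longrightarrow> bidegree_less d q \<Longrightarrow> bidegree_less d (p - q)"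
  by (simp add: bidegree_less_def)

lemma bidegree_less_sum: "(\<And>i. i \<in> A \<Longrightarrow> bidegree_less d (f i)) \<Longrightarrow> bidegree_less d (sum f A)"
  by (induction A rule: infinite_finite_induct) (auto intro: bidegree_less_add)

lemma coeff_mono_xy: "coeff (coeff (mono_xy i j c) k) l = (if k = i \<and> l = j then c else 0)"
  by (simp add: mono_xy_def)

lemma bidegree_less_mono_xy: "i + j < d \<Longrightarrow> bidegree_less d (mono_xy i j c)"
  by (auto simp: bidegree_less_def coeff_mono_xy)

lemma mono_xy_mult: "mono_xy i j c * mono_xy k l d = mono_xy (i + k) (j + l) (c * d)"
  by (simp add: mono_xy_def mult_monom)

lemma eval_xy_mono: "eval_xy (mono_xy i j c) x y = c * x ^ j * y ^ i"
  by (simp add: mono_xy_def eval_xy_def poly_monom poly_power)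

text \<open>The bound is \<open>Suc d\<close> on one side only: degree at most d plus degree below e
  is below d + e. This also covers a second factor that is zero.\<close>

lemma bidegree_less_mult:
  assumes "bidegree_less (Suc d) p" "bidegree_less e q"
  shows "bidegree_less (d + e) (p * q)"
  unfolding bidegree_less_def
proof (intro allI impI)
  fix i j assume ij: "d + e \<le> i + j"
  have "coeff (coeff p k) l * coeff (coeff q (i - k)) (j - l) = 0" if "k \<le> i" "l \<le> j" for k l
  proof (cases "Suc d \<le> k + l")
    case True then show ?thesis using assms by (simp add: bidegree_less_def)
  next
    case False
    then have "e \<le> (i - k) + (j - l)" using that ij by linarith
    then show ?thesis using assms by (simp add: bidegree_less_def)
  qed
  then show "coeff (coeff (p * q) i) j = 0"
    by (auto simp: coeff_mult coeff_sum intro!: sum.neutral)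
qed

lemma sum_mono_xy_eq:
  assumes "bidegree_less d p"
  shows "p = (\<Sum>i<d. \<Sum>j<d. mono_xy i j (coeff (coeff p i) j))"
proof (intro poly_eqI)
  fix i j
  have "coeff (coeff (\<Sum>i<d. \<Sum>j<d. mono_xy i j (coeff (coeff p i) j)) i) j =
    (\<Sum>k<d. \<Sum>l<d. if i = k \<and> j = l then coeff (coeff p k) l else 0)"
    by (simp add: coeff_sum coeff_mono_xy)
  also have "\<dots> = (\<Sum>k<d. if i = k then (\<Sum>l<d. if j = l then coeff (coeff p k) l else 0) else 0)"
    by (intro sum.cong) auto
  also have "\<dots> = (if i < d \<and> j < d then coeff (coeff p i) j else 0)"
    by (simp add: sum.delta)
  also have "\<dots> = coeff (coeff p i) j" using assms by (auto simp: bidegree_less_def)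
  finally show "coeff (coeff p i) j = coeff (coeff (\<Sum>i<d. \<Sum>j<d. mono_xy i j (coeff (coeff p i) j)) i) j" ..
qed

text \<open>For properties preserved by sums it suffices to treat monomials within the degree
  bound.\<close>

lemma bidegree_less_induct [consumes 1, case_names zero mono add]:
  assumes "bidegree_less d p" and "P 0"
    and "\<And>i j c. i + j < d \<Longrightarrow> P (mono_xy i j c)"
    and add: "\<And>p q. P p \<Longrightarrow> P q \<Longrightarrow> P (p + q)"
  shows "P p"
proof -
  have sumP: "(\<And>i. i \<in> A \<Longrightarrow> P (f i)) \<Longrightarrow> P (sum f A)" for f and A :: "nat set"
    by (induction A rule: infinite_finite_induct) (auto intro: assms(2) add)
  have "P (mono_xy i j (coeff (coeff p i) j))" for i j
  proof (cases "i + j < d")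
    case False
    then have "mono_xy i j (coeff (coeff p i) j) = 0"
      using assms(1) by (simp add: bidegree_less_def mono_xy_def)
    then show ?thesis using assms(2) by simp
  qed (rule assms(3))
  then show ?thesis
    by (subst sum_mono_xy_eq[OF assms(1)]) (intro sumP)
qed

lemma ex_bidegree_less: "\<exists>d. bidegree_less d p"
  using coeff_above_total_degree[of p]
  by (intro exI[of _ "Suc (total_degree p)"]) (auto simp: bidegree_less_def)

lemma bidegree_less_total_degree: "bidegree_less (Suc (total_degree p)) p"
  using coeff_above_total_degree[of p] by (auto simp: bidegree_less_def)

lemma total_degree_eqI:
  assumes "bidegree_less (Suc d) p" "coeff (coeff p i) j \<noteq> 0" "i + j = d"
  shows "total_degree p = d"
  unfolding total_degree_def
proof (rule Least_equality)
  show "\<forall>i j. d < i + j \<longrightarrow> coeff (coeff p i) j = 0" using assms(1) by (auto simp: bidegree_less_def)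
next
  fix e assume "\<forall>i j. e < i + j \<longrightarrow> coeff (coeff p i) j = 0"
  then show "d \<le> e" using assms(2,3) by (meson not_le)
qed

lemma total_degree_top:
  assumes "total_degree p = Suc d"
  shows "\<exists>i j. i + j = Suc d \<and> coeff (coeff p i) j \<noteq> 0"
proof (rule ccontr)
  assume *: "\<not> ?thesis"
  have "\<forall>i j. d < i + j \<longrightarrow> coeff (coeff p i) j = 0"
  proof (intro allI impI)
    fix i j assume "d < i + j"
    then consider "i + j = Suc d" | "total_degree p < i + j" using assms by linarith
    then show "coeff (coeff p i) j = 0" using * by cases (auto intro: coeff_above_total_degree)
  qed
  then have "total_degree p \<le> d" unfolding total_degree_def by (rule Least_le)
  then show False using assms by simp
qed

text \<open>The homogeneous part of degree \<open>d\<close> in the affine coordinate \<open>t = y / x\<close>.\<close>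

definition top_form :: "nat \<Rightarrow> poly_xy \<Rightarrow> real poly" where
  "top_form d p = (\<Sum>i\<le>d. monom (coeff (coeff p i) (d - i)) i)"

lemma coeff_top_form: "coeff (top_form d p) i = (if i \<le> d then coeff (coeff p i) (d - i) else 0)"
  by (simp add: top_form_def coeff_sum if_distrib cong: if_cong)

lemma degree_top_form: "degree (top_form d p) \<le> d"
  by (rule degree_le) (simp add: coeff_top_form)

lemma top_form_add: "top_form d (p + q) = top_form d p + top_form d q"
  by (rule poly_eqI) (simp add: coeff_top_form)

lemma top_form_diff: "top_form d (p - q) = top_form d p - top_form d q"
  by (rule poly_eqI) (simp add: coeff_top_form)

lemma top_form_minus: "top_form d (- p) = - top_form d p"
  by (rule poly_eqI) (simp add: coeff_top_form)

lemma top_form_0 [simp]: "top_form d 0 = 0"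
  by (rule poly_eqI) (simp add: coeff_top_form)

lemma top_form_sum: "top_form d (sum f A) = (\<Sum>i\<in>A. top_form d (f i))"
  by (induction A rule: infinite_finite_induct) (auto simp: top_form_add)

lemma top_form_eq_0: "bidegree_less d p \<Longrightarrow> d \<le> e \<Longrightarrow> top_form e p = 0"
  by (rule poly_eqI) (auto simp: coeff_top_form bidegree_less_def)

lemma top_form_mono_xy: "top_form d (mono_xy i j c) = (if i + j = d then monom c i else 0)"
  by (rule poly_eqI) (auto simp: coeff_top_form coeff_mono_xy)

lemma bidegree_less_pred:
  assumes "bidegree_less (Suc d) p" "top_form d p = 0"
  shows "bidegree_less d p"
  unfolding bidegree_less_def
proof (intro allI impI)
  fix i j assume "d \<le> i + j"
  then consider "i + j = d" | "Suc d \<le> i + j" by linarith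
  then show "coeff (coeff p i) j = 0"
  proof cases
    case 1
    then have "coeff (top_form d p) i = coeff (coeff p i) j" by (auto simp: coeff_top_form)
    then show ?thesis using assms by simp
  qed (use assms in \<open>auto simp: bidegree_less_def\<close>)
qed

lemma top_form_mult:
  assumes p: "bidegree_less (Suc d) p" and q: "bidegree_less (Suc e) q"
  shows "top_form (d + e) (p * q) = top_form d p * top_form e q"
  using p
proof (induction rule: bidegree_less_induct)
  case zero
  then show ?case by simp
next
  case (mono i j c)
  show ?case using q
  proof (induction rule: bidegree_less_induct)
    case zero
    then show ?case by simp
  next
    case (mono k l c')
    then show ?case using \<open>i + j < Suc d\<close>
      by (auto simp: mono_xy_mult top_form_mono_xy mult_monom)
  next
    case (add p q)
    then show ?case by (simp add: top_form_add algebra_simps)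
  qed
next
  case (add p q)
  then show ?case by (simp add: top_form_add algebra_simps)
qed

definition form_xy :: "nat \<Rightarrow> real poly \<Rightarrow> poly_xy" where
  "form_xy d p = (\<Sum>i\<le>d. mono_xy i (d - i) (coeff p i))"

lemma bidegree_less_form_xy: "bidegree_less (Suc d) (form_xy d p)"
  unfolding form_xy_def by (intro bidegree_less_sum bidegree_less_mono_xy) auto

lemma top_form_form_xy: "degree p \<le> d \<Longrightarrow> top_form d (form_xy d p) = p"
  unfolding form_xy_def top_form_sum
  by (rule poly_eqI) (auto simp: coeff_sum top_form_mono_xy coeff_eq_0)

section \<open>Evaluation and partial derivatives\<close>

lemma eval_xy_add: "eval_xy (p + q) x y = eval_xy p x y + eval_xy q x y"
  by (simp add: eval_xy_def)

lemma eval_xy_diff: "eval_xy (p - q) x y = eval_xy p x y - eval_xy q x y"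
  by (simp add: eval_xy_def)

lemma eval_xy_minus: "eval_xy (- p) x y = - eval_xy p x y"
  by (simp add: eval_xy_def)

lemma eval_xy_mult: "eval_xy (p * q) x y = eval_xy p x y * eval_xy q x y"
  by (simp add: eval_xy_def)

lemma eval_xy_0 [simp]: "eval_xy 0 x y = 0"
  by (simp add: eval_xy_def)

lemma eval_xy_pCons: "eval_xy (pCons a p) x y = poly a x + y * eval_xy p x y"
  by (simp add: eval_xy_def)

lemma eval_xy_sum: "eval_xy (sum f A) x y = (\<Sum>i\<in>A. eval_xy (f i) x y)"
  by (induction A rule: infinite_finite_induct) (auto simp: eval_xy_add)

lemma deriv_x_pCons: "deriv_x (pCons a p) = pCons (pderiv a) (deriv_x p)"
  unfolding deriv_x_def by (rule poly_eqI) (simp add: coeff_map_poly coeff_pCons split: nat.split)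

lemma deriv_y_pCons: "deriv_y (pCons a p) = p + pCons 0 (deriv_y p)"
  by (simp add: deriv_y_def pderiv_pCons)

lemma coeff_deriv_x: "coeff (coeff (deriv_x p) i) j = real (Suc j) * coeff (coeff p i) (Suc j)"
  by (simp add: deriv_x_def coeff_map_poly coeff_pderiv)

lemma coeff_deriv_y: "coeff (coeff (deriv_y p) i) j = real (Suc i) * coeff (coeff p (Suc i)) j"
  by (simp add: deriv_y_def coeff_pderiv flip: of_nat_Suc) (simp add: of_nat_poly)

lemma deriv_x_add: "deriv_x (p + q) = deriv_x p + deriv_x q"
  by (intro poly_eqI) (simp add: coeff_deriv_x algebra_simps)

lemma deriv_y_add: "deriv_y (p + q) = deriv_y p + deriv_y q"
  by (simp add: deriv_y_def pderiv_add)

lemma deriv_x_0 [simp]: "deriv_x 0 = 0"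
  by (simp add: deriv_x_def)

lemma deriv_y_0 [simp]: "deriv_y 0 = 0"
  by (simp add: deriv_y_def)

lemma deriv_x_mono_xy: "deriv_x (mono_xy i j c) = mono_xy i (j - 1) (real j * c)"
  by (intro poly_eqI) (auto simp: coeff_deriv_x coeff_mono_xy)

lemma deriv_y_mono_xy: "deriv_y (mono_xy i j c) = mono_xy (i - 1) j (real i * c)"
  by (intro poly_eqI) (auto simp: coeff_deriv_y coeff_mono_xy)

lemma bidegree_less_deriv_x: "bidegree_less (Suc d) p \<Longrightarrow> bidegree_less d (deriv_x p)"
  by (simp add: bidegree_less_def coeff_deriv_x)

lemma bidegree_less_deriv_y: "bidegree_less (Suc d) p \<Longrightarrow> bidegree_less d (deriv_y p)"
  by (simp add: bidegree_less_def coeff_deriv_y)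

lemma deriv_x_y_commute: "deriv_x (deriv_y p) = deriv_y (deriv_x p)"
  by (intro poly_eqI) (simp add: coeff_deriv_x coeff_deriv_y)

lemma eval_xy_has_derivative:
  "((\<lambda>z. eval_xy p (fst z) (snd z)) has_derivative
    (\<lambda>h. eval_xy (deriv_x p) (fst z) (snd z) * fst h + eval_xy (deriv_y p) (fst z) (snd z) * snd h)) (at z)"
proof (induction p)
  case 0
  then show ?case by simp
next
  case (pCons a p)
  have a: "((\<lambda>z. poly a (fst z)) has_derivative (\<lambda>h. poly (pderiv a) (fst z) * fst h)) (at z)"
    using DERIV_compose_FDERIV[OF poly_DERIV[of a "fst z"] has_derivative_fst[OF has_derivative_ident], of UNIV]
    by (simp add: mult.commute)
  show ?case unfolding eval_xy_pCons deriv_x_pCons deriv_y_pCons eval_xy_add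
    by (rule derivative_eq_intros a pCons.IH refl)+ (simp add: fun_eq_iff algebra_simps)
qed

lemma continuous_on_eval_xy: "continuous_on S (\<lambda>z. eval_xy p (fst z) (snd z))"
  by (intro continuous_at_imp_continuous_on ballI) (rule has_derivative_continuous[OF eval_xy_has_derivative])

lemma continuous_on_eval_xy' [continuous_intros]:
  "continuous_on S f \<Longrightarrow> continuous_on S g \<Longrightarrow> continuous_on S (\<lambda>z. eval_xy p (f z) (g z))"
  using continuous_on_compose2[OF continuous_on_eval_xy[of UNIV p] continuous_on_Pair[of S f g]] by simp

lemma eval_xy_DERIV:
  assumes "(f has_real_derivative f') (at s within S)" "(g has_real_derivative g') (at s within S)"
  shows "((\<lambda>s. eval_xy p (f s) (g s)) has_real_derivative
    (eval_xy (deriv_x p) (f s) (g s) * f' + eval_xy (deriv_y p) (f s) (g s) * g')) (at s within S)"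
proof -
  have "((\<lambda>s. (f s, g s)) has_derivative (\<lambda>h. (f' * h, g' * h))) (at s within S)"
    using assms by (auto simp: has_field_derivative_def intro: has_derivative_Pair)
  from has_derivative_compose[OF this eval_xy_has_derivative[of p "(f s, g s)"]]
  have "((\<lambda>s. eval_xy p (f s) (g s)) has_derivative
    (\<lambda>h. eval_xy (deriv_x p) (f s) (g s) * (f' * h) + eval_xy (deriv_y p) (f s) (g s) * (g' * h))) (at s within S)"
    by simp
  then show ?thesis unfolding has_field_derivative_def
    by (rule back_subst[where P = "\<lambda>D. (_ has_derivative D) _"]) (auto simp: fun_eq_iff algebra_simps)
qed

text \<open>Each monomial is telescoped first from x to a and then from y to b, so division by x - a
  and y - b does not raise the degree of the products. The values of the quotients at the point are
  the partial derivatives; a determinant of such quotients therefore evaluates to a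
  Jacobian.\<close>

lemma hadamard_xy:
  assumes "bidegree_less (Suc n) f" "eval_xy f a b = 0"
  obtains f1 f2 where "bidegree_less n f1" "bidegree_less n f2"
    "f = f1 * (mono_xy 0 1 1 - mono_xy 0 0 a) + f2 * (mono_xy 1 0 1 - mono_xy 0 0 b)"
    "eval_xy f1 a b = eval_xy (deriv_x f) a b" "eval_xy f2 a b = eval_xy (deriv_y f) a b"
proof -
  let ?X = "mono_xy 0 1 1 - mono_xy 0 0 a" and ?Y = "mono_xy 1 0 1 - mono_xy 0 0 b"
  let ?P = "\<lambda>f. \<exists>f1 f2. bidegree_less n f1 \<and> bidegree_less n f2 \<and>
     f = f1 * ?X + f2 * ?Y + mono_xy 0 0 (eval_xy f a b) \<and>
     eval_xy f1 a b = eval_xy (deriv_x f) a b \<and> eval_xy f2 a b = eval_xy (deriv_y f) a b"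
  have "?P f" using assms(1)
  proof (induction rule: bidegree_less_induct)
    case zero
    then show ?case by (intro exI[of _ 0]) (simp add: mono_xy_def)
  next
    case (mono i j c)
    let ?f1 = "\<Sum>l<j. mono_xy i l (c * a ^ (j - Suc l))" and ?f2 = "\<Sum>l<i. mono_xy l 0 (c * a ^ j * b ^ (i - Suc l))"
    have telx: "(\<Sum>l<j. mono_xy i (Suc l) (c * a ^ (j - Suc l)) - mono_xy i l (c * a ^ (j - l))) = mono_xy i j c - mono_xy i 0 (c * a ^ j)"
      using sum_lessThan_telescope[of "\<lambda>l. mono_xy i l (c * a ^ (j - l))" j] by simp
    have tely: "(\<Sum>l<i. mono_xy (Suc l) 0 (c * a ^ j * b ^ (i - Suc l)) - mono_xy l 0 (c * a ^ j * b ^ (i - l)))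
        = mono_xy i 0 (c * a ^ j) - mono_xy 0 0 (c * a ^ j * b ^ i)"
      using sum_lessThan_telescope[of "\<lambda>l. mono_xy l 0 (c * a ^ j * b ^ (i - l))" i] by simp
    have 1: "?f1 * ?X = mono_xy i j c - mono_xy i 0 (c * a ^ j)"
      unfolding telx[symmetric] sum_distrib_right
      by (intro sum.cong refl) (auto simp: right_diff_distrib mono_xy_mult Suc_diff_Suc mult.assoc simp flip: power_Suc2)
    have 2: "?f2 * ?Y = mono_xy i 0 (c * a ^ j) - mono_xy 0 0 (c * a ^ j * b ^ i)"
      unfolding tely[symmetric] sum_distrib_right
      by (intro sum.cong refl) (auto simp: right_diff_distrib mono_xy_mult Suc_diff_Suc mult.assoc simp flip: power_Suc2)
    have 3: "eval_xy ?f1 a b = eval_xy (deriv_x (mono_xy i j c)) a b"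
    proof -
      have "eval_xy ?f1 a b = (\<Sum>l<j. c * b ^ i * a ^ (j - 1))"
        unfolding eval_xy_sum
      proof (intro sum.cong refl)
        fix l assume "l \<in> {..<j}"
        then have "j - 1 = (j - Suc l) + l" by auto
        then show "eval_xy (mono_xy i l (c * a ^ (j - Suc l))) a b = c * b ^ i * a ^ (j - 1)"
          by (simp only: power_add eval_xy_mono) simp
      qed
      then show ?thesis by (simp add: deriv_x_mono_xy eval_xy_mono)
    qed
    have 4: "eval_xy ?f2 a b = eval_xy (deriv_y (mono_xy i j c)) a b"
    proof -
      have "eval_xy ?f2 a b = (\<Sum>l<i. c * a ^ j * b ^ (i - 1))"
        unfolding eval_xy_sum
      proof (intro sum.cong refl)
        fix l assume "l \<in> {..<i}"
        then have "i - 1 = (i - Suc l) + l" by auto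
        then show "eval_xy (mono_xy l 0 (c * a ^ j * b ^ (i - Suc l))) a b = c * a ^ j * b ^ (i - 1)"
          by (simp only: power_add eval_xy_mono) simp
      qed
      then show ?thesis by (simp add: deriv_y_mono_xy eval_xy_mono)
    qed
    show ?case
      using mono 1 2 3 4
      by (intro exI[of _ ?f1] exI[of _ ?f2] conjI bidegree_less_sum bidegree_less_mono_xy)
        (auto simp: eval_xy_mono)
  next
    case (add p q)
    then obtain p1 p2 q1 q2 where
      "bidegree_less n p1" "bidegree_less n p2" "p = p1 * ?X + p2 * ?Y + mono_xy 0 0 (eval_xy p a b)"
      "eval_xy p1 a b = eval_xy (deriv_x p) a b" "eval_xy p2 a b = eval_xy (deriv_y p) a b"
      "bidegree_less n q1" "bidegree_less n q2" "q = q1 * ?X + q2 * ?Y + mono_xy 0 0 (eval_xy q a b)"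
      "eval_xy q1 a b = eval_xy (deriv_x q) a b" "eval_xy q2 a b = eval_xy (deriv_y q) a b"
      by blast
    moreover have "mono_xy 0 0 (eval_xy (p + q) a b) = mono_xy 0 0 (eval_xy p a b) + mono_xy 0 0 (eval_xy q a b)"
      by (simp add: mono_xy_def eval_xy_add add_monom)
    ultimately show ?case
      by (intro exI[of _ "p1 + q1"] exI[of _ "p2 + q2"])
        (auto simp: bidegree_less_add eval_xy_add deriv_x_add deriv_y_add algebra_simps)
  qed
  then show thesis using that assms(2) by (auto simp: mono_xy_def)
qed

section \<open>The residue form\<close>

text \<open>Gaussian elimination, by induction on the equations. Index sets of arbitrary type are
  allowed because the later system collects unknowns and equations of different kinds in disjoint
  sums.\<close>

lemma underdetermined_system:
  fixes a :: "'i \<Rightarrow> 'j \<Rightarrow> real"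
  assumes "finite I" "finite J" "card I < card J"
  shows "\<exists>c. (\<exists>j\<in>J. c j \<noteq> 0) \<and> (\<forall>i\<in>I. (\<Sum>j\<in>J. a i j * c j) = 0)"
  using assms
proof (induction I arbitrary: J a rule: finite_induct)
  case empty
  then obtain j where "j \<in> J" by fastforce
  then show ?case by (intro exI[of _ "\<lambda>_. 1"]) auto
next
  case (insert i I)
  show ?case
  proof (cases "\<forall>j\<in>J. a i j = 0")
    case True
    then show ?thesis using insert.IH[of J a] insert.prems insert.hyps by auto
  next
    case False
    then obtain k where k: "k \<in> J" "a i k \<noteq> 0" by auto
    \<comment> \<open>The unknown \<open>k\<close> is eliminated from the remaining equations with
      the pivot \<open>a i k\<close>.\<close>
    let ?J = "J - {k}" and ?b = "\<lambda>l j. a l j - a l k * a i j / a i k"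
    have "card I < card ?J" using insert k by (simp add: card_Diff_singleton)
    then obtain c where c: "\<exists>j\<in>?J. c j \<noteq> 0" "\<forall>l\<in>I. (\<Sum>j\<in>?J. ?b l j * c j) = 0"
      using insert.IH[of ?J ?b] insert.prems by auto
    let ?d = "c(k := - (\<Sum>j\<in>?J. a i j * c j) / a i k)"
    have split: "(\<Sum>j\<in>J. a l j * ?d j) = a l k * ?d k + (\<Sum>j\<in>?J. a l j * c j)" for l
      using k insert.prems by (subst sum.remove[of J k]) (auto intro!: sum.cong)
    have "(\<Sum>j\<in>J. a l j * ?d j) = (\<Sum>j\<in>?J. ?b l j * c j)" for l
      unfolding split by (simp add: sum_subtractf left_diff_distrib sum_distrib_left sum_divide_distrib[symmetric] mult.assoc)
    moreover have "(\<Sum>j\<in>J. a i j * ?d j) = 0"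
      unfolding split using k by simp
    ultimately show ?thesis using c by (intro exI[of _ ?d]) auto
  qed
qed

section \<open>Degrees of multipliers in the ideal of f and g\<close>

lemma mono_xy_0_mult_coeff: "coeff (coeff (mono_xy 0 0 c * p) i) j = c * coeff (coeff p i) j"
  by (simp add: mono_xy_def monom_0)

lemma bidegree_less_scale: "bidegree_less d p \<Longrightarrow> bidegree_less d (mono_xy 0 0 c * p)"
  by (simp add: bidegree_less_def mono_xy_0_mult_coeff)

text \<open>If the sum has lower degree than its two summands, their leading forms cancel: A F + B G
  = 0. Coprimality makes this a multiple c of the trivial relation between F and G, which is removed
  by a multiplier \<open>e\<close> with leading form c. The assumption \<open>deg\<close> says that
  F has no zero in the direction x = 0, so coprimality in the affine coordinate is coprimality of
  forms.\<close>

lemma ideal_degree_step: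
  assumes f: "bidegree_less (Suc n) f" and g: "bidegree_less (Suc m) g"
    and deg: "degree (top_form n f) = n" and co: "coprime (top_form n f) (top_form m g)" and n: "1 \<le> n"
    and a: "bidegree_less (Suc v - n) a" and b: "bidegree_less (Suc v - m) b"
    and s: "bidegree_less v (a * f + b * g)"
  shows "\<exists>e. bidegree_less (v - n) (a + e * g) \<and> bidegree_less (v - m) (b - e * f) \<and> (v < n + m \<longrightarrow> e = 0)"
proof -
  let ?F = "top_form n f" and ?G = "top_form m g"
  \<comment> \<open>For v < n the difference \<open>v - n\<close> truncates to 0; there
    \<open>a\<close> is zero and A has to be zero as well. The same holds for B.\<close>
  define A where "A = (if n \<le> v then top_form (v - n) a else 0)"
  define B where "B = (if m \<le> v then top_form (v - m) b else 0)"
  have A: "top_form v (a * f) = A * ?F"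
  proof (cases "n \<le> v")
    case True
    then show ?thesis using top_form_mult[of "v - n" a n f] a f by (simp add: A_def Suc_diff_le)
  next
    case False then show ?thesis using a by (simp add: A_def bidegree_less_0_iff)
  qed
  have B: "top_form v (b * g) = B * ?G"
  proof (cases "m \<le> v")
    case True
    then show ?thesis using top_form_mult[of "v - m" b m g] b g by (simp add: B_def Suc_diff_le)
  next
    case False then show ?thesis using b by (simp add: B_def bidegree_less_0_iff)
  qed
  have F0: "?F \<noteq> 0" using deg n by auto
  have AB: "A * ?F + B * ?G = 0"
    using top_form_eq_0[OF s, of v] by (simp add: top_form_add A B)
  then have "B * ?G = ?F * (- A)" by (simp add: algebra_simps add_eq_0_iff)
  then have "?F dvd B * ?G" by (metis dvd_triv_left)
  then have "?F dvd B" using co by (metis coprime_dvd_mult_left_iff)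
  then obtain c where c: "B = ?F * c" by (auto elim: dvdE)
  then have "?F * (A + c * ?G) = 0" using AB by (simp add: algebra_simps)
  then have Ac: "A = - (c * ?G)" using F0 by (simp add: add_eq_0_iff2)
  show ?thesis
  proof (cases "v < n + m")
    case True
    \<comment> \<open>B is divisible by F, of degree n, but has degree at most v - m < n.\<close>
    have c0: "c = 0"
    proof (rule ccontr)
      assume "c \<noteq> 0"
      then have "degree B = n + degree c" "B \<noteq> 0" using c F0 deg by (auto simp: degree_mult_eq)
      moreover from \<open>B \<noteq> 0\<close> have "m \<le> v" "degree B \<le> v - m"
        by (auto simp: B_def degree_top_form split: if_splits)
      ultimately show False using True by linarith
    qed
    then have "A = 0" "B = 0" using Ac c by auto
    then have "bidegree_less (v - n) a" "bidegree_less (v - m) b"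
      using bidegree_less_pred[of "v - n" a] bidegree_less_pred[of "v - m" b] a b
      by (cases "n \<le> v"; cases "m \<le> v"; simp add: A_def B_def Suc_diff_le)+
    then show ?thesis by (intro exI[of _ 0]) auto
  next
    case False
    define e where "e = form_xy (v - n - m) c"
    have dc: "degree c \<le> v - n - m"
    proof (cases "c = 0")
      case False
      then have "degree B = n + degree c" using c F0 deg by (auto simp: degree_mult_eq)
      moreover have "degree B \<le> v - m" by (auto simp: B_def degree_top_form)
      ultimately show ?thesis by linarith
    qed simp
    have e: "bidegree_less (Suc (v - n - m)) e" "top_form (v - n - m) e = c"
      by (simp_all only: e_def bidegree_less_form_xy top_form_form_xy[OF dc])
    have eg: "bidegree_less (Suc (v - n)) (e * g)" "top_form (v - n) (e * g) = c * ?G"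
      using bidegree_less_mult[OF e(1) g] top_form_mult[OF e(1) g] e(2) False by auto
    have "v - n - m + n = v - m" using False by auto
    then have ef: "bidegree_less (Suc (v - m)) (e * f)" "top_form (v - m) (e * f) = c * ?F"
      using bidegree_less_mult[OF e(1) f] top_form_mult[OF e(1) f] e(2) by (auto simp only: add_Suc_right)
    have "bidegree_less (v - n) (a + e * g)"
    proof (rule bidegree_less_pred)
      show "bidegree_less (Suc (v - n)) (a + e * g)" using eg a False by (auto intro!: bidegree_less_add simp: Suc_diff_le)
      show "top_form (v - n) (a + e * g) = 0" using Ac False eg by (auto simp: top_form_add A_def)
    qed
    moreover have "bidegree_less (v - m) (b - e * f)"
    proof (rule bidegree_less_pred)
      show "bidegree_less (Suc (v - m)) (b - e * f)" using ef b False by (auto intro!: bidegree_less_diff simp: Suc_diff_le)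
      show "top_form (v - m) (b - e * f) = 0" using c False ef by (auto simp: top_form_diff B_def mult.commute)
    qed
    ultimately show ?thesis using False by auto
  qed
qed

text \<open>Descent from an arbitrary representation: each application of
  \<open>ideal_degree_step\<close> lowers the degree bound of the summands by one, until it reaches
  that of the sum.\<close>

lemma ideal_degree_bound:
  assumes f: "bidegree_less (Suc n) f" and g: "bidegree_less (Suc m) g"
    and deg: "degree (top_form n f) = n" and co: "coprime (top_form n f) (top_form m g)" and n: "1 \<le> n"
    and s: "bidegree_less s (a * f + b * g)"
  obtains a' b' where "a' * f + b' * g = a * f + b * g" "bidegree_less (s - n) a'" "bidegree_less (s - m) b'"
proof -
  have *: "\<exists>a' b'. a' * f + b' * g = a * f + b * g \<and> bidegree_less (s - n) a' \<and> bidegree_less (s - m) b'"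
    if "bidegree_less (s + k - n) a" "bidegree_less (s + k - m) b" "bidegree_less s (a * f + b * g)" for k a b
    using that
  proof (induction k arbitrary: a b)
    case 0
    then show ?case by auto
  next
    case (Suc k)
    have "bidegree_less (s + k) (a * f + b * g)" using Suc.prems(3) by (rule bidegree_less_mono) simp
    then obtain e where e: "bidegree_less (s + k - n) (a + e * g)" "bidegree_less (s + k - m) (b - e * f)"
      using ideal_degree_step[OF f g deg co n, of "s + k" a b] Suc.prems by auto
    have eq: "(a + e * g) * f + (b - e * f) * g = a * f + b * g" by (simp add: algebra_simps)
    show ?case using Suc.IH[OF e] Suc.prems(3) unfolding eq by blast
  qed
  obtain d1 d2 where "bidegree_less d1 a" "bidegree_less d2 b" using ex_bidegree_less by blast
  then have "bidegree_less (s + (d1 + d2 + n + m) - n) a" "bidegree_less (s + (d1 + d2 + n + m) - m) b"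
    by (auto elim!: bidegree_less_mono)
  from *[OF this s] show thesis using that by blast
qed

text \<open>All degrees that occur are below n + m, where the trivial relation between f and g
  cannot enter. The descent thus leaves the multipliers unchanged while their degree bounds go down
  to 0.\<close>

lemma ideal_representation_zero:
  assumes f: "bidegree_less (Suc n) f" and g: "bidegree_less (Suc m) g"
    and deg: "degree (top_form n f) = n" and co: "coprime (top_form n f) (top_form m g)" and n: "1 \<le> n" "1 \<le> m"
    and "a * f + b * g = 0" "bidegree_less (m - 1) a" "bidegree_less (n - 1) b"
  shows "a = 0 \<and> b = 0"
proof -
  have "bidegree_less (n + m - 1 - k - n) a \<and> bidegree_less (n + m - 1 - k - m) b" if "k \<le> n + m - 1" for k
    using that
  proof (induction k)
    case 0
    have "n + m - 1 - 0 - n = m - 1" "n + m - 1 - 0 - m = n - 1" using n by auto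
    then show ?case using assms by simp
  next
    case (Suc k)
    define v where "v = n + m - 1 - Suc k"
    have v: "n + m - 1 - k = Suc v" using Suc.prems by (simp add: v_def)
    have "v < n + m" using v by simp
    then show ?case
      using ideal_degree_step[OF f g deg co n(1), of v a b] Suc assms(7) unfolding v v_def[symmetric] by auto
  qed
  from this[of "n + m - 1"] show ?thesis by (simp add: bidegree_less_0_iff)
qed

text \<open>
  For a common zero \<open>z\<close> of \<open>f\<close> and \<open>g\<close> write \<open>f = f1 (x - a) + f2 (y - b)\<close> and similarly for
  \<open>g\<close>. By Cramer's rule \<open>q = f1 g2 - f2 g1\<close> is annihilated by \<open>x - a\<close> and \<open>y - b\<close> modulo
  \<open>(f, g)\<close>, and the leading form of \<open>q\<close> does not depend on \<open>z\<close> modulo the leading forms of the ideal.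
\<close>

lemma local_idempotent:
  assumes f: "bidegree_less (Suc n) f" and g: "bidegree_less (Suc m) g" and nm: "1 \<le> n" "1 \<le> m"
    and zf: "eval_xy f a b = 0" and zg: "eval_xy g a b = 0"
    and lam_add: "\<And>p q. lam (p + q) = lam p + lam q"
    and lam_F: "\<And>p. degree p \<le> m - 1 \<Longrightarrow> lam (top_form n f * p) = k1 * coeff p (m - 1)"
    and lam_G: "\<And>p. degree p \<le> n - 1 \<Longrightarrow> lam (top_form m g * p) = k2 * coeff p (n - 1)"
  obtains q where "bidegree_less (n + m - 1) q"
    "eval_xy q a b = eval_xy (deriv_x f) a b * eval_xy (deriv_y g) a b - eval_xy (deriv_y f) a b * eval_xy (deriv_x g) a b"
    "lam (top_form (n + m - 2) q) = k1 * coeff (top_form m g) m - k2 * coeff (top_form n f) n"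
    "\<And>h. \<exists>\<alpha> \<beta>. (h - mono_xy 0 0 (eval_xy h a b)) * q = \<alpha> * f + \<beta> * g"
proof -
  let ?X = "mono_xy 0 1 1 - mono_xy 0 0 a" and ?Y = "mono_xy 1 0 1 - mono_xy 0 0 b"
  obtain f1 f2 where f12: "bidegree_less n f1" "bidegree_less n f2" "f = f1 * ?X + f2 * ?Y"
    "eval_xy f1 a b = eval_xy (deriv_x f) a b" "eval_xy f2 a b = eval_xy (deriv_y f) a b"
    using hadamard_xy[OF f zf] by metis
  obtain g1 g2 where g12: "bidegree_less m g1" "bidegree_less m g2" "g = g1 * ?X + g2 * ?Y"
    "eval_xy g1 a b = eval_xy (deriv_x g) a b" "eval_xy g2 a b = eval_xy (deriv_y g) a b"
    using hadamard_xy[OF g zg] by metis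
  define q where "q = f1 * g2 - f2 * g1"
  have Xq: "?X * q = g2 * f + (- f2) * g" unfolding q_def f12(3) g12(3) by (simp add: algebra_simps)
  have Yq: "?Y * q = (- g1) * f + f1 * g" unfolding q_def f12(3) g12(3) by (simp add: algebra_simps)
  have XY1: "top_form 1 ?X = 1" "top_form 1 ?Y = monom 1 1"
    by (auto simp: top_form_diff top_form_mono_xy)
  have XYb: "bidegree_less (Suc 1) ?X" "bidegree_less (Suc 1) ?Y"
    by (auto intro!: bidegree_less_diff bidegree_less_mono_xy)
  obtain n' m' where n': "n = Suc n'" "m = Suc m'" using nm by (metis Suc_le_D One_nat_def)
  have tf: "top_form n f = top_form n' f1 + top_form n' f2 * monom 1 1"
    using top_form_mult[of n' f1 1 ?X] top_form_mult[of n' f2 1 ?Y] XYb f12(1,2) XY1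
    unfolding f12(3) top_form_add n' by simp
  have tg: "top_form m g = top_form m' g1 + top_form m' g2 * monom 1 1"
    using top_form_mult[of m' g1 1 ?X] top_form_mult[of m' g2 1 ?Y] XYb g12(1,2) XY1
    unfolding g12(3) top_form_add n' by simp
  have "top_form (n + m - 2) q = top_form n' f1 * top_form m' g2 - top_form n' f2 * top_form m' g1"
    using top_form_mult[of n' f1 m' g2] top_form_mult[of n' f2 m' g1] f12(1,2) g12(1,2)
    unfolding q_def top_form_diff n' by simp
  \<comment> \<open>The equations \<open>tf\<close> and \<open>tg\<close> eliminate the leading
    forms of \<open>f1\<close> and \<open>g1\<close>. What is left is a combination of the two
    leading forms of the ideal, on which \<open>lam\<close> is prescribed.\<close>
  also have "\<dots> = top_form n f * top_form m' g2 + top_form m g * (- top_form n' f2)"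
    unfolding tf tg by (simp add: algebra_simps)
  finally have tq: "lam (top_form (n + m - 2) q) = lam (top_form n f * top_form m' g2) + lam (top_form m g * (- top_form n' f2))"
    by (simp only: lam_add)
  have X: "p * monom 1 (Suc 0) = pCons 0 p" for p :: "real poly" by (simp add: monom_Suc monom_0)
  have cg: "coeff (top_form m g) m = coeff (top_form m' g2) m'"
    unfolding tg by (simp add: X n' coeff_top_form)
  have cf: "coeff (top_form n f) n = coeff (top_form n' f2) n'"
    unfolding tf by (simp add: X n' coeff_top_form)
  show thesis
  proof
    show "bidegree_less (n + m - 1) q"
      using bidegree_less_mult[of n' f1 m g2] bidegree_less_mult[of n' f2 m g1] f12(1,2) g12(1,2) n'
      unfolding q_def by (auto intro: bidegree_less_diff)
    show "eval_xy q a b = eval_xy (deriv_x f) a b * eval_xy (deriv_y g) a b - eval_xy (deriv_y f) a b * eval_xy (deriv_x g) a b"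
      unfolding q_def by (simp add: eval_xy_diff eval_xy_mult f12 g12)
    show "lam (top_form (n + m - 2) q) = k1 * coeff (top_form m g) m - k2 * coeff (top_form n f) n"
      unfolding tq cg cf using lam_F[of "top_form m' g2"] lam_G[of "- top_form n' f2"] n'
      by (simp add: degree_top_form)
    fix h
    obtain d where d: "bidegree_less d h" using ex_bidegree_less by blast
    have "bidegree_less (Suc d) (h - mono_xy 0 0 (eval_xy h a b))"
      using d by (auto intro!: bidegree_less_diff bidegree_less_mono_xy elim: bidegree_less_mono)
    moreover have "eval_xy (h - mono_xy 0 0 (eval_xy h a b)) a b = 0" by (simp add: eval_xy_diff eval_xy_mono)
    ultimately obtain h1 h2 where h: "h - mono_xy 0 0 (eval_xy h a b) = h1 * ?X + h2 * ?Y"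
      using hadamard_xy by metis
    have "(h - mono_xy 0 0 (eval_xy h a b)) * q = h1 * (?X * q) + h2 * (?Y * q)" unfolding h by (simp add: algebra_simps)
    also have "\<dots> = (h1 * g2 - h2 * g1) * f + (h2 * f1 - h1 * f2) * g" unfolding Xq Yq by (simp add: algebra_simps)
    finally show "\<exists>\<alpha> \<beta>. (h - mono_xy 0 0 (eval_xy h a b)) * q = \<alpha> * f + \<beta> * g" by blast
  qed
qed

lemma card_triangle: "finite {(i, j). i + j < (d::nat)} \<and> card {(i, j). i + j < (d::nat)} = d * (d + 1) div 2"
proof -
  have eq: "{(i, j). i + j < (d::nat)} = Sigma {..<d} (\<lambda>i. {..<d - i})" by auto
  have "card {(i, j). i + j < (d::nat)} = (\<Sum>i<d. d - i)" unfolding eq by simp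
  also have "\<dots> = (\<Sum>i<d. Suc i)" by (subst sum.nat_diff_reindex[symmetric]) (auto intro!: sum.cong)
  also have "\<dots> = d * (d + 1) div 2" by (induction d) auto
  finally show ?thesis unfolding eq by auto
qed

text \<open>
  If \<open>card Z + card M\<close> were larger, some nonzero combination of \<open>h \<in> span M\<close>, the \<open>q z\<close>, and multiples
  of \<open>f\<close> and \<open>g\<close> would vanish for reasons of dimension. Evaluating at \<open>z\<close> gives the coefficient of \<open>q z\<close>,
  and then \<open>lam\<close> of the leading form of \<open>h\<^sup>2\<close> is a negative combination of the \<open>h(z)\<^sup>2\<close>.
\<close>

lemma critical_count_bound:
  fixes M :: "(nat \<times> nat) set" and \<mu> :: "'l \<Rightarrow> nat \<times> nat \<Rightarrow> real" and Z :: "(real \<times> real) set"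
  assumes f: "bidegree_less (Suc n) f" and g: "bidegree_less (Suc m) g"
    and deg: "degree (top_form n f) = n" and co: "coprime (top_form n f) (top_form m g)" and nm: "1 \<le> n" "1 \<le> m"
    and lam_add: "\<And>p q. lam (p + q) = lam p + lam q"
    and lam_smult: "\<And>c p. lam (smult c p) = c * lam p"
    and lam_F: "\<And>p. degree p \<le> m - 1 \<Longrightarrow> lam (top_form n f * p) = k1 * coeff p (m - 1)"
    and lam_G: "\<And>p. degree p \<le> n - 1 \<Longrightarrow> lam (top_form m g * p) = k2 * coeff p (n - 1)"
    and Z: "finite Z" "\<And>z. z \<in> Z \<Longrightarrow> eval_xy f (fst z) (snd z) = 0" "\<And>z. z \<in> Z \<Longrightarrow> eval_xy g (fst z) (snd z) = 0"
      "\<And>z. z \<in> Z \<Longrightarrow> (k1 * coeff (top_form m g) m - k2 * coeff (top_form n f) n) *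
         (eval_xy (deriv_x f) (fst z) (snd z) * eval_xy (deriv_y g) (fst z) (snd z)
          - eval_xy (deriv_y f) (fst z) (snd z) * eval_xy (deriv_x g) (fst z) (snd z)) < 0"
    and M: "finite M" "\<And>i j. (i, j) \<in> M \<Longrightarrow> 2 * (i + j) \<le> n + m - 2"
    and M_indep: "\<And>c \<alpha> \<beta>. (\<Sum>(i, j)\<in>M. mono_xy i j (c (i, j))) = \<alpha> * f + \<beta> * g \<Longrightarrow>
        (\<Sum>(i, j)\<in>M. mono_xy i j (c (i, j))) = 0"
    and L: "finite L"
    and pos: "\<And>c h. (\<And>l. l \<in> L \<Longrightarrow> (\<Sum>ij\<in>M. \<mu> l ij * c ij) = 0) \<Longrightarrow> h = (\<Sum>(i, j)\<in>M. mono_xy i j (c (i, j))) \<Longrightarrow>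
        0 \<le> lam (top_form (n + m - 2) (h * h))"
  shows "card Z + card M \<le> n * m + card L"
proof (rule ccontr)
  assume "\<not> ?thesis"
  then have big: "n * m + card L < card Z + card M" by simp
  let ?c0 = "k1 * coeff (top_form m g) m - k2 * coeff (top_form n f) n"
  define K where "K z = eval_xy (deriv_x f) (fst z) (snd z) * eval_xy (deriv_y g) (fst z) (snd z)
          - eval_xy (deriv_y f) (fst z) (snd z) * eval_xy (deriv_x g) (fst z) (snd z)" for z
  have "\<forall>z\<in>Z. \<exists>q. bidegree_less (n + m - 1) q \<and> eval_xy q (fst z) (snd z) = K z \<and>
    lam (top_form (n + m - 2) q) = ?c0 \<and>
    (\<forall>h. \<exists>\<alpha> \<beta>. (h - mono_xy 0 0 (eval_xy h (fst z) (snd z))) * q = \<alpha> * f + \<beta> * g)"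
    using local_idempotent[OF f g nm Z(2,3) lam_add lam_F lam_G] unfolding K_def by metis
  then obtain q where q: "\<And>z. z \<in> Z \<Longrightarrow> bidegree_less (n + m - 1) (q z)"
    "\<And>z. z \<in> Z \<Longrightarrow> eval_xy (q z) (fst z) (snd z) = K z"
    "\<And>z. z \<in> Z \<Longrightarrow> lam (top_form (n + m - 2) (q z)) = ?c0"
    "\<And>z h. z \<in> Z \<Longrightarrow> \<exists>\<alpha> \<beta>. (h - mono_xy 0 0 (eval_xy h (fst z) (snd z))) * q z = \<alpha> * f + \<beta> * g"
    by metis
  \<comment> \<open>Take the two coordinate functions for \<open>h\<close> in the annihilation
    property; at least one of them separates w from z.\<close>
  have q0: "eval_xy (q z) (fst w) (snd w) = 0" if zZ: "z \<in> Z" and "w \<in> Z" and wz: "w \<noteq> z" for z w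
  proof -
    have *: "(eval_xy h (fst w) (snd w) - eval_xy h (fst z) (snd z)) * eval_xy (q z) (fst w) (snd w) = 0" for h
    proof -
      obtain \<alpha> \<beta> where "(h - mono_xy 0 0 (eval_xy h (fst z) (snd z))) * q z = \<alpha> * f + \<beta> * g" using q(4)[OF zZ, of h] by blast
      then have "eval_xy ((h - mono_xy 0 0 (eval_xy h (fst z) (snd z))) * q z) (fst w) (snd w)
         = eval_xy (\<alpha> * f + \<beta> * g) (fst w) (snd w)" by simp
      then show ?thesis using Z(2,3)[OF \<open>w \<in> Z\<close>] by (simp add: eval_xy_add eval_xy_diff eval_xy_mult eval_xy_mono)
    qed
    show ?thesis using *[of "mono_xy 0 1 1"] *[of "mono_xy 1 0 1"] wz
      by (auto simp: eval_xy_mono prod_eq_iff)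
  qed
  define A :: "nat \<Rightarrow> (nat \<times> nat) set" where "A d = {(i, j). i + j < d}" for d
  have A: "finite (A d)" "card (A d) = d * (d + 1) div 2" for d using card_triangle[of d] by (auto simp: A_def)
  \<comment> \<open>Unknowns: the coefficients of \<open>h\<close>, the weights of the
    \<open>q z\<close>, and the coefficients of multipliers of f and g of degrees below m - 1 and n
    - 1. Equations: one for each coefficient of degree below n + m - 1, and the conditions indexed
    by \<open>L\<close>.\<close>
  let ?J = "M <+> (Z <+> (A (m - 1) <+> A (n - 1)))" and ?I = "A (n + m - 1) <+> L"
  define v where "v x = (case x of Inl ij \<Rightarrow> mono_xy (fst ij) (snd ij) 1
     | Inr (Inl z) \<Rightarrow> q z | Inr (Inr (Inl ij)) \<Rightarrow> mono_xy (fst ij) (snd ij) 1 * f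
     | Inr (Inr (Inr ij)) \<Rightarrow> mono_xy (fst ij) (snd ij) 1 * g)"
    for x :: "(nat \<times> nat) + ((real \<times> real) + ((nat \<times> nat) + (nat \<times> nat)))"
  define a where "a l x = (case l of Inl ij \<Rightarrow> coeff (coeff (v x) (fst ij)) (snd ij)
     | Inr l \<Rightarrow> (case x of Inl ij \<Rightarrow> \<mu> l ij | Inr _ \<Rightarrow> 0))" for l x
  \<comment> \<open>The triangles of sizes m - 1 and n - 1 fall short of the triangle of size n + m
    - 1 by exactly n m.\<close>
  have "card ?I < card ?J"
  proof -
    obtain n' m' where n': "n = Suc n'" "m = Suc m'" using nm by (metis Suc_le_D One_nat_def)
    have A2: "2 * card (A d) = d * (d + 1)" for d
      unfolding A(2) by (rule dvd_mult_div_cancel) simp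
    have "2 * card (A (n + m - 1)) = 2 * (card (A (m - 1)) + card (A (n - 1)) + n * m)"
      unfolding distrib_left A2 by (simp add: n' algebra_simps)
    then have "card (A (n + m - 1)) = card (A (m - 1)) + card (A (n - 1)) + n * m"
      by simp
    then show ?thesis using big by (simp add: card_Plus A M(1) Z(1) L)
  qed
  then obtain c where cn: "\<exists>x\<in>?J. c x \<noteq> 0" and ce: "\<And>i. i \<in> ?I \<Longrightarrow> (\<Sum>x\<in>?J. a i x * c x) = 0"
    using underdetermined_system[of ?I ?J a] A(1) M(1) Z(1) L by auto
  define h where "h = (\<Sum>(i, j)\<in>M. mono_xy i j (c (Inl (i, j))))"
  define \<alpha> where "\<alpha> = (\<Sum>(i, j)\<in>A (m - 1). mono_xy i j (c (Inr (Inr (Inl (i, j))))))"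
  define \<beta> where "\<beta> = (\<Sum>(i, j)\<in>A (n - 1). mono_xy i j (c (Inr (Inr (Inr (i, j))))))"
  define Q where "Q = (\<Sum>z\<in>Z. mono_xy 0 0 (c (Inr (Inl z))) * q z)"
  have mono_scale: "mono_xy i j d = mono_xy 0 0 d * mono_xy i j 1" for i j d by (simp add: mono_xy_mult)
  have total: "(\<Sum>x\<in>?J. mono_xy 0 0 (c x) * v x) = h + (Q + (\<alpha> * f + \<beta> * g))"
    by (simp add: sum.Plus A(1) M(1) Z(1) v_def h_def \<alpha>_def \<beta>_def Q_def sum_distrib_right mono_xy_mult
        case_prod_unfold flip: mult.assoc)
  have bh: "bidegree_less ((n + m - 2) div 2 + 1) h"
    unfolding h_def
  proof (intro bidegree_less_sum, clarify)
    fix i j assume "(i, j) \<in> M"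
    then have "i + j < (n + m - 2) div 2 + 1" using M(2)[of i j] by (auto simp: less_Suc_eq_le) 
    then show "bidegree_less ((n + m - 2) div 2 + 1) (mono_xy i j (c (Inl (i, j))))"
      by (rule bidegree_less_mono_xy)
  qed
  have b\<alpha>: "bidegree_less (m - 1) \<alpha>" unfolding \<alpha>_def A_def by (auto intro!: bidegree_less_sum bidegree_less_mono_xy)
  have b\<beta>: "bidegree_less (n - 1) \<beta>" unfolding \<beta>_def A_def by (auto intro!: bidegree_less_sum bidegree_less_mono_xy)
  have bt: "bidegree_less (n + m - 1) (h + (Q + (\<alpha> * f + \<beta> * g)))"
  proof (intro bidegree_less_add)
    show "bidegree_less (n + m - 1) h" using bh by (rule bidegree_less_mono) (use nm in linarith)
    show "bidegree_less (n + m - 1) Q" unfolding Q_def using q(1)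
      by (auto intro!: bidegree_less_sum bidegree_less_scale)
    show "bidegree_less (n + m - 1) (\<alpha> * f)"
      using bidegree_less_mult[OF f b\<alpha>] nm by (simp add: mult.commute)
    show "bidegree_less (n + m - 1) (\<beta> * g)"
      using bidegree_less_mult[OF g b\<beta>] nm by (simp add: mult.commute add.commute)
  qed
  have rel: "h + (Q + (\<alpha> * f + \<beta> * g)) = 0"
  proof (intro poly_eqI)
    fix i j
    show "coeff (coeff (h + (Q + (\<alpha> * f + \<beta> * g))) i) j = coeff (coeff 0 i) j"
    proof (cases "i + j < n + m - 1")
      case True
      then have "(\<Sum>x\<in>?J. a (Inl (i, j)) x * c x) = 0" by (intro ce) (auto simp: A_def)
      then show ?thesis unfolding total[symmetric] coeff_sum mono_xy_0_mult_coeff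
        by (simp add: a_def mult.commute)
    next
      case False
      then show ?thesis using bt by (simp add: bidegree_less_def)
    qed
  qed
  have cond: "(\<Sum>ij\<in>M. \<mu> l ij * c (Inl ij)) = 0" if "l \<in> L" for l
    using ce[OF InrI[OF that]] by (simp add: sum.Plus A(1) M(1) Z(1) a_def)
  have \<open>0 \<le> lam (top_form (n + m - 2) (h * h))\<close>
    using pos[of "\<lambda>ij. c (Inl ij)" h] cond by (simp add: h_def)
  \<comment> \<open>Evaluation at z removes f, g and every \<open>q w\<close> with w different from
    z.\<close>
  have hz: "eval_xy h (fst z) (snd z) + c (Inr (Inl z)) * K z = 0" if "z \<in> Z" for z
  proof -
    have "0 = eval_xy (h + (Q + (\<alpha> * f + \<beta> * g))) (fst z) (snd z)" unfolding rel by simp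
    also have "\<dots> = eval_xy h (fst z) (snd z) + (\<Sum>w\<in>Z. c (Inr (Inl w)) * eval_xy (q w) (fst z) (snd z))"
      using Z(2,3)[OF that] by (simp add: eval_xy_add eval_xy_mult Q_def eval_xy_sum eval_xy_mono)
    also have "(\<Sum>w\<in>Z. c (Inr (Inl w)) * eval_xy (q w) (fst z) (snd z)) = (\<Sum>w\<in>Z. if w = z then c (Inr (Inl z)) * K z else 0)"
      using q(2) q0 that by (intro sum.cong) auto
    finally show ?thesis using that Z(1) by simp
  qed
  have K0: "?c0 * K z < 0" if "z \<in> Z" for z using Z(4)[OF that] by (simp add: K_def)
  have mono00: "mono_xy 0 0 (c * d) = mono_xy 0 0 c * mono_xy 0 0 d" for c d by (simp add: mono_xy_mult)
  \<comment> \<open>Modulo the ideal, \<open>h * q z\<close> equals h(z) times \<open>q z\<close>,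
    so \<open>h * Q\<close> may be replaced by \<open>R\<close>. Multiplying the relation by
    \<open>h\<close> then gives that \<open>h * h + R\<close> lies in the ideal.\<close>
  define R where "R = (\<Sum>z\<in>Z. mono_xy 0 0 (c (Inr (Inl z)) * eval_xy h (fst z) (snd z)) * q z)"
  have "\<exists>\<alpha>' \<beta>'. h * h + R = \<alpha>' * f + \<beta>' * g"
  proof -
    obtain u w where uw: "\<And>z. z \<in> Z \<Longrightarrow> (h - mono_xy 0 0 (eval_xy h (fst z) (snd z))) * q z = u z * f + w z * g"
      using q(4)[of _ h] by metis
    have "h * Q - R = (\<Sum>z\<in>Z. mono_xy 0 0 (c (Inr (Inl z))) * ((h - mono_xy 0 0 (eval_xy h (fst z) (snd z))) * q z))"
      unfolding Q_def R_def sum_distrib_left sum_subtractf[symmetric]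
      by (intro sum.cong refl) (simp only: mono00 algebra_simps)
    also have "\<dots> = (\<Sum>z\<in>Z. mono_xy 0 0 (c (Inr (Inl z))) * u z) * f + (\<Sum>z\<in>Z. mono_xy 0 0 (c (Inr (Inl z))) * w z) * g"
      unfolding sum_distrib_right sum.distrib[symmetric]
      by (intro sum.cong refl) (simp only: uw, simp only: algebra_simps)
    finally have 1: "h * Q - R = (\<Sum>z\<in>Z. mono_xy 0 0 (c (Inr (Inl z))) * u z) * f + (\<Sum>z\<in>Z. mono_xy 0 0 (c (Inr (Inl z))) * w z) * g" .
    have "h * (h + (Q + (\<alpha> * f + \<beta> * g))) = 0" unfolding rel by simp
    then have "h * h = - (h * Q) - h * \<alpha> * f - h * \<beta> * g" by (simp add: algebra_simps add_eq_0_iff)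
    then have "h * h + R = - (h * Q - R) - h * \<alpha> * f - h * \<beta> * g" by simp
    then show ?thesis unfolding 1 
      by (intro exI[of _ "- (\<Sum>z\<in>Z. mono_xy 0 0 (c (Inr (Inl z))) * u z) - h * \<alpha>"]
                exI[of _ "- (\<Sum>z\<in>Z. mono_xy 0 0 (c (Inr (Inl z))) * w z) - h * \<beta>"])
         (simp add: algebra_simps)
  qed
  then obtain \<alpha>' \<beta>' where ab: "h * h + R = \<alpha>' * f + \<beta>' * g" by blast
  have bhh: "bidegree_less (n + m - 1) (h * h)"
  proof -
    have "bidegree_less ((n + m - 2) div 2 + ((n + m - 2) div 2 + 1)) (h * h)"
      using bidegree_less_mult[of "(n + m - 2) div 2" h, OF _ bh] bh by simp
    then show ?thesis by (rule bidegree_less_mono) (use nm in linarith)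
  qed
  have bR: "bidegree_less (n + m - 1) R" unfolding R_def using q(1)
      by (auto intro!: bidegree_less_sum bidegree_less_scale)
  have "bidegree_less (n + m - 1) (\<alpha>' * f + \<beta>' * g)" unfolding ab[symmetric] using bhh bR by (rule bidegree_less_add)
  \<comment> \<open>In a representation without cancellation the multipliers of the leading forms
    have degrees below m - 1 and n - 1, and the coefficients that \<open>lam\<close> reads off are
    zero.\<close>
  then obtain \<alpha>'' \<beta>'' where ab2: "\<alpha>'' * f + \<beta>'' * g = \<alpha>' * f + \<beta>' * g"
    "bidegree_less (n + m - 1 - n) \<alpha>''" "bidegree_less (n + m - 1 - m) \<beta>''"
    using ideal_degree_bound[OF f g deg co nm(1)] by metis
  have lam0: "lam 0 = 0" using lam_add[of 0 0] by simp
  have "lam (top_form (n + m - 2) (\<alpha>'' * f)) = 0"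
  proof (cases "m = 1")
    case True then show ?thesis using ab2(2) by (simp add: bidegree_less_0_iff lam0)
  next
    case False
    then have e: "n + m - 1 - n = Suc (m - 2)" "m - 2 + n = n + m - 2" using nm by auto
    have "top_form (n + m - 2) (\<alpha>'' * f) = top_form (m - 2) \<alpha>'' * top_form n f"
      using top_form_mult[of "m - 2" \<alpha>'' n f] ab2(2) f unfolding e by simp
    moreover have "degree (top_form (m - 2) \<alpha>'') < m - 1" using degree_top_form[of "m - 2" \<alpha>''] nm False by linarith
    ultimately show ?thesis using lam_F[of "top_form (m - 2) \<alpha>''"] by (simp add: mult.commute coeff_eq_0)
  qed
  moreover have "lam (top_form (n + m - 2) (\<beta>'' * g)) = 0"
  proof (cases "n = 1")
    case True then show ?thesis using ab2(3) by (simp add: bidegree_less_0_iff lam0)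
  next
    case False
    then have e: "n + m - 1 - m = Suc (n - 2)" "n - 2 + m = n + m - 2" using nm by auto
    have "top_form (n + m - 2) (\<beta>'' * g) = top_form (n - 2) \<beta>'' * top_form m g"
      using top_form_mult[of "n - 2" \<beta>'' m g] ab2(3) g unfolding e by simp
    moreover have "degree (top_form (n - 2) \<beta>'') < n - 1" using degree_top_form[of "n - 2" \<beta>''] nm False by linarith
    ultimately show ?thesis using lam_G[of "top_form (n - 2) \<beta>''"] by (simp add: mult.commute coeff_eq_0)
  qed
  ultimately have "lam (top_form (n + m - 2) (h * h + R)) = 0"
    unfolding ab ab2(1)[symmetric] top_form_add lam_add by simp
  moreover have "lam (top_form (n + m - 2) R) = (\<Sum>z\<in>Z. c (Inr (Inl z)) * eval_xy h (fst z) (snd z) * ?c0)"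
  proof -
    have lam_sum: "lam (sum F B) = (\<Sum>b\<in>B. lam (F b))" for F :: "real \<times> real \<Rightarrow> real poly" and B
      by (induction B rule: infinite_finite_induct) (auto simp: lam_add lam0)
    have ts: "top_form d (mono_xy 0 0 c * p) = smult c (top_form d p)" for c d p
      by (rule poly_eqI) (simp add: coeff_top_form mono_xy_0_mult_coeff)
    show ?thesis unfolding R_def top_form_sum lam_sum ts lam_smult using q(3) by (intro sum.cong) auto
  qed
  moreover have "(\<Sum>z\<in>Z. c (Inr (Inl z)) * eval_xy h (fst z) (snd z) * ?c0) = (\<Sum>z\<in>Z. - ((c (Inr (Inl z)))\<^sup>2 * (?c0 * K z)))"
  proof (intro sum.cong refl)
    fix z assume "z \<in> Z"
    then have "eval_xy h (fst z) (snd z) = - c (Inr (Inl z)) * K z" using hz[of z] by simp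
    then show "c (Inr (Inl z)) * eval_xy h (fst z) (snd z) * ?c0 = - ((c (Inr (Inl z)))\<^sup>2 * (?c0 * K z))"
      by (simp add: power2_eq_square)
  qed
  \<comment> \<open>\<open>lam\<close> of the leading form of \<open>h * h\<close> is nonnegative
    and cancels against \<open>lam\<close> of that of \<open>R\<close>. The latter is a sum of
    nonnegative terms by the sign hypothesis on the Jacobian, so every term vanishes.\<close>
  ultimately have le: "(\<Sum>z\<in>Z. - ((c (Inr (Inl z)))\<^sup>2 * (?c0 * K z))) \<le> 0"
    using \<open>0 \<le> lam (top_form (n + m - 2) (h * h))\<close> by (simp add: top_form_add lam_add)
  have nn: "0 \<le> - ((c (Inr (Inl z)))\<^sup>2 * (?c0 * K z))" if "z \<in> Z" for z
    using mult_nonneg_nonpos[OF zero_le_power2 less_imp_le[OF K0[OF that]]] by simp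
  have "(\<Sum>z\<in>Z. - ((c (Inr (Inl z)))\<^sup>2 * (?c0 * K z))) = 0"
    by (rule antisym[OF le sum_nonneg[OF nn]])
  then have "\<forall>z\<in>Z. - ((c (Inr (Inl z)))\<^sup>2 * (?c0 * K z)) = 0"
    using sum_nonneg_eq_0_iff[OF Z(1), of "\<lambda>z. - ((c (Inr (Inl z)))\<^sup>2 * (?c0 * K z))"] nn by blast
  then have cz: "c (Inr (Inl z)) = 0" if "z \<in> Z" for z using K0[OF that] that by fastforce
  then have "Q = 0" by (simp add: Q_def mono_xy_def)
  then have "h = (- \<alpha>) * f + (- \<beta>) * g" using rel by (simp add: algebra_simps add_eq_0_iff)
  then have h0: "h = 0" using M_indep[of "\<lambda>ij. c (Inl ij)" "- \<alpha>" "- \<beta>"] unfolding h_def by blast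
  then have ab0: "\<alpha> = 0 \<and> \<beta> = 0"
    using rel \<open>Q = 0\<close> ideal_representation_zero[OF f g deg co nm _ b\<alpha> b\<beta>] by simp
  have coeffs: "d (k, l) = 0" if "(\<Sum>(i, j)\<in>B. mono_xy i j (d (i, j))) = 0" "(k, l) \<in> B" "finite B" for d :: "nat \<times> nat \<Rightarrow> real" and B k l
  proof -
    have "coeff (coeff (\<Sum>(i, j)\<in>B. mono_xy i j (d (i, j))) k) l = (\<Sum>ij\<in>B. if ij = (k, l) then d ij else 0)"
      by (auto simp: coeff_sum case_prod_unfold coeff_mono_xy intro!: sum.cong)
    then show ?thesis using that by simp
  qed
  have "c (Inl (i, j)) = 0" if "(i, j) \<in> M" for i j
    using coeffs[where B = M and d = "\<lambda>ij. c (Inl ij)"] h0 that M(1) by (simp add: h_def)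
  moreover have "c (Inr (Inr (Inl (i, j)))) = 0" if "(i, j) \<in> A (m - 1)" for i j
    using coeffs[where B = "A (m - 1)" and d = "\<lambda>ij. c (Inr (Inr (Inl ij)))"] ab0 that A(1) by (simp add: \<alpha>_def)
  moreover have "c (Inr (Inr (Inr (i, j)))) = 0" if "(i, j) \<in> A (n - 1)" for i j
    using coeffs[where B = "A (n - 1)" and d = "\<lambda>ij. c (Inr (Inr (Inr ij)))"] ab0 that A(1) by (simp add: \<beta>_def)
  ultimately show False using cn cz by auto
qed

section \<open>Extrema of a polynomial with squarefree leading form\<close>

definition cpoly :: "real poly \<Rightarrow> complex poly" where
  "cpoly p = map_poly of_real p"

lemma coeff_cpoly: "coeff (cpoly p) i = of_real (coeff p i)"
  by (simp add: cpoly_def coeff_map_poly)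

lemma cpoly_add: "cpoly (p + q) = cpoly p + cpoly q"
  by (rule poly_eqI) (simp add: coeff_cpoly)

lemma cpoly_mult: "cpoly (p * q) = cpoly p * cpoly q"
  by (rule poly_eqI) (simp add: coeff_cpoly coeff_mult)

lemma cpoly_smult: "cpoly (smult c p) = smult (of_real c) (cpoly p)"
  by (rule poly_eqI) (simp add: coeff_cpoly)

lemma cpoly_pderiv: "cpoly (pderiv p) = pderiv (cpoly p)"
  by (rule poly_eqI) (simp add: coeff_cpoly coeff_pderiv)

lemma degree_cpoly: "degree (cpoly p) = degree p"
  by (simp add: cpoly_def degree_map_poly)

lemma cpoly_0_iff: "cpoly p = 0 \<longleftrightarrow> p = 0"
  by (auto simp: poly_eq_iff coeff_cpoly)

lemma poly_cpoly_of_real: "poly (cpoly p) (of_real x) = of_real (poly p x)"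
  by (induction p) (auto simp: cpoly_def map_poly_pCons)

lemma poly_cpoly_cnj: "poly (cpoly p) (cnj z) = cnj (poly (cpoly p) z)"
  by (induction p) (auto simp: cpoly_def map_poly_pCons)

lemma ex_root_cpoly: "0 < degree p \<Longrightarrow> \<exists>z. poly (cpoly p) z = 0"
  using fundamental_theorem_of_algebra[of "cpoly p"] by (simp add: constant_degree degree_cpoly)

lemma coprime_if_no_common_root:
  assumes "p \<noteq> 0" "\<And>z. poly (cpoly p) z = 0 \<Longrightarrow> poly (cpoly q) z \<noteq> 0"
  shows "coprime p (q :: real poly)"
proof (rule coprimeI)
  fix c assume c: "c dvd p" "c dvd q"
  have "degree c = 0"
  proof (rule ccontr)
    assume "degree c \<noteq> 0"
    then obtain z where "poly (cpoly c) z = 0" using ex_root_cpoly by blast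
    then show False using c assms(2)[of z] by (auto elim!: dvdE simp: cpoly_mult)
  qed
  moreover have "c \<noteq> 0" using c assms(1) by auto
  ultimately show "is_unit c" by (simp add: is_unit_iff_degree)
qed

text \<open>Comparison of the coefficients of degree n in Lagrange's interpolation formula for
  \<open>p\<close> at the n + 1 zeros of \<open>Q\<close>. For \<open>p\<close> of degree below n
  the sum of residues of p / Q is zero.\<close>

lemma euler_lagrange_sum:
  fixes Q p :: "complex poly"
  assumes sq: "rsquarefree Q" and dQ: "degree Q = Suc n" and dp: "degree p \<le> n"
  shows "(\<Sum>t | poly Q t = 0. poly p t / poly (pderiv Q) t) = coeff p n / lead_coeff Q"
proof -
  let ?R = "{t. poly Q t = 0}" and ?l = "lead_coeff Q"
  have Q0: "Q \<noteq> 0" using dQ by auto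
  have fin: "finite ?R" using Q0 by (rule poly_roots_finite)
  have Q: "Q = smult ?l (\<Prod>t\<in>?R. [:- t, 1:])" using complex_poly_decompose_rsquarefree[OF sq] by simp
  have deg_prod: "degree (\<Prod>t\<in>A. [:- t, 1:]) = card A" for A :: "complex set"
    by (subst degree_prod_eq_sum_degree) auto
  have "Suc n = degree (smult ?l (\<Prod>t\<in>?R. [:- t, 1:]))" using Q dQ by simp
  then have cR: "card ?R = Suc n" using Q0 by (simp add: deg_prod)
  define B where "B t = (\<Prod>s\<in>?R - {t}. [:- s, 1:])" for t
  have Bd: "degree (B t) = n" if "t \<in> ?R" for t using that fin cR by (simp add: B_def deg_prod)
  have Bl: "coeff (B t) n = 1" if "t \<in> ?R" for t
  proof -
    have "lead_coeff (B t) = 1" unfolding B_def lead_coeff_prod by simp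
    then show ?thesis using Bd[OF that] by simp
  qed
  have Bz: "poly (B t) s = 0" if "s \<in> ?R" "s \<noteq> t" for s t
    using that fin by (auto simp: B_def poly_prod intro!: prod_zero)
  have QB: "Q = smult ?l ([:- t, 1:] * B t)" if "t \<in> ?R" for t
    by (subst Q) (simp only: prod.remove[OF fin that] B_def)
  have dB: "poly (pderiv Q) t = ?l * poly (B t) t" if "t \<in> ?R" for t
  proof -
    have "pderiv Q = smult ?l (pderiv ([:- t, 1:] * B t))" by (subst QB[OF that]) (simp only: pderiv_smult)
    also have "pderiv ([:- t, 1:] * B t) = B t + [:- t, 1:] * pderiv (B t)"
      by (subst pderiv_mult) (simp add: pderiv_pCons)
    finally show ?thesis by simp
  qed
  have B0: "poly (B t) t \<noteq> 0" if "t \<in> ?R" for t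
    using sq dB[OF that] that by (auto simp: rsquarefree_roots)
  let ?S = "\<Sum>t\<in>?R. smult (poly p t / poly (B t) t) (B t)"
  have "p = ?S"
  proof (rule poly_eqI_degree[of ?R])
    fix s assume s: "s \<in> ?R"
    have "poly ?S s = (\<Sum>t\<in>?R. poly p t / poly (B t) t * poly (B t) s)" by (simp add: poly_sum)
    also have "\<dots> = (\<Sum>t\<in>?R. if t = s then poly p s else 0)"
      using Bz[OF s] B0[OF s] by (intro sum.cong) auto
    finally show "poly p s = poly ?S s" using s fin by simp
  next
    show "degree p < card ?R" using dp cR by simp
    have "degree ?S \<le> n" using Bd by (intro degree_sum_le) (auto simp: fin)
    then show "degree ?S < card ?R" using cR by simp
  qed
  then have "coeff p n = coeff ?S n" by simp
  also have "\<dots> = (\<Sum>t\<in>?R. poly p t / poly (B t) t)"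
    unfolding coeff_sum using Bl by (intro sum.cong) auto
  also have "\<dots> = ?l * (\<Sum>t\<in>?R. poly p t / poly (pderiv Q) t)"
    unfolding sum_distrib_left using Q0 by (intro sum.cong) (auto simp: dB)
  finally show ?thesis using Q0 by simp
qed

lemma top_form_deriv_y: "top_form n (deriv_y H) = pderiv (top_form (Suc n) H)"
  by (rule poly_eqI) (auto simp: coeff_top_form coeff_deriv_y coeff_pderiv)

text \<open>Euler's identity x H_x = (n + 1) H - y H_y for the leading form, read at x = 1 and y =
  t.\<close>

lemma top_form_deriv_x:
  "top_form n (deriv_x H) = smult (of_nat (Suc n)) (top_form (Suc n) H) - pCons 0 (pderiv (top_form (Suc n) H))"
proof (rule poly_eqI)
  fix i
  show "coeff (top_form n (deriv_x H)) i =
    coeff (smult (of_nat (Suc n)) (top_form (Suc n) H) - pCons 0 (pderiv (top_form (Suc n) H))) i"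
    by (cases i) (auto simp: coeff_top_form coeff_deriv_x coeff_pderiv Suc_diff_le Suc_diff_Suc of_nat_diff algebra_simps)
qed

definition hess :: "poly_xy \<Rightarrow> real \<times> real \<Rightarrow> real" where
  "hess H z = eval_xy (deriv_x (deriv_x H)) (fst z) (snd z) * eval_xy (deriv_y (deriv_y H)) (fst z) (snd z)
    - (eval_xy (deriv_x (deriv_y H)) (fst z) (snd z))\<^sup>2"

text \<open>Let P be the leading form. Then F = P' and, at the zeros of P, G = - t P', so dividing
  by P'^2 reduces both prescribed values of \<open>lam\<close> to Euler-Lagrange sums. For h of
  degree below n with leading form q, \<open>lam\<close> of q^2 is the real part of the sum of (q /
  P')^2. It is nonnegative once all q / P' are real, which is automatic at real zeros and costs one
  condition per conjugate pair.\<close>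

lemma extrema_bound_equal:
  assumes H: "bidegree_less (Suc (Suc n)) H" and n: "1 \<le> n"
    and deg: "degree (top_form (Suc n) H) = Suc n" and sq: "rsquarefree (cpoly (top_form (Suc n) H))"
    and Z: "finite Z" "\<And>z. z \<in> Z \<Longrightarrow> eval_xy (deriv_x H) (fst z) (snd z) = 0"
      "\<And>z. z \<in> Z \<Longrightarrow> eval_xy (deriv_y H) (fst z) (snd z) = 0" "\<And>z. z \<in> Z \<Longrightarrow> 0 < hess H z"
  shows "2 * card Z + card {t. poly (top_form (Suc n) H) t = 0} \<le> n * n + 1"
proof -
  define P where "P = top_form (Suc n) H"
  let ?Q = "cpoly P"
  define l where "l = lead_coeff P"
  have l0: "l \<noteq> 0" using deg unfolding l_def P_def by (metis degree_0 leading_coeff_0_iff nat.distinct(1))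
  have lQ: "lead_coeff ?Q = of_real l" by (simp add: l_def coeff_cpoly degree_cpoly)
  have dQ: "degree ?Q = Suc n" using deg by (simp add: degree_cpoly P_def)
  have sqQ: "rsquarefree ?Q" using sq by (simp add: P_def)
  define R where "R = {t. poly ?Q t = 0}"
  have finR: "finite R" unfolding R_def using dQ by (intro poly_roots_finite) auto
  have Q'0: "poly (pderiv ?Q) t \<noteq> 0" if "t \<in> R" for t
    using sqQ that by (auto simp: rsquarefree_roots R_def)
  have eul: "(\<Sum>t\<in>R. poly p t / poly (pderiv ?Q) t) = coeff p n / of_real l" if "degree p \<le> n" for p
    using euler_lagrange_sum[OF sqQ dQ that] by (simp add: R_def lQ)
  define f where "f = deriv_y H"
  define g where "g = deriv_x H"
  have F: "top_form n f = pderiv P" by (simp add: f_def P_def top_form_deriv_y)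
  have G: "top_form n g = smult (of_nat (Suc n)) P - pCons 0 (pderiv P)" by (simp add: g_def P_def top_form_deriv_x)
  define lam where "lam q = Re (\<Sum>t\<in>R. poly (cpoly q) t / (poly (pderiv ?Q) t)\<^sup>2)" for q
  define L where "L = {t \<in> R. 0 < Im t}"
  define \<mu> where "\<mu> t ij = (if fst ij + snd ij = n - 1 then Im (t ^ fst ij / poly (pderiv ?Q) t) else 0)" for t and ij :: "nat \<times> nat"
  define M :: "(nat \<times> nat) set" where "M = {(i, j). i + j < n}"
  have finL: "finite L" using finR by (simp add: L_def)
  have dP: "degree P = Suc n" using deg by (simp add: P_def)
  have "card Z + card M \<le> n * n + card L"
  proof (rule critical_count_bound[where f = f and g = g and lam = lam and ?k1.0 = 0 and ?k2.0 = "- 1 / l" and \<mu> = \<mu>])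
    show "bidegree_less (Suc n) f" "bidegree_less (Suc n) g"
      using H by (simp_all add: f_def g_def bidegree_less_deriv_x bidegree_less_deriv_y)
    show "degree (top_form n f) = n" by (simp add: F degree_pderiv dP)
    show "coprime (top_form n f) (top_form n g)"
    proof (rule coprime_if_no_common_root)
      show "top_form n f \<noteq> 0" using n by (auto simp: F pderiv_eq_0_iff dP)
      fix z assume z: "poly (cpoly (top_form n f)) z = 0"
      then have z': "poly (pderiv ?Q) z = 0" by (simp add: F cpoly_pderiv)
      have "cpoly (pCons 0 p) = pCons 0 (cpoly p)" for p by (rule poly_eqI) (simp add: coeff_cpoly coeff_pCons split: nat.split)
      then have "cpoly (top_form n g) = smult (of_nat (Suc n)) ?Q - pCons 0 (pderiv ?Q)"
        unfolding G by (intro poly_eqI) (simp add: coeff_cpoly coeff_pCons coeff_pderiv split: nat.split)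
      then have "poly (cpoly (top_form n g)) z = of_nat (Suc n) * poly ?Q z" using z' by simp
      moreover have "poly ?Q z \<noteq> 0" using sqQ z' by (auto simp: rsquarefree_roots)
      ultimately show "poly (cpoly (top_form n g)) z \<noteq> 0" by (simp del: of_nat_Suc)
    qed
    show "1 \<le> n" "1 \<le> n" using n by auto
    show "lam (p + q) = lam p + lam q" for p q
      by (simp add: lam_def cpoly_add sum.distrib add_divide_distrib)
    show "lam (smult c p) = c * lam p" for c p
    proof -
      have "(\<Sum>t\<in>R. poly (cpoly (smult c p)) t / (poly (pderiv ?Q) t)\<^sup>2) = of_real c * (\<Sum>t\<in>R. poly (cpoly p) t / (poly (pderiv ?Q) t)\<^sup>2)"
        by (simp add: cpoly_smult sum_distrib_left)
      then show ?thesis by (simp add: lam_def)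
    qed
    show "lam (top_form n f * p) = 0 * coeff p (n - 1)" if "degree p \<le> n - 1" for p
    proof -
      have "(\<Sum>t\<in>R. poly (cpoly (top_form n f * p)) t / (poly (pderiv ?Q) t)\<^sup>2) = (\<Sum>t\<in>R. poly (cpoly p) t / poly (pderiv ?Q) t)"
        using Q'0 by (intro sum.cong refl) (simp add: cpoly_mult F cpoly_pderiv power2_eq_square)
      also have "\<dots> = 0" using that n by (subst eul) (auto simp: degree_cpoly coeff_cpoly coeff_eq_0)
      finally show ?thesis by (simp add: lam_def)
    qed
    show "lam (top_form n g * p) = (- 1 / l) * coeff p (n - 1)" if "degree p \<le> n - 1" for p
    proof -
      have dp: "degree (pCons 0 (cpoly p)) \<le> n" using that n by (intro order_trans[OF degree_pCons_le]) (simp add: degree_cpoly)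
      have "(\<Sum>t\<in>R. poly (cpoly (top_form n g * p)) t / (poly (pderiv ?Q) t)\<^sup>2) = (\<Sum>t\<in>R. - (poly (pCons 0 (cpoly p)) t / poly (pderiv ?Q) t))"
      proof (intro sum.cong refl)
        fix t assume t: "t \<in> R"
        have "cpoly (pCons 0 p) = pCons 0 (cpoly p)" for p by (rule poly_eqI) (simp add: coeff_cpoly coeff_pCons split: nat.split)
        then have "cpoly (top_form n g) = smult (of_nat (Suc n)) ?Q - pCons 0 (pderiv ?Q)"
          unfolding G by (intro poly_eqI) (simp add: coeff_cpoly coeff_pCons coeff_pderiv split: nat.split)
        then have "poly (cpoly (top_form n g)) t = - t * poly (pderiv ?Q) t" using t by (simp add: R_def)
        then show "poly (cpoly (top_form n g * p)) t / (poly (pderiv ?Q) t)\<^sup>2 = - (poly (pCons 0 (cpoly p)) t / poly (pderiv ?Q) t)"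
          using Q'0[OF t] by (simp add: cpoly_mult power2_eq_square)
      qed
      also have "\<dots> = - (coeff (pCons 0 (cpoly p)) n / of_real l)"
        using eul[OF dp] by (simp add: sum_negf)
      also have "coeff (pCons 0 (cpoly p)) n = of_real (coeff p (n - 1))"
        using n by (cases n) (auto simp: coeff_cpoly)
      finally show ?thesis by (simp add: lam_def)
    qed
    show "finite Z" by fact
    show "eval_xy f (fst z) (snd z) = 0" "eval_xy g (fst z) (snd z) = 0" if "z \<in> Z" for z
      using Z(2,3) that by (auto simp: f_def g_def)
    \<comment> \<open>The order (H_y, H_x) of the two equations turns the Jacobian into minus the
      Hessian determinant; the factor in front is n + 1, whatever the sign of the leading
      coefficient.\<close>
    show "(0 * coeff (top_form n g) n - (- 1 / l) * coeff (top_form n f) n) *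
         (eval_xy (deriv_x f) (fst z) (snd z) * eval_xy (deriv_y g) (fst z) (snd z)
          - eval_xy (deriv_y f) (fst z) (snd z) * eval_xy (deriv_x g) (fst z) (snd z)) < 0" if "z \<in> Z" for z
    proof -
      have "coeff (top_form n f) n = of_nat (Suc n) * l" by (simp add: F coeff_pderiv l_def dP)
      then have "0 * coeff (top_form n g) n - (- 1 / l) * coeff (top_form n f) n = of_nat (Suc n)"
        using l0 by simp
      moreover have "eval_xy (deriv_x f) (fst z) (snd z) * eval_xy (deriv_y g) (fst z) (snd z)
          - eval_xy (deriv_y f) (fst z) (snd z) * eval_xy (deriv_x g) (fst z) (snd z) = - hess H z"
        by (simp add: f_def g_def hess_def deriv_x_y_commute power2_eq_square mult.commute)
      ultimately show ?thesis using Z(4)[OF that] by (simp del: of_nat_Suc)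
    qed
    show "finite M" using card_triangle[of n] by (simp add: M_def)
    show "2 * (i + j) \<le> n + n - 2" if "(i, j) \<in> M" for i j using that by (auto simp: M_def)
    show "(\<Sum>(i, j)\<in>M. mono_xy i j (c (i, j))) = 0" if *: "(\<Sum>(i, j)\<in>M. mono_xy i j (c (i, j))) = \<alpha> * f + \<beta> * g" for c \<alpha> \<beta>
    proof -
      have "bidegree_less n (\<alpha> * f + \<beta> * g)" unfolding *[symmetric]
        by (auto intro!: bidegree_less_sum bidegree_less_mono_xy simp: M_def)
      \<comment> \<open>An element of the ideal of degree below n has multipliers of degree bound n
        - n = 0, so it is zero.\<close>
      then obtain a b where "a * f + b * g = \<alpha> * f + \<beta> * g" "bidegree_less (n - n) a" "bidegree_less (n - n) b"
        using ideal_degree_bound[of n f n g n \<alpha> \<beta>] \<open>bidegree_less (Suc n) f\<close> \<open>bidegree_less (Suc n) g\<close>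
          \<open>degree (top_form n f) = n\<close> \<open>coprime (top_form n f) (top_form n g)\<close> n by metis
      then show ?thesis using * by (simp add: bidegree_less_0_iff)
    qed
    show "finite L" by (rule finL)
    show "0 \<le> lam (top_form (n + n - 2) (h * h))"
      if c: "\<And>l. l \<in> L \<Longrightarrow> (\<Sum>ij\<in>M. \<mu> l ij * c ij) = 0" and h: "h = (\<Sum>(i, j)\<in>M. mono_xy i j (c (i, j)))" for c h
    proof -
      have bh: "bidegree_less (Suc (n - 1)) h" unfolding h using n
        by (auto intro!: bidegree_less_sum bidegree_less_mono_xy simp: M_def)
      define q where "q = top_form (n - 1) h"
      have tq: "top_form (n + n - 2) (h * h) = q * q"
        using top_form_mult[OF bh bh] n by (simp add: q_def mult_2 numeral_2_eq_2)
      have qs: "q = (\<Sum>ij\<in>M. if fst ij + snd ij = n - 1 then monom (c ij) (fst ij) else 0)"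
        unfolding q_def h top_form_sum by (intro sum.cong refl) (auto simp: top_form_mono_xy case_prod_unfold)
      have cs: "cpoly (sum u A) = (\<Sum>x\<in>A. cpoly (u x))" for u :: "nat \<times> nat \<Rightarrow> real poly" and A
        by (induction A rule: infinite_finite_induct) (auto simp: cpoly_add cpoly_0_iff)
      have cm: "cpoly (monom a k) = monom (of_real a) k" for a k
        by (rule poly_eqI) (simp add: coeff_cpoly)
      have im: "Im (poly (cpoly q) t / poly (pderiv ?Q) t) = (\<Sum>ij\<in>M. \<mu> t ij * c ij)" for t
      proof -
        have "poly (cpoly q) t / poly (pderiv ?Q) t = (\<Sum>ij\<in>M. if fst ij + snd ij = n - 1 then of_real (c ij) * (t ^ fst ij / poly (pderiv ?Q) t) else 0)"
          unfolding qs cs poly_sum sum_divide_distrib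
          by (intro sum.cong refl) (auto simp: cm poly_monom cpoly_0_iff[THEN iffD2])
        moreover have "Im (of_real a * w) = Im w * a" for a w by simp
        ultimately show ?thesis
          by (simp only: Im_sum) (auto simp: \<mu>_def intro!: sum.cong simp del: times_divide_eq_right)
      qed
      \<comment> \<open>The conditions are imposed only in the upper half plane; conjugation
        transfers them to the lower one.\<close>
      have im0: "Im (poly (cpoly q) t / poly (pderiv ?Q) t) = 0" if "t \<in> R" for t
      proof (cases "Im t" "0::real" rule: linorder_cases)
        case greater
        then have "t \<in> L" using that by (simp add: L_def)
        then show ?thesis unfolding im by (rule c)
      next
        case less
        have "poly ?Q (cnj t) = 0" using that by (simp add: R_def poly_cpoly_cnj)
        then have "cnj t \<in> L" using less by (simp add: L_def R_def)
        then have "Im (poly (cpoly q) (cnj t) / poly (pderiv ?Q) (cnj t)) = 0" unfolding im by (rule c)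
        moreover have "poly (cpoly q) (cnj t) / poly (pderiv ?Q) (cnj t) = cnj (poly (cpoly q) t / poly (pderiv ?Q) t)"
          by (simp add: poly_cpoly_cnj flip: cpoly_pderiv)
        ultimately have "Im (cnj (poly (cpoly q) t / poly (pderiv ?Q) t)) = 0" by (simp only:)
        then show ?thesis by (simp only: cnj.sel neg_equal_0_iff_equal)
      next
        case equal
        then obtain x where "t = of_real x" by (metis complex_is_Real_iff Reals_cases)
        then show ?thesis by (simp add: poly_cpoly_of_real Im_divide_of_real flip: cpoly_pderiv of_real_divide)
      qed
      have "lam (q * q) = (\<Sum>t\<in>R. Re ((poly (cpoly q) t / poly (pderiv ?Q) t)\<^sup>2))"
        by (simp add: lam_def cpoly_mult power2_eq_square)
      also have "\<dots> \<ge> 0"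
        using im0 by (intro sum_nonneg) (simp add: Re_power2)
      finally show ?thesis unfolding tq .
    qed
  qed
  moreover have "2 * card M = n * (n + 1)"
    using card_triangle[of n] by (simp add: M_def dvd_mult_div_cancel)
  moreover have "2 * card L + card {t. poly P t = 0} = n + 1"
  proof -
    have RR: "R = L \<union> cnj ` L \<union> of_real ` {t. poly P t = 0}"
    proof (intro equalityI subsetI)
      fix t assume t: "t \<in> R"
      show "t \<in> L \<union> cnj ` L \<union> of_real ` {t. poly P t = 0}"
      proof (cases "Im t" "0::real" rule: linorder_cases)
        case greater then show ?thesis using t by (simp add: L_def)
      next
        case less
        then have "cnj t \<in> L" using t by (simp add: L_def R_def poly_cpoly_cnj)
        then show ?thesis by (metis UnI1 UnI2 complex_cnj_cnj imageI)
      next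
        case equal
        then obtain x where x: "t = of_real x" by (metis complex_is_Real_iff Reals_cases)
        then show ?thesis using t by (auto simp: R_def poly_cpoly_of_real)
      qed
    qed (auto simp: L_def R_def poly_cpoly_cnj poly_cpoly_of_real)
    have fr: "finite {t. poly P t = 0}" using dP by (intro poly_roots_finite) auto
    have "card R = card (L \<union> cnj ` L) + card (complex_of_real ` {t. poly P t = 0})"
      unfolding RR using finL fr by (intro card_Un_disjoint) (auto simp: L_def complex_eq_iff)
    also have "card (L \<union> cnj ` L) = card L + card (cnj ` L)"
      using finL by (intro card_Un_disjoint) (auto simp: L_def)
    also have "card (cnj ` L) = card L" by (intro card_image) (auto simp: inj_on_def)
    also have "card (complex_of_real ` {t. poly P t = 0}) = card {t. poly P t = 0}"
      by (intro card_image) (auto simp: inj_on_def)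
    finally have "card R = 2 * card L + card {t. poly P t = 0}" by simp
    moreover have "card R = Suc n"
    proof -
      have "?Q = smult (lead_coeff ?Q) (\<Prod>t\<in>R. [:- t, 1:])" using complex_poly_decompose_rsquarefree[OF sqQ] by (simp add: R_def)
      then have "Suc n = degree (smult (lead_coeff ?Q) (\<Prod>t\<in>R. [:- t, 1:]))" using dQ by simp
      also have "\<dots> = card R" using l0 lQ by (simp add: degree_prod_eq_sum_degree)
      finally show ?thesis by simp
    qed
    ultimately show ?thesis by simp
  qed
  ultimately show ?thesis unfolding P_def[symmetric] by (simp add: algebra_simps)
qed

text \<open>For n = i + i' + 1 and m = j + j' + 1 the points (i, j) and (i', j') are exchanged by
  the central reflection of the box. If neither lies in the chosen half, both lie on the middle
  antidiagonal and the tie-break leaves only the center.\<close>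

lemma half_box_arith:
  fixes i j i' j' :: nat
  assumes "\<not> (2 * (i + j) < i + i' + j + j' \<or> (2 * (i + j) = i + i' + j + j' \<and> 2 * j + 1 < j + j' + 1))"
    and "\<not> (2 * (i' + j') < i + i' + j + j' \<or> (2 * (i' + j') = i + i' + j + j' \<and> 2 * j' + 1 < j + j' + 1))"
  shows "i = i' \<and> j = j'"
proof -
  have "i + j = i' + j'" using assms by auto
  then show ?thesis using assms by auto
qed

text \<open>\<open>M\<close> and its central reflection cover the box up to its center. On the
  middle antidiagonal the tie-break keeps small exponents of x, hence large exponents of y;
  divisibility of the leading form by a power of y rests on this choice.\<close>

lemma box_half_card:
  assumes "1 \<le> m" "m \<le> (n::nat)"
  defines "M \<equiv> {(i, j). j < m \<and> i < n \<and> (2 * (i + j) < n + m - 2 \<or> (2 * (i + j) = n + m - 2 \<and> 2 * j + 1 < m))}"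
  shows "finite M" "n * m \<le> 2 * card M + 1"
proof -
  show fin: "finite M" by (rule finite_subset[of _ "{..<n} \<times> {..<m}"]) (auto simp: M_def)
  let ?r = "\<lambda>(i, j). (n - 1 - i, m - 1 - j)" and ?p = "((n - 1) div 2, (m - 1) div 2)"
  have "{..<n} \<times> {..<m} \<subseteq> insert ?p (M \<union> ?r ` M)"
  proof (intro subsetI, rule insertCI)
    fix ij assume "ij \<in> {..<n} \<times> {..<m}" "ij \<notin> M \<union> ?r ` M"
    then obtain i j where ijeq: "ij = (i, j)" and ij: "i < n" "j < m" "(i, j) \<notin> ?r ` M" "(i, j) \<notin> M"
      by (cases ij) auto
    have "(n - 1 - i, m - 1 - j) \<notin> M"
    proof
      assume "(n - 1 - i, m - 1 - j) \<in> M"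
      then have "?r (n - 1 - i, m - 1 - j) \<in> ?r ` M" by (rule imageI)
      then show False using ij by simp
    qed
    define i' where "i' = n - 1 - i"
    define j' where "j' = m - 1 - j"
    define N where "N = n + m - 2"
    have e: "n = i + i' + 1" "m = j + j' + 1" "N = i + i' + j + j'" using ij assms(1,2) by (auto simp: i'_def j'_def N_def)
    have 1: "\<not> (2 * (i + j) < N \<or> (2 * (i + j) = N \<and> 2 * j + 1 < m))"
      using ij unfolding M_def N_def by blast
    have "i' < n" "j' < m" using e by auto
    then have 2: "\<not> (2 * (i' + j') < N \<or> (2 * (i' + j') = N \<and> 2 * j' + 1 < m))"
      using \<open>(n - 1 - i, m - 1 - j) \<notin> M\<close> unfolding M_def N_def i'_def[symmetric] j'_def[symmetric] by blast
    have "i = i' \<and> j = j'"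
      using half_box_arith[of i j i' j'] 1 2 unfolding e by blast
    then have "2 * i = n - 1 \<and> 2 * j = m - 1" using e by simp
    then show "ij = ?p" unfolding ijeq by auto
  qed
  then have "card ({..<n} \<times> {..<m}) \<le> card (insert ?p (M \<union> ?r ` M))"
    by (rule card_mono[rotated]) (use fin in auto)
  also have "\<dots> \<le> Suc (card (M \<union> ?r ` M))" using fin by (simp add: card_insert_if)
  also have "card (M \<union> ?r ` M) \<le> card M + card (?r ` M)" by (rule card_Un_le)
  also have "card (?r ` M) \<le> card M" using fin by (rule card_image_le)
  finally show "n * m \<le> 2 * card M + 1" by (simp add: card_cartesian_product)
qed

text \<open>Here F is a multiple of t^n and G(0) is nonzero. With B the inverse of G modulo t^n, the
  coefficient of t^(n - 1) in q B is the residue at 0 of q / (t^n G); it vanishes on multiples of F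
  and is explicit on multiples of G. The form is zero on the span of \<open>M\<close>, so no
  conditions \<open>L\<close> are imposed.\<close>

lemma extrema_bound_greater:
  assumes nm: "1 \<le> m" "m \<le> n"
    and f: "bidegree_less (Suc n) (deriv_y H)" and g: "bidegree_less (Suc m) (deriv_x H)"
    and F: "top_form n (deriv_y H) = monom l n" and l: "l \<noteq> 0"
    and G: "coeff (top_form m (deriv_x H)) 0 \<noteq> 0"
    and Z: "finite Z" "\<And>z. z \<in> Z \<Longrightarrow> eval_xy (deriv_x H) (fst z) (snd z) = 0"
      "\<And>z. z \<in> Z \<Longrightarrow> eval_xy (deriv_y H) (fst z) (snd z) = 0" "\<And>z. z \<in> Z \<Longrightarrow> 0 < hess H z"
  shows "2 * card Z \<le> n * m + 1"
proof -
  define f' where "f' = deriv_y H"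
  define g' where "g' = deriv_x H"
  let ?G = "top_form m g'"
  \<comment> \<open>A truncated geometric series: G / G(0) differs from 1 by a multiple of t, whose
    n-th power is divisible by t^n.\<close>
  obtain B E where BE: "B * ?G + E * monom 1 n = 1"
  proof -
    define g0 where "g0 = coeff ?G 0"
    define W where "W = smult (inverse g0) (?G)"
    have g0: "g0 \<noteq> 0" using G by (simp add: g0_def g'_def)
    have "coeff (1 - W) 0 = 0" using g0 by (simp add: W_def g0_def)
    then obtain V where V: "1 - W = pCons 0 V" by (metis coeff_pCons_0 pCons_cases)
    have "pCons 0 V = monom 1 1 * V" by (simp add: monom_Suc monom_0)
    then have Vn: "(1 - W) ^ n = monom 1 n * V ^ n" unfolding V by (simp add: power_mult_distrib monom_power)
    have "W * (\<Sum>i<n. (1 - W) ^ i) = 1 - (1 - W) ^ n"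
      using one_diff_power_eq[of "1 - W" n] by simp
    then have "smult (inverse g0) (\<Sum>i<n. (1 - W) ^ i) * ?G + V ^ n * monom 1 n = 1"
      unfolding Vn by (simp add: W_def algebra_simps)
    then show thesis by (rule that)
  qed
  have co': "coprime (monom c k) ?G" if "c \<noteq> 0" for c k
  proof (rule coprime_if_no_common_root)
    fix z assume "poly (cpoly (monom c k)) z = 0"
    moreover have "cpoly (monom c k) = monom (of_real c) k" by (rule poly_eqI) (simp add: coeff_cpoly)
    ultimately have "z = of_real 0" using that by (simp add: poly_monom)
    then show "poly (cpoly ?G) z \<noteq> 0" using G by (simp only: poly_cpoly_of_real) (simp add: poly_0_coeff_0 g'_def)
  qed (use that in simp)
  have Fm: "top_form n f' = smult l (monom 1 n)" using F by (simp add: f'_def smult_monom)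
  have degF: "degree (top_form n f') = n" using F l by (simp add: f'_def degree_monom_eq)
  have co: "coprime (top_form n f') ?G" using co'[OF l] F by (simp add: f'_def)
  \<comment> \<open>This sign makes the constant paired with the Jacobian equal to the absolute
    value of \<open>l\<close>.\<close>
  define \<sigma> where "\<sigma> = - sgn l"
  define lam where "lam q = \<sigma> * coeff (q * B) (n - 1)" for q
  define M where "M = {(i, j). j < m \<and> i < n \<and> (2 * (i + j) < n + m - 2 \<or> (2 * (i + j) = n + m - 2 \<and> 2 * j + 1 < m))}"
  have n1: "1 \<le> n" using nm by simp
  have high: "coeff (p * monom 1 n) (n - 1) = 0" for p :: "real poly"
    using n1 by (subst mult.commute) (simp add: coeff_monom_mult)
  have "card Z + card M \<le> n * m + card ({} :: nat set)"
  proof (rule critical_count_bound[where f = f' and g = g' and lam = lam and ?k1.0 = 0 and ?k2.0 = \<sigma> and \<mu> = "\<lambda>_ _. 0"])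
    show bf: "bidegree_less (Suc n) f'" and bg: "bidegree_less (Suc m) g'" using f g by (simp_all add: f'_def g'_def)
    show "degree (top_form n f') = n" by (rule degF)
    show "coprime (top_form n f') (top_form m g')" by (rule co)
    show "1 \<le> n" "1 \<le> m" using nm by auto
    show "lam (p + q) = lam p + lam q" for p q by (simp add: lam_def algebra_simps)
    show "lam (smult c p) = c * lam p" for c p by (simp add: lam_def)
    show "lam (top_form n f' * p) = 0 * coeff p (m - 1)" for p
      using high[of "smult l (p * B)"] by (simp add: lam_def Fm mult_ac)
    show "lam (top_form m g' * p) = \<sigma> * coeff p (n - 1)" for p
    proof -
      have "top_form m g' * p * B = (B * top_form m g') * p" by (simp add: mult_ac)
      also have "B * top_form m g' = 1 - E * monom 1 n" using BE by (simp add: algebra_simps)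
      finally have "top_form m g' * p * B = p - (p * E) * monom 1 n" by (simp add: algebra_simps)
      then show ?thesis using high[of "p * E"] by (simp add: lam_def)
    qed
    show "finite Z" by fact
    show "eval_xy f' (fst z) (snd z) = 0" "eval_xy g' (fst z) (snd z) = 0" if "z \<in> Z" for z
      using Z(2,3) that by (auto simp: f'_def g'_def)
    show "(0 * coeff (top_form m g') m - \<sigma> * coeff (top_form n f') n) *
         (eval_xy (deriv_x f') (fst z) (snd z) * eval_xy (deriv_y g') (fst z) (snd z)
          - eval_xy (deriv_y f') (fst z) (snd z) * eval_xy (deriv_x g') (fst z) (snd z)) < 0" if "z \<in> Z" for z
    proof -
      have "0 * coeff (top_form m g') m - \<sigma> * coeff (top_form n f') n = \<bar>l\<bar>"
        using l by (simp add: Fm \<sigma>_def sgn_if)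
      moreover have "eval_xy (deriv_x f') (fst z) (snd z) * eval_xy (deriv_y g') (fst z) (snd z)
          - eval_xy (deriv_y f') (fst z) (snd z) * eval_xy (deriv_x g') (fst z) (snd z) = - hess H z"
        by (simp add: f'_def g'_def hess_def deriv_x_y_commute power2_eq_square mult.commute)
      ultimately show ?thesis using Z(4)[OF that] l by simp
    qed
    show "finite M" unfolding M_def by (rule box_half_card[OF nm])
    show "2 * (i + j) \<le> n + m - 2" if "(i, j) \<in> M" for i j using that by (auto simp: M_def)
    show "(\<Sum>(i, j)\<in>M. mono_xy i j (c (i, j))) = 0" if *: "(\<Sum>(i, j)\<in>M. mono_xy i j (c (i, j))) = \<alpha> * f' + \<beta> * g'" for c \<alpha> \<beta>
    proof -
      define h where "h = (\<Sum>(i, j)\<in>M. mono_xy i j (c (i, j)))"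
      have "bidegree_less n h" unfolding h_def
        by (auto intro!: bidegree_less_sum bidegree_less_mono_xy simp: M_def) (use nm in linarith)+
      then obtain a b where ab: "a * f' + b * g' = h" "bidegree_less (n - n) a" "bidegree_less (n - m) b"
        using ideal_degree_bound[OF bf bg degF co n1, of n \<alpha> \<beta>] * unfolding h_def[symmetric] by metis
      then have hb: "h = b * g'" by (simp add: bidegree_less_0_iff)
      \<comment> \<open>All monomials of \<open>h\<close> have x-exponent below m, so its part of
        degree e + m is divisible by y^(e + 1). Since G is prime to y, the leading form of
        \<open>b\<close>, of degree e, would be divisible by y^(e + 1).\<close>
      have "b = 0"
      proof (rule ccontr)
        assume "b \<noteq> 0"
        define d where "d = (LEAST d. bidegree_less d b)"
        have d: "bidegree_less d b" unfolding d_def using ex_bidegree_less by (rule LeastI_ex)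
        then obtain e where e: "d = Suc e" using \<open>b \<noteq> 0\<close> by (cases d) (auto simp: bidegree_less_0_iff)
        have "\<not> bidegree_less e b" using e d_def not_less_Least[of e "\<lambda>d. bidegree_less d b"] by simp
        then have te: "top_form e b \<noteq> 0" using bidegree_less_pred d e by blast
        have th: "top_form (e + m) h = top_form e b * ?G" unfolding hb using top_form_mult d bg e by blast
        have "monom 1 (Suc e) dvd top_form (e + m) h"
        proof -
          have "coeff (top_form (e + m) h) i = 0" if "i < Suc e" for i
          proof -
            have "coeff (coeff h i) (e + m - i) = (\<Sum>ij\<in>M. 0)"
              unfolding h_def coeff_sum case_prod_unfold using that
              by (intro sum.cong refl) (auto simp: coeff_mono_xy M_def)
            then show ?thesis by (simp add: coeff_top_form)
          qed
          then show ?thesis by (simp add: monom_1_dvd_iff')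
        qed
        then have "monom 1 (Suc e) dvd top_form e b"
          unfolding th using co'[OF one_neq_zero, of "Suc e"] by (metis coprime_dvd_mult_left_iff)
        then have "degree (monom (1::real) (Suc e)) \<le> degree (top_form e b)" using te by (rule dvd_imp_degree_le)
        then show False using degree_top_form[of e b] by (simp add: degree_monom_eq)
      qed
      then show ?thesis using hb by (simp add: h_def)
    qed
    show "finite ({} :: nat set)" by simp
    show "0 \<le> lam (top_form (n + m - 2) (h * h))" if h: "h = (\<Sum>(i, j)\<in>M. mono_xy i j (c (i, j)))" for c h
    proof (cases "even (n + m - 2)")
      case False
      then obtain k where k: "n + m - 2 = 2 * k + 1" by (elim oddE)
      have "bidegree_less (Suc k) h" unfolding h using k
        by (auto intro!: bidegree_less_sum bidegree_less_mono_xy simp: M_def)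
      from bidegree_less_mult[OF this this] have "top_form (n + m - 2) (h * h) = 0"
        by (rule top_form_eq_0) (use k in simp)
      then show ?thesis by (simp add: lam_def)
    next
      case True
      then obtain k where k: "n + m - 2 = 2 * k" by (elim evenE)
      have bh: "bidegree_less (Suc k) h" unfolding h using k
        by (auto intro!: bidegree_less_sum bidegree_less_mono_xy simp: M_def)
      define q where "q = top_form k h"
      have tq: "top_form (n + m - 2) (h * h) = q * q" using top_form_mult[OF bh bh] k by (simp add: q_def mult_2)
      \<comment> \<open>In degree k the set \<open>M\<close> retains only 2 j + 1 < m, that is 2 i
        >= n. Hence q^2 is divisible by t^n and \<open>lam\<close> vanishes on it.\<close>
      have cq: "coeff q i = 0" if "2 * i < n" for i
      proof (cases "i \<le> k")
        case True
        have "coeff (coeff h i) (k - i) = (\<Sum>ij\<in>M. 0)"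
          unfolding h coeff_sum case_prod_unfold using that k nm True
          by (intro sum.cong refl) (auto simp: coeff_mono_xy M_def)
        then show ?thesis by (simp add: q_def coeff_top_form)
      qed (simp add: q_def coeff_top_form)
      have "coeff (q * q) i = 0" if "i < n" for i
        unfolding coeff_mult
      proof (intro sum.neutral ballI)
        fix j assume "j \<in> {..i}"
        then have "2 * j < n \<or> 2 * (i - j) < n" using that by auto
        then show "coeff q j * coeff q (i - j) = 0" using cq by auto
      qed
      then have "monom 1 n dvd q * q" by (simp add: monom_1_dvd_iff')
      then obtain p where "q * q = monom 1 n * p" by (elim dvdE)
      then show ?thesis using high[of "p * B"] by (simp add: tq lam_def mult_ac)
    qed
  qed
  moreover have "n * m \<le> 2 * card M + 1" unfolding M_def by (rule box_half_card[OF nm])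
  ultimately show ?thesis by simp
qed

section \<open>Perturbing univariate polynomials\<close>

text \<open>A certificate for \<open>card I\<close> distinct real zeros, the pairs being the
  endpoints of intervals that may touch. Unlike the zeros themselves it survives small
  perturbations.\<close>

definition sign_changes :: "(real \<times> real) set \<Rightarrow> real poly \<Rightarrow> bool" where
  "sign_changes I p \<longleftrightarrow> finite I \<and> pairwise (\<lambda>a b. snd a \<le> fst b \<or> snd b \<le> fst a) I \<and>
     (\<forall>a\<in>I. fst a < snd a \<and> poly p (fst a) * poly p (snd a) < 0)"

lemma sign_changes_card:
  assumes "sign_changes I p" "p \<noteq> 0"
  shows "card I \<le> card {t. poly p t = 0}"
proof -
  have "\<exists>x. fst a < x \<and> x < snd a \<and> poly p x = 0" if "a \<in> I" for a
  proof -
    have *: "fst a < snd a" "poly p (fst a) * poly p (snd a) < 0" using assms that by (auto simp: sign_changes_def)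
    then consider "poly p (fst a) < 0" "poly p (snd a) > 0" | "poly p (fst a) > 0" "poly p (snd a) < 0"
      by (auto simp: mult_less_0_iff)
    then show ?thesis using poly_IVT_pos poly_IVT_neg *(1) by cases blast+
  qed
  then obtain f where f: "\<And>a. a \<in> I \<Longrightarrow> fst a < f a \<and> f a < snd a \<and> poly p (f a) = 0" by metis
  have "inj_on f I"
  proof (rule inj_onI, rule ccontr)
    fix a b assume "a \<in> I" "b \<in> I" "f a = f b" "a \<noteq> b"
    then show False using assms(1) f[of a] f[of b] unfolding sign_changes_def pairwise_def by force
  qed
  then show ?thesis using f assms(2)
    by (intro card_inj_on_le[of f]) (auto intro: poly_roots_finite)
qed

lemma sign_changes_stable:
  assumes "sign_changes I p"
  shows "\<forall>\<^sub>F e in at_right 0. sign_changes I (p + smult e L)"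
proof -
  have "\<forall>\<^sub>F e in at_right 0. poly (p + smult e L) (fst a) * poly (p + smult e L) (snd a) < 0" if "a \<in> I" for a
  proof -
    have "((\<lambda>e. poly (p + smult e L) (fst a) * poly (p + smult e L) (snd a)) \<longlongrightarrow>
        (poly p (fst a) + 0 * poly L (fst a)) * (poly p (snd a) + 0 * poly L (snd a))) (at_right 0)"
      by (simp only: poly_add poly_smult) (intro tendsto_intros)
    moreover have "(poly p (fst a) + 0 * poly L (fst a)) * (poly p (snd a) + 0 * poly L (snd a)) < 0"
      using assms that by (simp add: sign_changes_def)
    ultimately show ?thesis by (rule order_tendstoD(2))
  qed
  then have "\<forall>\<^sub>F e in at_right 0. \<forall>a\<in>I. poly (p + smult e L) (fst a) * poly (p + smult e L) (snd a) < 0"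
    using assms by (intro eventually_ball_finite) (auto simp: sign_changes_def)
  then show ?thesis
    by eventually_elim (use assms in \<open>auto simp: sign_changes_def\<close>)
qed

lemma poly_sign_at_top:
  fixes p :: "real poly"
  assumes "p \<noteq> 0"
  shows "\<exists>n. \<forall>x\<ge>n. 0 < lead_coeff p * poly p x"
proof -
  have "0 < lead_coeff p * lead_coeff p" using assms by (metis leading_coeff_0_iff not_real_square_gt_zero)
  then have "lead_coeff (smult (lead_coeff p) p) > 0" using assms by (simp add: degree_smult_eq)
  then obtain n where "\<forall>x\<ge>n. poly (smult (lead_coeff p) p) x \<ge> lead_coeff (smult (lead_coeff p) p)"
    using poly_pinfty_gt_lc by blast
  then show ?thesis using \<open>lead_coeff (smult (lead_coeff p) p) > 0\<close>
    by (intro exI[of _ n]) (auto intro: less_le_trans)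
qed

lemma eventually_at_right_witness:
  assumes "\<forall>\<^sub>F e in at_right (0::real). P e"
  obtains e where "0 < e" "P e"
proof -
  obtain b where "b > 0" "\<forall>e. 0 < e \<and> e < b \<longrightarrow> P e"
    using assms unfolding eventually_at_right_field by auto
  then show thesis using that[of "b / 2"] by auto
qed

text \<open>At a zero \<open>a\<close> where P does not change sign, a small term of the sign
  opposite to that of P nearby forces a sign change between \<open>a\<close> and a + \<rho>. The
  other zeros are already certified by stable sign changes. The correction has lower degree than P,
  so the leading coefficient is preserved.\<close>

lemma perturb_real_roots:
  assumes P0: "P \<noteq> 0"
  obtains L I where "degree L \<le> degree P" "coeff L (degree P) = 0" "card I = card {t. poly P t = 0}"
    "\<forall>\<^sub>F e in at_right 0. sign_changes I (P + smult e L)"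
proof -
  define R where "R = {t. poly P t = 0}"
  have finR: "finite R" unfolding R_def using P0 by (rule poly_roots_finite)
  have "\<forall>\<^sub>F \<rho> in at_right 0. \<forall>a\<in>R. \<forall>b\<in>R. a \<noteq> b \<longrightarrow> 2 * \<rho> < \<bar>a - b\<bar>"
  proof (intro eventually_ball_finite finR ballI)
    fix a b :: real
    show "\<forall>\<^sub>F \<rho> in at_right 0. a \<noteq> b \<longrightarrow> 2 * \<rho> < \<bar>a - b\<bar>"
    proof (cases "a = b")
      case False
      then show ?thesis unfolding eventually_at_right_field by (intro exI[of _ "\<bar>a - b\<bar> / 2"]) auto
    qed simp
  qed
  then obtain \<rho> where \<rho>: "0 < \<rho>" and sep: "\<And>a b. a \<in> R \<Longrightarrow> b \<in> R \<Longrightarrow> a \<noteq> b \<Longrightarrow> 2 * \<rho> < \<bar>a - b\<bar>"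
    by (rule eventually_at_right_witness) auto
  have nz: "poly P (a + \<rho>) \<noteq> 0" "poly P (a - \<rho>) \<noteq> 0" if "a \<in> R" for a
    using sep[OF that, of "a + \<rho>"] sep[OF that, of "a - \<rho>"] \<rho> by (auto simp: R_def)
  define E where "E = {a \<in> R. 0 < poly P (a - \<rho>) * poly P (a + \<rho>)}"
  have finE: "finite E" and ER: "E \<subseteq> R" using finR by (auto simp: E_def)
  \<comment> \<open>Lagrange interpolation without denominators: the value at \<open>a\<close> is
    minus P(a + \<rho>) times a square.\<close>
  define L where "L = (\<Sum>a\<in>E. smult (- poly P (a + \<rho>) * (\<Prod>b\<in>E - {a}. (a - b))) (\<Prod>b\<in>E - {a}. [:- b, 1:]))"
  have La: "poly L a * poly P (a + \<rho>) < 0" if a: "a \<in> E" for a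
  proof -
    have "poly L a = (\<Sum>c\<in>E. if c = a then - poly P (a + \<rho>) * (\<Prod>b\<in>E - {a}. (a - b)) * (\<Prod>b\<in>E - {a}. (a - b)) else 0)"
      unfolding L_def poly_sum
    proof (intro sum.cong refl)
      fix c assume c: "c \<in> E"
      show "poly (smult (- poly P (c + \<rho>) * (\<Prod>b\<in>E - {c}. (c - b))) (\<Prod>b\<in>E - {c}. [:- b, 1:])) a
        = (if c = a then - poly P (a + \<rho>) * (\<Prod>b\<in>E - {a}. (a - b)) * (\<Prod>b\<in>E - {a}. (a - b)) else 0)"
        using a finE by (auto simp: poly_prod intro!: prod_zero)
    qed
    also have "\<dots> = - poly P (a + \<rho>) * (\<Prod>b\<in>E - {a}. (a - b))\<^sup>2"
      using a finE by (simp add: power2_eq_square)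
    finally have "poly L a * poly P (a + \<rho>) = - ((poly P (a + \<rho>))\<^sup>2 * (\<Prod>b\<in>E - {a}. (a - b))\<^sup>2)"
      by (simp add: power2_eq_square mult_ac)
    moreover have "(\<Prod>b\<in>E - {a}. (a - b)) \<noteq> 0" using finE by auto
    moreover have "poly P (a + \<rho>) \<noteq> 0" using nz a ER by blast
    ultimately show ?thesis by (simp add: zero_less_mult_iff)
  qed
  have dL: "degree L \<le> degree P \<and> coeff L (degree P) = 0"
  proof (cases "E = {}")
    case True then show ?thesis by (simp add: L_def)
  next
    case False
    have "degree L \<le> card E - 1"
      unfolding L_def
    proof (intro degree_sum_le finE)
      fix a assume "a \<in> E"
      have "degree (\<Prod>b\<in>E - {a}. [:- b, 1:]) = card E - 1"
        using \<open>a \<in> E\<close> finE by (subst degree_prod_eq_sum_degree) auto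
      then show "degree (smult (- poly P (a + \<rho>) * (\<Prod>b\<in>E - {a}. (a - b))) (\<Prod>b\<in>E - {a}. [:- b, 1:])) \<le> card E - 1"
        by (metis degree_smult_le)
    qed
    moreover have "card E \<le> degree P"
      using card_mono[OF finR ER] card_poly_roots_bound[OF P0] by (simp add: R_def)
    moreover have "0 < card E" using False finE by (simp add: card_gt_0_iff)
    ultimately have "degree L < degree P" by linarith
    then show ?thesis by (auto intro: coeff_eq_0)
  qed
  \<comment> \<open>For \<open>a\<close> in \<open>E\<close> the left endpoint is the zero itself:
    there the perturbed value is e L(a), of definite sign for every positive e.\<close>
  define i where "i a = (if a \<in> E then a else a - \<rho>, a + \<rho>)" for a
  have injI: "inj_on i R" by (auto simp: inj_on_def i_def)
  have ev: "\<forall>\<^sub>F e in at_right 0. poly (P + smult e L) (fst (i a)) * poly (P + smult e L) (snd (i a)) < 0" if a: "a \<in> R" for a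
  proof (cases "a \<in> E")
    case True
    have "((\<lambda>e. poly L a * (poly P (a + \<rho>) + e * poly L (a + \<rho>))) \<longlongrightarrow> poly L a * (poly P (a + \<rho>) + 0 * poly L (a + \<rho>))) (at_right 0)"
      by (intro tendsto_intros)
    then have "\<forall>\<^sub>F e in at_right 0. poly L a * (poly P (a + \<rho>) + e * poly L (a + \<rho>)) < 0"
      by (rule order_tendstoD(2)) (use La[OF True] in simp)
    moreover have "\<forall>\<^sub>F e in at_right (0::real). 0 < e" by (simp add: eventually_at_right_less)
    ultimately show ?thesis
    proof eventually_elim
      case (elim e)
      have "poly (P + smult e L) (fst (i a)) * poly (P + smult e L) (snd (i a)) = e * (poly L a * (poly P (a + \<rho>) + e * poly L (a + \<rho>)))"
        using True a by (simp add: i_def R_def)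
      then show ?case using elim by (simp add: mult_pos_neg)
    qed
  next
    case False
    then have "poly P (a - \<rho>) * poly P (a + \<rho>) < 0" using a nz[OF a] by (auto simp: E_def not_less le_less)
    then have "sign_changes {i a} P" using False \<rho> by (simp add: sign_changes_def i_def)
    from sign_changes_stable[OF this, of L] show ?thesis by eventually_elim (simp add: sign_changes_def)
  qed
  have "\<forall>\<^sub>F e in at_right 0. \<forall>a\<in>R. poly (P + smult e L) (fst (i a)) * poly (P + smult e L) (snd (i a)) < 0"
    using ev finR by (intro eventually_ball_finite) auto
  then have ev': "\<forall>\<^sub>F e in at_right 0. sign_changes (i ` R) (P + smult e L)"
  proof eventually_elim
    case (elim e)
    have "snd (i a) \<le> fst (i b) \<or> snd (i b) \<le> fst (i a)" if "a \<in> R" "b \<in> R" "a \<noteq> b" for a b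
      using sep[OF that] \<rho> by (auto simp: i_def abs_if split: if_splits)
    moreover have "fst (i a) < snd (i a)" for a using \<rho> by (simp add: i_def)
    ultimately show ?case using elim finR unfolding sign_changes_def pairwise_def by blast
  qed
  have "card (i ` R) = card R" using injI by (rule card_image)
  then show thesis using that[OF _ _ _ ev'] dL by (simp add: R_def)
qed

text \<open>A double zero of p + s is a critical point of p with critical value - s, and there are
  only finitely many critical values.\<close>

lemma squarefree_generic_constant:
  assumes "1 \<le> degree p"
  shows "\<forall>\<^sub>F s in at_right 0. rsquarefree (cpoly (p + smult s [:1:]))"
proof -
  let ?Q = "cpoly p"
  have "pderiv ?Q \<noteq> 0" using assms by (simp add: pderiv_eq_0_iff degree_cpoly)
  then have fin: "finite {z. poly (pderiv ?Q) z = 0}" by (rule poly_roots_finite)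
  \<comment> \<open>Comparing real parts suffices to keep the real number - s away from the complex
    critical values.\<close>
  have "\<forall>\<^sub>F s in at_right 0. \<forall>z\<in>{z. poly (pderiv ?Q) z = 0}. s \<noteq> - Re (poly ?Q z)"
    using fin by (intro eventually_ball_finite ballI eventually_neq_at_within)
  then show ?thesis
  proof eventually_elim
    case (elim s)
    have eq: "cpoly (p + smult s [:1:]) = ?Q + [:of_real s:]"
      by (rule poly_eqI) (simp add: coeff_cpoly coeff_pCons split: nat.split)
    have "pderiv (?Q + [:of_real s:]) = pderiv ?Q" by (simp add: pderiv_add)
    then show ?case unfolding eq rsquarefree_roots using elim by (auto simp: complex_eq_iff)
  qed
qed

text \<open>
  \<open>S\<close> stands for a condition that is stable under small perturbations. The perturbation is made in
  three stages: splitting each real zero without sign change, producing a new real zero near infinity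
  if the degree is too small, and moving a generic amount vertically.
\<close>

lemma perturb_to_squarefree:
  assumes P0: "P \<noteq> 0" and dP: "degree P \<le> N" and N: "1 \<le> N" and GP: "S P"
    and stable: "\<And>p L. S p \<Longrightarrow> degree p \<le> N \<Longrightarrow> degree L \<le> N \<Longrightarrow> \<forall>\<^sub>F e in at_right 0. S (p + smult e L)"
  obtains p where "S p" "degree p = N" "rsquarefree (cpoly p)"
    "card {t. poly P t = 0} + (if degree P < N then 1 else 0) \<le> card {t. poly p t = 0}"
proof -
  let ?l = "lead_coeff P"
  obtain L I where L: "degree L \<le> degree P" "coeff L (degree P) = 0" "card I = card {t. poly P t = 0}"
    "\<forall>\<^sub>F e in at_right 0. sign_changes I (P + smult e L)"
    using perturb_real_roots[OF P0] by metis
  have "\<forall>\<^sub>F e in at_right 0. S (P + smult e L)" using L(1) dP by (intro stable GP) auto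
  with L(4) have "\<forall>\<^sub>F e in at_right 0. S (P + smult e L) \<and> sign_changes I (P + smult e L)" by eventually_elim auto
  then obtain e where e: "S (P + smult e L)" "sign_changes I (P + smult e L)"
    by (rule eventually_at_right_witness) auto
  define A where "A = P + smult e L"
  have dA: "degree A = degree P" "lead_coeff A = ?l"
  proof -
    have c: "coeff A (degree P) = ?l" by (simp add: A_def L(2))
    have "degree A \<le> degree P" unfolding A_def using L(1) by (intro degree_add_le) (auto intro: order_trans[OF degree_smult_le])
    moreover have "degree P \<le> degree A" using c P0 by (intro le_degree) simp
    ultimately show d: "degree A = degree P" by simp
    show "lead_coeff A = ?l" unfolding d by (rule c)
  qed
  have A0: "A \<noteq> 0" using dA(2) P0 by auto
  have "\<exists>B J. S B \<and> degree B = N \<and> sign_changes J B \<and> card J = card I + (if degree P < N then 1 else 0)"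
  proof (cases "degree P < N")
    case False
    then show ?thesis using e dA dP by (intro exI[of _ A] exI[of _ I]) (auto simp: A_def)
  next
    case True
    have finI: "finite I" using e by (simp add: sign_changes_def)
    obtain n where n: "\<And>x. x \<ge> n \<Longrightarrow> 0 < ?l * poly A x" using poly_sign_at_top[OF A0] unfolding dA(2) by auto
    obtain T where T: "T \<ge> n" "\<And>a. a \<in> I \<Longrightarrow> snd a \<le> T"
    proof
      show "Max (insert n (snd ` I)) \<ge> n" using finI by simp
      show "snd a \<le> Max (insert n (snd ` I))" if "a \<in> I" for a using finI that by (intro Max_ge) auto
    qed
    \<comment> \<open>A positive multiple of this monomial gives the opposite sign near infinity,
      while at T the old sign persists. The resulting zero beyond T replaces the zero at infinity of
      a form of too small degree.\<close>
    let ?M = "monom (- ?l) N"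
    have "\<forall>\<^sub>F e in at_right 0. S (A + smult e ?M)"
      using e dA dP by (intro stable) (auto simp: A_def degree_monom_le)
    moreover have "\<forall>\<^sub>F e in at_right 0. sign_changes I (A + smult e ?M)"
      using e(2) unfolding A_def by (rule sign_changes_stable)
    moreover have "\<forall>\<^sub>F e in at_right 0. 0 < ?l * poly (A + smult e ?M) T"
    proof -
      have "((\<lambda>e. ?l * poly (A + smult e ?M) T) \<longlongrightarrow> ?l * (poly A T + 0 * poly ?M T)) (at_right 0)"
        by (simp only: poly_add poly_smult) (intro tendsto_intros)
      then show ?thesis by (rule order_tendstoD(1)) (use n[OF T(1)] in simp)
    qed
    moreover have "\<forall>\<^sub>F e in at_right (0::real). 0 < e" by (simp add: eventually_at_right_less)
    ultimately have "\<forall>\<^sub>F e in at_right 0. S (A + smult e ?M) \<and> sign_changes I (A + smult e ?M) \<and> 0 < ?l * poly (A + smult e ?M) T \<and> 0 < e"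
      by eventually_elim auto
    then obtain s where s: "S (A + smult s ?M)" "sign_changes I (A + smult s ?M)" "0 < ?l * poly (A + smult s ?M) T" "0 < s"
      by (rule eventually_at_right_witness) auto
    define B where "B = A + smult s ?M"
    have l0: "?l \<noteq> 0" using P0 by simp
    have cB: "coeff B N = - s * ?l" using True dA by (simp add: B_def coeff_eq_0)
    have dB: "degree B = N"
    proof (rule antisym)
      show "degree B \<le> N" unfolding B_def using dA True
        by (intro degree_add_le) (auto intro!: order_trans[OF degree_smult_le] degree_monom_le)
      show "N \<le> degree B" using cB s(4) l0 by (intro le_degree) simp
    qed
    have B0: "B \<noteq> 0" using dB N by auto
    obtain n' where n': "\<And>x. x \<ge> n' \<Longrightarrow> 0 < lead_coeff B * poly B x" using poly_sign_at_top[OF B0] by auto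
    define V where "V = max n' (T + 1)"
    have "0 < - s * ?l * poly B V" using n'[of V] cB dB by (simp add: V_def)
    then have V: "?l * poly B V < 0" using s(4) by (simp add: mult_less_0_iff zero_less_mult_iff)
    have TB: "0 < ?l * poly B T" using s(3) by (simp add: B_def)
    have "poly B T * poly B V < 0" using V TB by (auto simp: zero_less_mult_iff mult_less_0_iff)
    then have "sign_changes (insert (T, V) I) B"
      using s(2) T(2) unfolding sign_changes_def B_def[symmetric] pairwise_insert by (auto simp: V_def)
    moreover have "(T, V) \<notin> I" using T(2) by (force simp: V_def)
    ultimately show ?thesis using s(1) dB finI True by (intro exI[of _ B] exI[of _ "insert (T, V) I"]) (auto simp: B_def)
  qed
  then obtain B J where B: "S B" "degree B = N" "sign_changes J B" "card J = card I + (if degree P < N then 1 else 0)" by blast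
  have "\<forall>\<^sub>F s in at_right 0. rsquarefree (cpoly (B + smult s [:1:]))" using B(2) N by (intro squarefree_generic_constant) simp
  moreover have "\<forall>\<^sub>F s in at_right 0. S (B + smult s [:1:])" using B(1,2) N by (intro stable) auto
  moreover have "\<forall>\<^sub>F s in at_right 0. sign_changes J (B + smult s [:1:])" using B(3) by (rule sign_changes_stable)
  ultimately have "\<forall>\<^sub>F s in at_right 0. rsquarefree (cpoly (B + smult s [:1:])) \<and> S (B + smult s [:1:]) \<and> sign_changes J (B + smult s [:1:])"
    by eventually_elim auto
  then obtain s where s: "rsquarefree (cpoly (B + smult s [:1:]))" "S (B + smult s [:1:])" "sign_changes J (B + smult s [:1:])"
    by (rule eventually_at_right_witness) auto
  have "degree (B + smult s [:1:]) = N" using B(2) N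
    by (subst degree_add_eq_left) (auto simp: degree_pCons_0)
  moreover from this have "B + smult s [:1:] \<noteq> 0" using N by auto
  ultimately show thesis using that s sign_changes_card[OF s(3)] B(4) L(3) by simp
qed

section \<open>Wells\<close>

lemma deriv_x_minus: "deriv_x (- p) = - deriv_x p"
  by (intro poly_eqI) (simp add: coeff_deriv_x)

lemma deriv_y_minus: "deriv_y (- p) = - deriv_y p"
  by (simp add: deriv_y_def pderiv_minus)

lemma hess_minus: "hess (- p) z = hess p z"
  by (simp add: hess_def deriv_x_minus deriv_y_minus eval_xy_minus)

definition well :: "(real \<times> real \<Rightarrow> real) \<Rightarrow> (real \<times> real) set \<Rightarrow> bool" where
  "well h W \<longleftrightarrow> open W \<and> bounded W \<and>
     (\<exists>q\<in>W. (\<forall>z\<in>closure W - W. h q < h z) \<or> (\<forall>z\<in>closure W - W. h z < h q))"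

definition wells :: "(real \<times> real \<Rightarrow> real) \<Rightarrow> (real \<times> real) set set \<Rightarrow> bool" where
  "wells h \<W> \<longleftrightarrow> finite \<W> \<and> pairwise disjnt \<W> \<and> (\<forall>W\<in>\<W>. well h W)"

abbreviation evalp :: "poly_xy \<Rightarrow> real \<times> real \<Rightarrow> real" where
  "evalp H z \<equiv> eval_xy H (fst z) (snd z)"

lemma well_uminus: "well (\<lambda>z. - h z) W \<longleftrightarrow> well h W"
  by (auto simp: well_def)

lemma compact_closure_diff: "open W \<Longrightarrow> bounded W \<Longrightarrow> compact (closure W - W)"
  for W :: "(real \<times> real) set"
  by (intro compact_diff) auto

text \<open>The boundary is compact, so by the tube lemma the strict inequality at all of its points
  persists for parameters near \<open>w0\<close>.\<close>

lemma well_stable: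
  fixes \<Phi> :: "'a::topological_space \<Rightarrow> real \<times> real \<Rightarrow> real"
  assumes cont: "continuous_on UNIV (\<lambda>p. \<Phi> (fst p) (snd p))" and W: "well (\<Phi> w0) W"
  shows "\<forall>\<^sub>F w in nhds w0. well (\<Phi> w) W"
proof -
  have *: "\<forall>\<^sub>F w in nhds w0. well (\<Psi> w) W"
    if cont: "continuous_on UNIV (\<lambda>p. \<Psi> (fst p) (snd p))" and oW: "open W" "bounded W" "q \<in> W"
      and q: "\<forall>z\<in>closure W - W. \<Psi> w0 q < \<Psi> w0 z" for q and \<Psi> :: "'a \<Rightarrow> real \<times> real \<Rightarrow> real"
  proof -
    let ?O = "{p. \<Psi> (fst p) q < \<Psi> (fst p) (snd p)}"
    have "continuous_on UNIV (\<lambda>p::'a \<times> (real \<times> real). \<Psi> (fst p) q)"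
      using continuous_on_compose2[OF cont, of UNIV "\<lambda>p. (fst p, q)"] by (simp add: continuous_on_Pair continuous_on_fst continuous_on_const continuous_on_id)
    then have "open ?O" using cont by (intro open_Collect_less)
    moreover have "{w0} \<times> (closure W - W) \<subseteq> ?O" using q by auto
    ultimately obtain X where X: "w0 \<in> X" "open X" "X \<times> (closure W - W) \<subseteq> ?O"
      using Elementary_Topology.tube_lemma[of "closure W - W" ?O w0] compact_closure_diff[OF oW(1,2)] by blast
    have "well (\<Psi> w) W" if "w \<in> X" for w
    proof -
      have "\<forall>z\<in>closure W - W. \<Psi> w q < \<Psi> w z" using X(3) that by auto
      then show ?thesis unfolding well_def using oW by blast
    qed
    then show ?thesis unfolding eventually_nhds using X(1,2) by blast
  qed
  obtain q where q: "open W" "bounded W" "q \<in> W"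
    "(\<forall>z\<in>closure W - W. \<Phi> w0 q < \<Phi> w0 z) \<or> (\<forall>z\<in>closure W - W. \<Phi> w0 z < \<Phi> w0 q)"
    using W by (auto simp: well_def)
  from q(4) show ?thesis
  proof
    assume "\<forall>z\<in>closure W - W. \<Phi> w0 q < \<Phi> w0 z"
    with * cont q show ?thesis by blast
  next
    assume "\<forall>z\<in>closure W - W. \<Phi> w0 z < \<Phi> w0 q"
    then have "\<forall>\<^sub>F w in nhds w0. well (\<lambda>z. - \<Phi> w z) W"
      using *[of "\<lambda>w z. - \<Phi> w z" q] cont q by (simp add: continuous_on_minus)
    then show ?thesis by (simp only: well_uminus)
  qed
qed

lemma wells_stable:
  fixes \<Phi> :: "'a::topological_space \<Rightarrow> real \<times> real \<Rightarrow> real"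
  assumes cont: "continuous_on UNIV (\<lambda>p. \<Phi> (fst p) (snd p))" and W: "wells (\<Phi> w0) \<W>"
  shows "\<forall>\<^sub>F w in nhds w0. wells (\<Phi> w) \<W>"
proof -
  have "\<forall>\<^sub>F w in nhds w0. \<forall>W\<in>\<W>. well (\<Phi> w) W"
    using W by (intro eventually_ball_finite) (auto simp: wells_def intro: well_stable[OF cont])
  then show ?thesis by eventually_elim (use W in \<open>auto simp: wells_def\<close>)
qed

lemma not_local_min_if_second_deriv_neg:
  fixes f f' :: "real \<Rightarrow> real"
  assumes "\<And>s. (f has_real_derivative f' s) (at s)" "f' 0 = 0" "(f' has_real_derivative d) (at 0)" "d < 0"
  shows "\<exists>e>0. \<forall>s. 0 < s \<and> s < e \<longrightarrow> f s < f 0"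
proof -
  obtain e where e: "e > 0" "\<And>s. 0 < s \<Longrightarrow> s < e \<Longrightarrow> f' (0 + s) < f' 0"
    using DERIV_neg_dec_right[OF assms(3,4)] by blast
  have "f s < f 0" if s: "0 < s" "s < e" for s
  proof -
    obtain z where z: "0 < z" "z < s" "f s - f 0 = (s - 0) * f' z"
      using MVT2[OF s(1), of f f'] assms(1) by blast
    then have "f' z < 0" using e(2)[of z] s assms(2) by simp
    then have "(s - 0) * f' z < 0" using s(1) by (simp add: mult_pos_neg)
    then show ?thesis using z(3) by linarith
  qed
  then show ?thesis using e(1) by blast
qed

text \<open>A negative Hessian determinant gives a direction of negative second derivative, along
  which the function would decrease.\<close>

lemma hess_local_min:
  assumes "open W" "z \<in> W" "\<And>w. w \<in> W \<Longrightarrow> evalp H z \<le> evalp H w"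
  shows "evalp (deriv_x H) z = 0 \<and> evalp (deriv_y H) z = 0 \<and> 0 \<le> hess H z"
proof -
  have "(\<lambda>h. evalp (deriv_x H) z * fst h + evalp (deriv_y H) z * snd h) = (\<lambda>v. 0)"
    using assms by (intro differential_zero_maxmin[OF assms(2,1) eval_xy_has_derivative]) blast
  then have *: "evalp (deriv_x H) z * fst h + evalp (deriv_y H) z * snd h = 0" for h by meson
  have crit: "evalp (deriv_x H) z = 0" "evalp (deriv_y H) z = 0" using *[of "(1, 0)"] *[of "(0, 1)"] by auto
  have "0 \<le> hess H z"
  proof (rule ccontr)
    define A where "A = evalp (deriv_x (deriv_x H)) z"
    define B where "B = evalp (deriv_x (deriv_y H)) z"
    define C where "C = evalp (deriv_y (deriv_y H)) z"
    assume "\<not> 0 \<le> hess H z"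
    then have neg: "A * C - B\<^sup>2 < 0" by (simp add: hess_def A_def B_def C_def)
    \<comment> \<open>For A > 0 the vector (B, - A) gives A (A C - B^2). For A = 0 the form is
      linear in u at v = 1, and u is solved for to give the value - 1.\<close>
    have "\<exists>u v. A * u\<^sup>2 + 2 * B * u * v + C * v\<^sup>2 < 0"
    proof (cases A "0::real" rule: linorder_cases)
      case less
      then show ?thesis by (intro exI[of _ 1] exI[of _ 0]) simp
    next
      case greater
      have "A * B\<^sup>2 + 2 * B * B * (- A) + C * (- A)\<^sup>2 = A * (A * C - B\<^sup>2)" by (simp add: power2_eq_square algebra_simps)
      also have "\<dots> < 0" using greater neg by (simp add: mult_pos_neg)
      finally show ?thesis by blast
    next
      case equal
      then have "B \<noteq> 0" using neg by auto
      then have "A * (- (C + 1) / (2 * B))\<^sup>2 + 2 * B * (- (C + 1) / (2 * B)) * 1 + C * 1\<^sup>2 < 0" using equal by simp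
      then show ?thesis by blast
    qed
    then obtain u v where uv: "A * u\<^sup>2 + 2 * B * u * v + C * v\<^sup>2 < 0" by blast
    let ?x = "\<lambda>s. fst z + s * u" and ?y = "\<lambda>s. snd z + s * v"
    define f where "f s = eval_xy H (?x s) (?y s)" for s
    define f' where "f' s = eval_xy (deriv_x H) (?x s) (?y s) * u + eval_xy (deriv_y H) (?x s) (?y s) * v" for s
    have dx: "(?x has_real_derivative u) (at s)" "(?y has_real_derivative v) (at s)" for s
      by (auto intro!: derivative_eq_intros)
    have f: "(f has_real_derivative f' s) (at s)" for s
      unfolding f_def f'_def by (rule eval_xy_DERIV[OF dx])
    have "(f' has_real_derivative
        ((eval_xy (deriv_x (deriv_x H)) (?x 0) (?y 0) * u + eval_xy (deriv_y (deriv_x H)) (?x 0) (?y 0) * v) * u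
       + (eval_xy (deriv_x (deriv_y H)) (?x 0) (?y 0) * u + eval_xy (deriv_y (deriv_y H)) (?x 0) (?y 0) * v) * v)) (at 0)"
      unfolding f'_def by (intro DERIV_add DERIV_cmult_right eval_xy_DERIV[OF dx])
    also have "(eval_xy (deriv_x (deriv_x H)) (?x 0) (?y 0) * u + eval_xy (deriv_y (deriv_x H)) (?x 0) (?y 0) * v) * u
       + (eval_xy (deriv_x (deriv_y H)) (?x 0) (?y 0) * u + eval_xy (deriv_y (deriv_y H)) (?x 0) (?y 0) * v) * v
       = A * u\<^sup>2 + 2 * B * u * v + C * v\<^sup>2"
      by (simp add: A_def B_def C_def deriv_x_y_commute power2_eq_square algebra_simps)
    finally have f'': "(f' has_real_derivative (A * u\<^sup>2 + 2 * B * u * v + C * v\<^sup>2)) (at 0)" .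
    have "f' 0 = 0" using crit by (simp add: f'_def)
    from not_local_min_if_second_deriv_neg[OF f this f'' uv]
    obtain e where e: "e > 0" "\<And>s. 0 < s \<Longrightarrow> s < e \<Longrightarrow> f s < f 0" by blast
    have "((\<lambda>s. (?x s, ?y s)) \<longlongrightarrow> (?x 0, ?y 0)) (at_right 0)" by (intro tendsto_intros)
    then have "\<forall>\<^sub>F s in at_right 0. (?x s, ?y s) \<in> W" using assms(1,2) by (auto elim!: topological_tendstoD)
    moreover have "\<forall>\<^sub>F s in at_right 0. 0 < s \<and> s < e" using e(1) unfolding eventually_at_right_field by auto
    ultimately have "\<forall>\<^sub>F s in at_right (0::real). False"
    proof eventually_elim
      case (elim s)
      then show ?case using assms(3)[of "(?x s, ?y s)"] e(2)[of s] by (simp add: f_def)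
    qed
    then show False by (simp add: trivial_limit_at_right_real)
  qed
  with crit show ?thesis by simp
qed

text \<open>The minimum over the compact closure is at most the value at \<open>q\<close>, so it
  lies inside. Wells around a maximum reduce to this by passing to \<open>- H\<close>, which has the
  same Hessian determinant.\<close>

lemma well_critical:
  assumes "well (evalp H) W"
  shows "\<exists>z\<in>W. evalp (deriv_x H) z = 0 \<and> evalp (deriv_y H) z = 0 \<and> 0 \<le> hess H z"
proof -
  have *: "\<exists>z\<in>W. evalp (deriv_x G) z = 0 \<and> evalp (deriv_y G) z = 0 \<and> 0 \<le> hess G z"
    if W: "open W" "bounded W" "q \<in> W" "\<forall>z\<in>closure W - W. evalp G q < evalp G z" for G q
  proof -
    have "compact (closure W)" "closure W \<noteq> {}" using W by auto
    then obtain z where z: "z \<in> closure W" "\<And>w. w \<in> closure W \<Longrightarrow> evalp G z \<le> evalp G w"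
      using continuous_attains_inf[of "closure W" "evalp G"] continuous_on_eval_xy by blast
    have qc: "q \<in> closure W" using W closure_subset by blast
    have "z \<in> W"
    proof (rule ccontr)
      assume "z \<notin> W"
      then have "evalp G q < evalp G z" using W(4) z(1) by blast
      with z(2)[OF qc] show False by simp
    qed
    then show ?thesis using hess_local_min[OF W(1), of z G] z(2) closure_subset by blast
  qed
  obtain q where q: "open W" "bounded W" "q \<in> W"
    "(\<forall>z\<in>closure W - W. evalp H q < evalp H z) \<or> (\<forall>z\<in>closure W - W. evalp H z < evalp H q)"
    using assms by (auto simp: well_def)
  from q(4) show ?thesis
  proof
    assume "\<forall>z\<in>closure W - W. evalp H q < evalp H z"
    with *[OF q(1-3)] show ?thesis by blast
  next
    assume "\<forall>z\<in>closure W - W. evalp H z < evalp H q"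
    then have "\<forall>z\<in>closure W - W. evalp (- H) q < evalp (- H) z" by (simp add: eval_xy_minus)
    from *[OF q(1-3) this] show ?thesis by (auto simp: deriv_x_minus deriv_y_minus eval_xy_minus hess_minus)
  qed
qed

text \<open>Sard's theorem for the gradient map of \<open>H\<close>, whose Jacobian determinant is
  \<open>hess\<close>.\<close>

lemma hessian_critical_values_negligible:
  "negligible ((\<lambda>v::real^2. vector [eval_xy (deriv_x H) (vec_nth v 1) (vec_nth v 2), eval_xy (deriv_y H) (vec_nth v 1) (vec_nth v 2)] :: real^2)
     ` {v. hess H (vec_nth v 1, vec_nth v 2) = 0})" (is "negligible (?f ` ?S)")
proof (rule baby_Sard)
  show "CARD(2) \<le> CARD(2)" by simp
  let ?A = "\<lambda>v. \<lambda>h::real^2. vector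
      [eval_xy (deriv_x (deriv_x H)) (vec_nth v 1) (vec_nth v 2) * vec_nth h 1 + eval_xy (deriv_y (deriv_x H)) (vec_nth v 1) (vec_nth v 2) * vec_nth h 2,
       eval_xy (deriv_x (deriv_y H)) (vec_nth v 1) (vec_nth v 2) * vec_nth h 1 + eval_xy (deriv_y (deriv_y H)) (vec_nth v 1) (vec_nth v 2) * vec_nth h 2] :: real^2"
  fix v :: "real^2" assume v: "v \<in> ?S"
  have proj: "((\<lambda>v::real^2. (vec_nth v 1, vec_nth v 2)) has_derivative (\<lambda>h. (vec_nth h 1, vec_nth h 2))) (at v within ?S)"
    by (intro has_derivative_Pair bounded_linear.has_derivative[OF bounded_linear_vec_nth] has_derivative_ident)
  have ev: "((\<lambda>v::real^2. eval_xy p (vec_nth v 1) (vec_nth v 2)) has_derivative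
      (\<lambda>h. eval_xy (deriv_x p) (vec_nth v 1) (vec_nth v 2) * vec_nth h 1 + eval_xy (deriv_y p) (vec_nth v 1) (vec_nth v 2) * vec_nth h 2)) (at v within ?S)" for p
    using has_derivative_compose[OF proj eval_xy_has_derivative[of p]] by simp
  show "(?f has_derivative ?A v) (at v within ?S)"
  proof (subst has_derivative_componentwise_within, intro ballI)
    fix b :: "real^2" assume "b \<in> Basis"
    then consider "b = axis 1 1" | "b = axis 2 1" by (auto simp: Basis_vec_def UNIV_2)
    then show "((\<lambda>x. ?f x \<bullet> b) has_derivative (\<lambda>x. ?A v x \<bullet> b)) (at v within ?S)"
      by cases (simp_all add: inner_axis ev)
  qed
  have lin: "linear (?A v)"
    by (intro linearI) (auto simp: vec_eq_iff forall_2 algebra_simps)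
  have "det (matrix (?A v)) = 0"
    using v by (simp add: det_2 matrix_def axis_def hess_def deriv_x_y_commute power2_eq_square mult_ac)
  then show "rank (matrix (?A v)) < CARD(2)" by (simp add: det_eq_0_rank)
qed

lemma eval_xy_linear: "eval_xy (mono_xy 0 1 a + mono_xy 1 0 b) x y = a * x + b * y"
  by (simp add: eval_xy_add eval_xy_mono)

text \<open>A linear term translates the gradient by a constant and leaves the Hessian unchanged. A
  small translation that makes 0 a regular value of the gradient keeps the wells, and the
  semidefinite extremum in each of them becomes nondegenerate.\<close>

lemma wells_nondegenerate_critical_points:
  assumes "wells (evalp H) \<W>"
  obtains a b Z where "finite Z" "card Z = card \<W>"
    "\<And>z. z \<in> Z \<Longrightarrow> evalp (deriv_x (H + (mono_xy 0 1 a + mono_xy 1 0 b))) z = 0"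
    "\<And>z. z \<in> Z \<Longrightarrow> evalp (deriv_y (H + (mono_xy 0 1 a + mono_xy 1 0 b))) z = 0"
    "\<And>z. z \<in> Z \<Longrightarrow> 0 < hess (H + (mono_xy 0 1 a + mono_xy 1 0 b)) z"
proof -
  let ?L = "\<lambda>c :: real^2. mono_xy 0 1 (vec_nth c 1) + mono_xy 1 0 (vec_nth c 2)"
  let ?\<Phi> = "\<lambda>(c :: real^2) z. evalp H z + (vec_nth c 1 * fst z + vec_nth c 2 * snd z)"
  have "continuous_on UNIV (\<lambda>p. ?\<Phi> (fst p) (snd p))"
    by (intro continuous_intros)
  moreover have "wells (?\<Phi> 0) \<W>" using assms by simp
  ultimately have "\<forall>\<^sub>F c in nhds 0. wells (?\<Phi> c) \<W>" by (rule wells_stable)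
  then obtain X where X: "open X" "0 \<in> X" "\<And>c. c \<in> X \<Longrightarrow> wells (?\<Phi> c) \<W>"
    unfolding eventually_nhds by blast
  let ?N = "(\<lambda>v::real^2. vector [eval_xy (deriv_x H) (vec_nth v 1) (vec_nth v 2), eval_xy (deriv_y H) (vec_nth v 1) (vec_nth v 2)] :: real^2)
     ` {v. hess H (vec_nth v 1, vec_nth v 2) = 0}"
  have "\<not> uminus ` X \<subseteq> ?N"
  proof
    assume "uminus ` X \<subseteq> ?N"
    then have "negligible (uminus ` X)" using hessian_critical_values_negligible negligible_subset by blast
    moreover have "open (uminus ` X)" using X(1) by (rule open_negations)
    ultimately show False using open_not_negligible X(2) by blast
  qed
  then obtain c where c: "c \<in> X" "- c \<notin> ?N" by blast
  let ?G = "H + ?L c"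
  have ev: "evalp ?G = ?\<Phi> c" by (rule ext) (simp only: eval_xy_add[of H] eval_xy_linear)
  have "wells (evalp ?G) \<W>" unfolding ev using X(3) c(1) by blast
  then have w: "\<And>W. W \<in> \<W> \<Longrightarrow> well (evalp ?G) W" "finite \<W>" "pairwise disjnt \<W>" by (auto simp: wells_def)
  have dx: "deriv_x ?G = deriv_x H + mono_xy 0 0 (vec_nth c 1)" by (simp add: deriv_x_add deriv_x_mono_xy) (simp add: mono_xy_def)
  have dy: "deriv_y ?G = deriv_y H + mono_xy 0 0 (vec_nth c 2)" by (simp add: deriv_y_add deriv_y_mono_xy) (simp add: mono_xy_def)
  have hG: "hess ?G z = hess H z" for z
    by (simp add: hess_def dx dy deriv_x_add deriv_y_add deriv_x_mono_xy deriv_y_mono_xy) (simp add: mono_xy_def)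
  have nd: "hess ?G z \<noteq> 0" if "evalp (deriv_x ?G) z = 0" "evalp (deriv_y ?G) z = 0" for z
  proof
    assume "hess ?G z = 0"
    let ?v = "vector [fst z, snd z] :: real^2"
    have "?v \<in> {v. hess H (vec_nth v 1, vec_nth v 2) = 0}" using \<open>hess ?G z = 0\<close> unfolding hG by simp
    moreover have "- c = vector [eval_xy (deriv_x H) (vec_nth ?v 1) (vec_nth ?v 2), eval_xy (deriv_y H) (vec_nth ?v 1) (vec_nth ?v 2)]"
    proof -
      have "evalp (deriv_x H) z + vec_nth c 1 = 0" "evalp (deriv_y H) z + vec_nth c 2 = 0"
        using that unfolding dx dy by (simp_all add: eval_xy_add eval_xy_mono)
      then show ?thesis by (simp add: vec_eq_iff forall_2)
    qed
    ultimately show False using c(2) by blast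
  qed
  obtain f where f: "\<And>W. W \<in> \<W> \<Longrightarrow> f W \<in> W \<and> evalp (deriv_x ?G) (f W) = 0 \<and> evalp (deriv_y ?G) (f W) = 0 \<and> 0 \<le> hess ?G (f W)"
    using well_critical[OF w(1)] by metis
  have "inj_on f \<W>" using f w(3) unfolding inj_on_def pairwise_def disjnt_iff by metis
  then have "card (f ` \<W>) = card \<W>" by (rule card_image)
  moreover have "0 < hess ?G (f W)" if "W \<in> \<W>" for W using f[OF that] nd[of "f W"] by (simp add: less_le)
  ultimately show thesis using that[of "f ` \<W>" "vec_nth c 1" "vec_nth c 2"] f w(2) by blast
qed

section \<open>Centers contain wells\<close>

lemma poly_locally_lipschitz:
  "\<exists>B. 0 \<le> B \<and> (\<forall>z\<in>cball 0 R. \<forall>w\<in>cball 0 R. \<bar>evalp p z - evalp p w\<bar> \<le> B * norm (z - w))"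
proof -
  let ?K = "cball (0 :: real \<times> real) R"
  have "compact ((\<lambda>z. \<bar>evalp (deriv_x p) z\<bar> + \<bar>evalp (deriv_y p) z\<bar>) ` ?K)"
    by (intro compact_continuous_image continuous_intros compact_cball)
  then obtain B where B: "\<And>z. z \<in> ?K \<Longrightarrow> \<bar>evalp (deriv_x p) z\<bar> + \<bar>evalp (deriv_y p) z\<bar> \<le> B"
    unfolding compact_eq_bounded_closed bounded_iff by force
  have "\<bar>evalp p z - evalp p w\<bar> \<le> max B 0 * norm (z - w)" if "z \<in> ?K" "w \<in> ?K" for z w
  proof -
    have "norm (evalp p z - evalp p w) \<le> max B 0 * norm (z - w)"
    proof (rule differentiable_bound[OF convex_cball _ _ that])
      fix x assume x: "x \<in> ?K"
      show "(evalp p has_derivative (\<lambda>h. evalp (deriv_x p) x * fst h + evalp (deriv_y p) x * snd h)) (at x within ?K)"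
        using eval_xy_has_derivative by (rule has_derivative_at_withinI)
      show "onorm (\<lambda>h. evalp (deriv_x p) x * fst h + evalp (deriv_y p) x * snd h) \<le> max B 0"
      proof (rule onorm_le)
        fix h :: "real \<times> real"
        have "\<bar>evalp (deriv_x p) x * fst h + evalp (deriv_y p) x * snd h\<bar>
          \<le> \<bar>evalp (deriv_x p) x\<bar> * \<bar>fst h\<bar> + \<bar>evalp (deriv_y p) x\<bar> * \<bar>snd h\<bar>"
          by (metis abs_mult abs_triangle_ineq)
        also have "\<dots> \<le> \<bar>evalp (deriv_x p) x\<bar> * norm h + \<bar>evalp (deriv_y p) x\<bar> * norm h"
          using norm_fst_le[of "fst h" "snd h"] norm_snd_le[of "snd h" "fst h"] by (intro add_mono mult_left_mono) auto
        also have "\<dots> = (\<bar>evalp (deriv_x p) x\<bar> + \<bar>evalp (deriv_y p) x\<bar>) * norm h" by (simp add: algebra_simps)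
        also have "\<dots> \<le> max B 0 * norm h" using B[OF x] by (intro mult_right_mono) auto
        finally show "norm (evalp (deriv_x p) x * fst h + evalp (deriv_y p) x * snd h) \<le> max B 0 * norm h" by simp
      qed
    qed
    then show ?thesis by simp
  qed
  then show ?thesis by (intro exI[of _ "max B 0"]) auto
qed

lemma vf_locally_lipschitz:
  "\<exists>B\<ge>0. \<forall>z\<in>cball 0 R. \<forall>w\<in>cball 0 R. norm (vf_at X z - vf_at X w) \<le> B * norm (z - w)"
proof -
  obtain B where B: "0 \<le> B" "\<And>z w. z \<in> cball 0 R \<Longrightarrow> w \<in> cball 0 R \<Longrightarrow> \<bar>evalp (fst X) z - evalp (fst X) w\<bar> \<le> B * norm (z - w)"
    using poly_locally_lipschitz by blast
  obtain C where C: "0 \<le> C" "\<And>z w. z \<in> cball 0 R \<Longrightarrow> w \<in> cball 0 R \<Longrightarrow> \<bar>evalp (snd X) z - evalp (snd X) w\<bar> \<le> C * norm (z - w)"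
    using poly_locally_lipschitz by blast
  have "norm (vf_at X z - vf_at X w) \<le> (B + C) * norm (z - w)" if "z \<in> cball 0 R" "w \<in> cball 0 R" for z w
  proof -
    have "norm (vf_at X z - vf_at X w) \<le> \<bar>evalp (fst X) z - evalp (fst X) w\<bar> + \<bar>evalp (snd X) z - evalp (snd X) w\<bar>"
      using norm_Pair_le[of "evalp (fst X) z - evalp (fst X) w" "evalp (snd X) z - evalp (snd X) w"] by (simp add: vf_at_def)
    also have "\<dots> \<le> (B + C) * norm (z - w)" using B(2)[OF that] C(2)[OF that] by (simp add: algebra_simps)
    finally show ?thesis .
  qed
  with B(1) C(1) show ?thesis by (intro exI[of _ "B + C"]) auto
qed

section \<open>Uniqueness of solutions and geometry of periodic orbits\<close>

definition solution :: "poly_vf \<Rightarrow> (real \<Rightarrow> real \<times> real) \<Rightarrow> bool" where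
  "solution X \<gamma> \<longleftrightarrow> (\<forall>t. (\<gamma> has_vector_derivative vf_at X (\<gamma> t)) (at t))"

lemma solution_continuous: "solution X \<gamma> \<Longrightarrow> continuous_on S \<gamma>"
  unfolding solution_def by (meson continuous_at_imp_continuous_on has_vector_derivative_continuous)

lemma solution_shift: "solution X \<gamma> \<Longrightarrow> solution X (\<lambda>t. \<gamma> (t + c))"
  unfolding solution_def
proof (intro allI)
  fix t assume *: "\<forall>t. (\<gamma> has_vector_derivative vf_at X (\<gamma> t)) (at t)"
  have "((\<lambda>t. t + c) has_vector_derivative 1) (at t)"
    by (auto intro!: derivative_eq_intros simp: has_vector_derivative_def)
  from vector_diff_chain_at[OF this, of \<gamma> "vf_at X (\<gamma> (t + c))"] *
  show "((\<lambda>t. \<gamma> (t + c)) has_vector_derivative vf_at X (\<gamma> (t + c))) (at t)" by (simp add: o_def)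
qed

text \<open>Gronwall's argument: if B is a Lipschitz constant on a ball containing both arcs, the
  squared distance times exp (- 2 B t) is nonincreasing and starts at 0.\<close>

lemma solution_unique_forward:
  assumes \<gamma>: "solution X \<gamma>" and \<delta>: "solution X \<delta>" and eq: "\<gamma> 0 = \<delta> 0" and t: "0 \<le> t"
  shows "\<gamma> t = \<delta> t"
proof -
  have "compact (\<gamma> ` {0..t} \<union> \<delta> ` {0..t})"
    using solution_continuous[OF \<gamma>] solution_continuous[OF \<delta>] by (intro compact_Un compact_continuous_image) auto
  then have "bounded (\<gamma> ` {0..t} \<union> \<delta> ` {0..t})" by (rule compact_imp_bounded)
  then obtain R where R: "\<gamma> ` {0..t} \<union> \<delta> ` {0..t} \<subseteq> cball 0 R"
    unfolding bounded_iff by (metis dist_0_norm mem_cball subsetI)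
  obtain B where B: "0 \<le> B" "\<And>z w. z \<in> cball 0 R \<Longrightarrow> w \<in> cball 0 R \<Longrightarrow> norm (vf_at X z - vf_at X w) \<le> B * norm (z - w)"
    using vf_locally_lipschitz by blast
  define \<phi> where "\<phi> s = (\<gamma> s - \<delta> s) \<bullet> (\<gamma> s - \<delta> s)" for s
  define \<phi>' where "\<phi>' s = 2 * ((\<gamma> s - \<delta> s) \<bullet> (vf_at X (\<gamma> s) - vf_at X (\<delta> s)))" for s
  have "(\<phi> has_real_derivative \<phi>' s) (at s)" for s
  proof -
    have d: "((\<lambda>s. \<gamma> s - \<delta> s) has_derivative (\<lambda>h. h *\<^sub>R (vf_at X (\<gamma> s) - vf_at X (\<delta> s)))) (at s)"
      using \<gamma> \<delta> has_vector_derivative_diff[of \<gamma> _ "at s" \<delta>] unfolding solution_def has_vector_derivative_def by blast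
    show ?thesis unfolding \<phi>_def has_field_derivative_def
      by (rule has_derivative_eq_rhs[OF has_derivative_inner[OF d d]]) (simp add: fun_eq_iff \<phi>'_def inner_commute)
  qed
  then have d\<phi>: "((\<lambda>s. \<phi> s * exp (- (2 * B) * s)) has_real_derivative (\<phi>' s - 2 * B * \<phi> s) * exp (- (2 * B) * s)) (at s)" for s
  proof -
    have "((\<lambda>s. exp (- (2 * B) * s)) has_real_derivative exp (- (2 * B) * s) * (- (2 * B))) (at s)"
      by (rule DERIV_chain2[OF DERIV_exp]) (rule DERIV_cmult_Id)
    from DERIV_mult[OF \<open>(\<phi> has_real_derivative \<phi>' s) (at s)\<close> this]
    show ?thesis by (rule back_subst[where P = "\<lambda>d. (_ has_real_derivative d) _"]) (simp add: left_diff_distrib)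
  qed
  have n\<phi>: "(\<phi>' s - 2 * B * \<phi> s) * exp (- (2 * B) * s) \<le> 0" if "0 \<le> s" "s \<le> t" for s
  proof -
    have "\<gamma> s \<in> \<gamma> ` {0..t} \<union> \<delta> ` {0..t}" "\<delta> s \<in> \<gamma> ` {0..t} \<union> \<delta> ` {0..t}" using that by auto
    then have "\<gamma> s \<in> cball 0 R" "\<delta> s \<in> cball 0 R" using R by blast+
    note lip = B(2)[OF this]
    have "(\<gamma> s - \<delta> s) \<bullet> (vf_at X (\<gamma> s) - vf_at X (\<delta> s)) \<le> norm (\<gamma> s - \<delta> s) * norm (vf_at X (\<gamma> s) - vf_at X (\<delta> s))"
      by (rule norm_cauchy_schwarz)
    also have "\<dots> \<le> norm (\<gamma> s - \<delta> s) * (B * norm (\<gamma> s - \<delta> s))"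
      by (rule mult_left_mono[OF lip norm_ge_zero])
    finally have "\<phi>' s \<le> 2 * (norm (\<gamma> s - \<delta> s) * (B * norm (\<gamma> s - \<delta> s)))"
      unfolding \<phi>'_def by simp
    also have "\<dots> = 2 * B * \<phi> s" by (simp add: \<phi>_def power2_norm_eq_inner[symmetric] power2_eq_square)
    finally show ?thesis by (simp add: mult_nonpos_nonneg)
  qed
  have "\<phi> t * exp (- (2 * B) * t) \<le> \<phi> 0 * exp (- (2 * B) * 0)"
    using t by (rule DERIV_nonpos_imp_nonincreasing[where f = "\<lambda>s. \<phi> s * exp (- (2 * B) * s)"]) (use d\<phi> n\<phi> in blast)
  then have "\<phi> t \<le> 0" using eq by (simp add: \<phi>_def mult_le_0_iff)
  then have "(\<gamma> t - \<delta> t) \<bullet> (\<gamma> t - \<delta> t) = 0" unfolding \<phi>_def by (rule antisym[OF _ inner_ge_zero])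
  then show ?thesis by simp
qed

lemma solution_unique_from:
  assumes "solution X \<gamma>" "solution X \<delta>" "\<gamma> a = \<delta> b" "0 \<le> t"
  shows "\<gamma> (a + t) = \<delta> (b + t)"
  using solution_unique_forward[of X "\<lambda>t. \<gamma> (t + a)" "\<lambda>t. \<delta> (t + b)" t] assms solution_shift
  by (simp add: add.commute)

lemma periodic_multiple:
  assumes "\<And>t. \<gamma> (t + T) = \<gamma> (t::real)"
  shows "\<gamma> (t + of_nat k * T) = \<gamma> t"
proof (induction k)
  case (Suc k)
  have "t + of_nat (Suc k) * T = (t + of_nat k * T) + T" by (simp add: algebra_simps)
  then show ?case by (simp only: assms Suc.IH)
qed simp

text \<open>A periodic orbit is traced completely after any time, so uniqueness in forward time is
  enough to compare whole orbits.\<close>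

lemma periodic_range:
  assumes "\<And>t. \<gamma> (t + T) = \<gamma> (t::real)" "0 < T"
  shows "range \<gamma> = (\<lambda>t. \<gamma> (a + t)) ` {0..}"
proof (intro equalityI subsetI)
  fix x assume "x \<in> range \<gamma>"
  then obtain t where x: "x = \<gamma> t" by auto
  obtain k where "a - t < of_nat k * T" using reals_Archimedean3[OF assms(2)] by blast
  then show "x \<in> (\<lambda>t. \<gamma> (a + t)) ` {0..}"
    using periodic_multiple[of \<gamma> T t k] assms(1) x by (intro image_eqI[of _ _ "t + of_nat k * T - a"]) auto
qed auto

lemma periodic_orbit_eq:
  assumes "periodic_orbit X S1" "periodic_orbit X S2" "z \<in> S1" "z \<in> S2"
  shows "S1 = S2"
proof -
  obtain \<gamma> T where \<gamma>: "solution X \<gamma>" "0 < T" "\<And>t. \<gamma> (t + T) = \<gamma> t" "S1 = range \<gamma>"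
    using assms(1) by (auto simp: periodic_orbit_def solution_def)
  obtain \<delta> U where \<delta>: "solution X \<delta>" "0 < U" "\<And>t. \<delta> (t + U) = \<delta> t" "S2 = range \<delta>"
    using assms(2) by (auto simp: periodic_orbit_def solution_def)
  obtain a b where "\<gamma> a = z" "\<delta> b = z" using assms(3,4) \<gamma>(4) \<delta>(4) by auto
  then have "\<gamma> (a + t) = \<delta> (b + t)" if "0 \<le> t" for t using solution_unique_from[OF \<gamma>(1) \<delta>(1) _ that] by simp
  then have "(\<lambda>t. \<gamma> (a + t)) ` {0..} = (\<lambda>t. \<delta> (b + t)) ` {0..}" by (intro image_cong) auto
  then show ?thesis using periodic_range[of \<gamma> T a] periodic_range[of \<delta> U b] \<gamma>(2-4) \<delta>(2-4) by simp
qed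

lemma periodic_orbit_regular:
  assumes "periodic_orbit X S" "z \<in> S"
  shows "vf_at X z \<noteq> 0"
proof
  assume z0: "vf_at X z = 0"
  obtain \<gamma> T where \<gamma>: "solution X \<gamma>" "0 < T" "\<And>t. \<gamma> (t + T) = \<gamma> t" "S = range \<gamma>" "\<exists>t. \<gamma> t \<noteq> \<gamma> 0"
    using assms(1) by (auto simp: periodic_orbit_def solution_def)
  obtain a where a: "\<gamma> a = z" using assms(2) \<gamma>(4) by auto
  have "solution X (\<lambda>t. z)" unfolding solution_def using z0 by simp
  from solution_unique_from[OF \<gamma>(1) this a] have "\<gamma> (a + t) = z" if "0 \<le> t" for t using that by simp
  then have "range \<gamma> \<subseteq> {z}" using periodic_range[of \<gamma> T a] \<gamma>(2,3) by auto
  then have "\<gamma> t = z" for t by (simp add: image_subset_iff)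
  then show False using \<gamma>(5) by simp
qed

lemma periodic_orbit_compact: "periodic_orbit X S \<Longrightarrow> compact S"
proof -
  assume "periodic_orbit X S"
  then obtain \<gamma> T where \<gamma>: "solution X \<gamma>" "0 < T" "\<And>t. \<gamma> (t + T) = \<gamma> t" "S = range \<gamma>"
    by (auto simp: periodic_orbit_def solution_def)
  have "range \<gamma> \<subseteq> \<gamma> ` {0..T}"
  proof
    fix x assume "x \<in> range \<gamma>"
    then obtain t where x: "x = \<gamma> t" by auto
    define k where "k = \<lfloor>t / T\<rfloor>"
    define u where "u = t - of_int k * T"
    have u: "0 \<le> u" "u \<le> T"
      using floor_divide_lower[OF \<gamma>(2), of t] floor_divide_upper[OF \<gamma>(2), of t] by (auto simp: u_def k_def algebra_simps)
    have "\<gamma> t = \<gamma> u"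
    proof (cases "0 \<le> k")
      case True
      then have "t = u + of_nat (nat k) * T" by (simp add: u_def)
      then show ?thesis using periodic_multiple[of \<gamma> T u "nat k"] \<gamma>(3) by simp
    next
      case False
      then have "u = t + of_nat (nat (- k)) * T" by (simp add: u_def)
      then show ?thesis using periodic_multiple[of \<gamma> T t "nat (- k)"] \<gamma>(3) by simp
    qed
    then show "x \<in> \<gamma> ` {0..T}" using u x by auto
  qed
  then have "S = \<gamma> ` {0..T}" using \<gamma>(4) by auto
  then show "compact S" using solution_continuous[OF \<gamma>(1)] by (auto intro: compact_continuous_image)
qed

lemma hamiltonian_constant_on_orbit:
  assumes "periodic_orbit (hamiltonian_vf H) S" "z \<in> S" "w \<in> S"
  shows "evalp H z = evalp H w"
proof -
  obtain \<gamma> where \<gamma>: "solution (hamiltonian_vf H) \<gamma>" "S = range \<gamma>"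
    using assms(1) by (auto simp: periodic_orbit_def solution_def)
  have "((\<lambda>t. evalp H (\<gamma> t)) has_real_derivative 0) (at t)" for t
  proof -
    have d: "(\<gamma> has_vector_derivative (- evalp (deriv_y H) (\<gamma> t), evalp (deriv_x H) (\<gamma> t))) (at t)"
      using \<gamma>(1) by (simp add: solution_def vf_at_def hamiltonian_vf_def eval_xy_minus)
    have dx: "((\<lambda>t. fst (\<gamma> t)) has_real_derivative - evalp (deriv_y H) (\<gamma> t)) (at t)"
      using bounded_linear.has_vector_derivative[OF bounded_linear_fst d]
      by (simp add: has_real_derivative_iff_has_vector_derivative)
    have dy: "((\<lambda>t. snd (\<gamma> t)) has_real_derivative evalp (deriv_x H) (\<gamma> t)) (at t)"
      using bounded_linear.has_vector_derivative[OF bounded_linear_snd d]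
      by (simp add: has_real_derivative_iff_has_vector_derivative)
    show ?thesis using eval_xy_DERIV[OF dx dy, of H] by (simp add: mult.commute)
  qed
  then have "evalp H (\<gamma> t) = evalp H (\<gamma> s)" for t s by (intro DERIV_isconst_all allI)
  then show ?thesis using assms \<gamma>(2) by auto
qed

text \<open>The given period may be traversed several times, so the loop is closed at the first
  return. Since the velocity is nonzero, return times stay away from 0; as they form a closed set, a
  least one exists. The loop lives in the complex plane, where the Jordan curve theorem will be
  applied.\<close>

lemma periodic_orbit_simple_loop:
  assumes "periodic_orbit X S"
  obtains c where "simple_path c" "pathfinish c = pathstart c" "path_image c \<subseteq> (\<lambda>z. Complex (fst z) (snd z)) ` S"
proof -
  obtain \<gamma> T where \<gamma>: "solution X \<gamma>" "0 < T" "\<And>t. \<gamma> (t + T) = \<gamma> t" "S = range \<gamma>"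
    using assms by (auto simp: periodic_orbit_def solution_def)
  define v where "v = vf_at X (\<gamma> 0)"
  have v: "v \<noteq> 0" using periodic_orbit_regular[OF assms] \<gamma>(4) by (simp add: v_def)
  have "((\<lambda>t. \<gamma> t \<bullet> v) has_real_derivative v \<bullet> v) (at 0)"
    using bounded_linear.has_vector_derivative[OF bounded_linear_inner_left, of \<gamma> v "at 0" v] \<gamma>(1)
    by (simp add: solution_def v_def has_real_derivative_iff_has_vector_derivative)
  then obtain e where e: "e > 0" "\<And>h. 0 < h \<Longrightarrow> h < e \<Longrightarrow> \<gamma> 0 \<bullet> v < \<gamma> (0 + h) \<bullet> v"
    using DERIV_pos_inc_right[of "\<lambda>t. \<gamma> t \<bullet> v" "v \<bullet> v" 0] v by auto
  define P where "P = {s. e \<le> s \<and> \<gamma> s = \<gamma> 0}"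
  have noP: "\<gamma> s \<noteq> \<gamma> 0" if "0 < s" "s < e" for s using e(2)[OF that] by auto
  have cl: "closed P"
  proof -
    have "P = {e..} \<inter> {s. \<gamma> s = \<gamma> 0}" by (auto simp: P_def)
    moreover have "closed {s. \<gamma> s = \<gamma> 0}"
      using solution_continuous[OF \<gamma>(1)] by (intro closed_Collect_eq) auto
    ultimately show ?thesis by auto
  qed
  have "T \<in> P" using \<gamma>(2) \<gamma>(3)[of 0] noP[of T] by (auto simp: P_def not_less[symmetric])
  then have Pne: "P \<noteq> {}" by auto
  have Pb: "bdd_below P" by (auto simp: P_def bdd_below_def)
  define \<tau> where "\<tau> = Inf P"
  have "\<tau> \<in> P" unfolding \<tau>_def using cl Pne Pb by (intro closed_contains_Inf)
  then have \<tau>: "0 < \<tau>" "\<gamma> \<tau> = \<gamma> 0" using e(1) by (auto simp: P_def)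
  have min: "\<gamma> s \<noteq> \<gamma> 0" if "0 < s" "s < \<tau>" for s
  proof
    assume "\<gamma> s = \<gamma> 0"
    then have "s \<in> P" using noP[OF that(1)] by (auto simp: P_def not_less[symmetric])
    then have "\<tau> \<le> s" unfolding \<tau>_def using Pb by (rule cInf_lower)
    then show False using that by simp
  qed
  \<comment> \<open>A coincidence at times a < b is carried forward to b = \<tau> and gives a return
    at time a + \<tau> - b, before \<tau>.\<close>
  have inj: "\<gamma> a \<noteq> \<gamma> b" if "0 \<le> a" "a < b" "b < \<tau>" for a b
  proof
    assume "\<gamma> a = \<gamma> b"
    then have "\<gamma> (a + (\<tau> - b)) = \<gamma> (b + (\<tau> - b))" using solution_unique_from[OF \<gamma>(1,1)] that by simp
    then show False using min[of "a + (\<tau> - b)"] that \<tau> by simp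
  qed
  let ?C = "\<lambda>z. Complex (fst z) (snd z)"
  define c where "c u = ?C (\<gamma> (\<tau> * u))" for u
  have Cinj: "?C z = ?C w \<longleftrightarrow> z = w" for z w by (auto simp: prod_eq_iff)
  have c0: "c 1 = c 0" using \<tau> by (simp add: c_def)
  have lt: "c x \<noteq> c y" if "0 \<le> x" "x < y" "y \<le> 1" "\<not> (x = 0 \<and> y = 1)" for x y
  proof (cases "y = 1")
    case True
    then have "0 < x" "x < 1" using that by auto
    then have "\<gamma> (\<tau> * x) \<noteq> \<gamma> 0" using min[of "\<tau> * x"] \<tau>(1) by simp
    then show ?thesis unfolding c_def Cinj using True \<tau>(2) by simp
  next
    case False
    then show ?thesis unfolding c_def Cinj using inj[of "\<tau> * x" "\<tau> * y"] that \<tau>(1) by simp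
  qed
  have "continuous_on {0..1} c"
  proof -
    have "continuous_on {0..1} (\<lambda>u. \<gamma> (\<tau> * u))"
      using continuous_on_compose2[OF solution_continuous[OF \<gamma>(1), of UNIV], of "{0..1}" "\<lambda>u. \<tau> * u"] by (simp add: continuous_intros)
    then show ?thesis unfolding c_def Complex_eq by (intro continuous_intros)
  qed
  then have "simple_path c" unfolding simple_path_def loop_free_def path_def
    using lt by (auto) (metis linorder_neqE_linordered_idom)+
  moreover have "pathfinish c = pathstart c" using c0 by (simp add: pathfinish_def pathstart_def)
  moreover have "path_image c \<subseteq> ?C ` S" unfolding path_image_def c_def \<gamma>(4) by auto
  ultimately show thesis by (rule that)
qed

text \<open>\<open>W\<close> is the inside of the Jordan curve; convexity of \<open>Q\<close> keeps
  it within \<open>Q\<close>. \<open>H\<close> is constant on its boundary but not on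
  \<open>W\<close>, since otherwise the gradient would vanish on an open set, and \<open>Q\<close>
  has no critical point other than possibly \<open>p\<close>.\<close>

lemma periodic_orbit_well:
  assumes S: "periodic_orbit (hamiltonian_vf H) S" "S \<subseteq> Q" and Q: "convex Q" "bounded Q"
    and reg: "\<And>z. z \<in> Q - {p} \<Longrightarrow> vf_at (hamiltonian_vf H) z \<noteq> 0"
  shows "\<exists>W\<subseteq>Q. well (evalp H) W"
proof -
  let ?C = "\<lambda>z::real \<times> real. Complex (fst z) (snd z)" and ?R = "\<lambda>w. (Re w, Im w)"
  obtain c where c: "simple_path c" "pathfinish c = pathstart c" "path_image c \<subseteq> ?C ` S"
    using periodic_orbit_simple_loop[OF S(1)] by metis
  define I where "I = inside (path_image c)"
  have I: "I \<noteq> {}" "open I" "bounded I" "frontier I = path_image c"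
    using Jordan_inside_outside[OF c(1,2)] by (auto simp: I_def)
  have linC: "linear ?C" by (intro linearI) (auto simp: complex_eq_iff)
  have IQ: "I \<subseteq> ?C ` Q"
  proof -
    have "convex (?C ` Q)" using linC Q(1) by (rule convex_linear_image)
    moreover have "path_image c \<subseteq> ?C ` Q" using c(3) S(2) by auto
    ultimately show ?thesis unfolding I_def
      using inside_mono[of "path_image c" "?C ` Q"] inside_convex[of "?C ` Q"] by blast
  qed
  define W where "W = ?C -` I"
  have contC: "continuous_on UNIV ?C" unfolding Complex_eq by (intro continuous_intros)
  have oW: "open W" unfolding W_def using contC I(2) by (auto intro: open_vimage)
  have WQ: "W \<subseteq> Q"
  proof
    fix z assume "z \<in> W"
    then obtain w where "w \<in> Q" "?C z = ?C w" using IQ by (auto simp: W_def)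
    then have "z = w" by (simp add: prod_eq_iff)
    then show "z \<in> Q" using \<open>w \<in> Q\<close> by simp
  qed
  have bW: "bounded W" using Q(2) WQ by (rule bounded_subset)
  have Wne: "W \<noteq> {}"
  proof -
    obtain w where "w \<in> I" using I(1) by auto
    then have "?R w \<in> W" by (simp add: W_def)
    then show ?thesis by auto
  qed
  obtain s where s: "s \<in> S"
    using c(3) path_image_nonempty[of c] by blast
  have bd: "evalp H z = evalp H s" if "z \<in> closure W - W" for z
  proof -
    have "?C ` closure W \<subseteq> closure I"
      by (rule image_closure_subset[OF continuous_on_subset[OF contC]]) (auto simp: W_def intro: closure_subset[THEN subsetD])
    then have "?C z \<in> closure I" using that by auto
    moreover have "?C z \<notin> I" using that by (simp add: W_def)
    ultimately have "?C z \<in> frontier I" using I(2) by (simp add: frontier_def interior_open)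
    then have "?C z \<in> ?C ` S" using c(3) I(4) by auto
    then have "z \<in> S" by (auto simp: prod_eq_iff)
    then show ?thesis using hamiltonian_constant_on_orbit[OF S(1) _ s] by blast
  qed
  have "\<exists>q\<in>W. evalp H q \<noteq> evalp H s"
  proof (rule ccontr)
    assume "\<not> ?thesis"
    then have const: "evalp H q = evalp H s" if "q \<in> W" for q using that by blast
    have "\<not> W \<subseteq> {p}"
    proof
      assume "W \<subseteq> {p}"
      then have "finite W" by (rule finite_subset) simp
      then show False using oW Wne finite_imp_not_open by blast
    qed
    then obtain q where q: "q \<in> W" "q \<noteq> p" by blast
    have "evalp (deriv_x H) q = 0 \<and> evalp (deriv_y H) q = 0"
      using hess_local_min[OF oW q(1), of H] const q(1) by simp
    then have "vf_at (hamiltonian_vf H) q = 0" by (simp add: vf_at_def hamiltonian_vf_def eval_xy_minus zero_prod_def)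
    then show False using reg[of q] q WQ by blast
  qed
  then obtain q where q: "q \<in> W" "evalp H q \<noteq> evalp H s" by blast
  then have "well (evalp H) W" unfolding well_def
    using oW bW bd by (cases "evalp H q < evalp H s") (auto intro!: bexI[of _ q])
  then show ?thesis using WQ by blast
qed

text \<open>On a vertical line with infinitely many zeros all coefficients of the powers of y
  vanish, and a nonzero coefficient has finitely many zeros.\<close>

lemma finite_vertical_zero_lines:
  assumes "P \<noteq> (0 :: poly_xy)"
  shows "finite {x. infinite {y. eval_xy P x y = 0}}"
proof -
  obtain i where i: "coeff P i \<noteq> 0" using assms by (auto simp: poly_eq_iff)
  have "poly (coeff P i) x = 0" if "infinite {y. eval_xy P x y = 0}" for x
  proof -
    let ?p = "map_poly (\<lambda>c. poly c x) P"
    have "poly ?p y = eval_xy P x y" for y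
      by (induction P) (auto simp: eval_xy_pCons map_poly_pCons)
    then have "infinite {y. poly ?p y = 0}" using that by simp
    then have "?p = 0" using poly_roots_finite by blast
    then have "coeff ?p i = 0" by simp
    then show ?thesis by (simp add: coeff_map_poly)
  qed
  then have "{x. infinite {y. eval_xy P x y = 0}} \<subseteq> {x. poly (coeff P i) x = 0}" by blast
  then show ?thesis using poly_roots_finite[OF i] by (rule finite_subset)
qed

lemma finite_horizontal_zero_lines:
  assumes "P \<noteq> (0 :: poly_xy)"
  shows "finite {y. infinite {x. eval_xy P x y = 0}}"
proof -
  have "poly P [:y:] = 0" if "infinite {x. eval_xy P x y = 0}" for y
    using that poly_roots_finite[of "poly P [:y:]"] by (auto simp: eval_xy_def)
  then have "(\<lambda>y. [:y:]) ` {y. infinite {x. eval_xy P x y = 0}} \<subseteq> {c. poly P c = 0}" by blast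
  then have "finite ((\<lambda>y. [:y:]) ` {y. infinite {x. eval_xy P x y = 0}})" using poly_roots_finite[OF assms] by (rule finite_subset)
  then show ?thesis by (rule finite_imageD) (auto simp: inj_on_def)
qed

text \<open>Squares are used instead of discs because the restriction of a polynomial to a side is a
  polynomial in one variable.\<close>

definition square :: "real \<times> real \<Rightarrow> real \<Rightarrow> (real \<times> real) set" where
  "square p \<rho> = cbox (p - (\<rho>, \<rho>)) (p + (\<rho>, \<rho>))"

lemma mem_square: "z \<in> square p \<rho> \<longleftrightarrow> \<bar>fst z - fst p\<bar> \<le> \<rho> \<and> \<bar>snd z - snd p\<bar> \<le> \<rho>"
proof -
  have "square p \<rho> = cbox (fst p - \<rho>, snd p - \<rho>) (fst p + \<rho>, snd p + \<rho>)"
    unfolding square_def by (cases p) simp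
  also have "\<dots> = cbox (fst p - \<rho>) (fst p + \<rho>) \<times> cbox (snd p - \<rho>) (snd p + \<rho>)" by (rule cbox_Pair_eq)
  finally show ?thesis by (cases z) (auto simp: abs_le_iff)
qed

lemma frontier_square:
  assumes "z \<in> frontier (square p \<rho>)"
  shows "z \<in> square p \<rho>" "fst z \<in> {fst p - \<rho>, fst p + \<rho>} \<or> snd z \<in> {snd p - \<rho>, snd p + \<rho>}"
proof -
  have "frontier (square p \<rho>) = square p \<rho> - box (p - (\<rho>, \<rho>)) (p + (\<rho>, \<rho>))"
    unfolding square_def by (rule frontier_cbox)
  then have z: "z \<in> square p \<rho>" and nb: "z \<notin> box (p - (\<rho>, \<rho>)) (p + (\<rho>, \<rho>))" using assms by auto
  show "z \<in> square p \<rho>" by (rule z)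
  have "box (p - (\<rho>, \<rho>)) (p + (\<rho>, \<rho>)) = box (fst p - \<rho>) (fst p + \<rho>) \<times> box (snd p - \<rho>) (snd p + \<rho>)"
    by (cases p) (auto simp: box_def Basis_prod_def inner_Pair ball_Un)
  then have "\<not> (\<bar>fst z - fst p\<bar> < \<rho> \<and> \<bar>snd z - snd p\<bar> < \<rho>)" using nb by (cases z) (auto simp: abs_less_iff box_real)
  then show "fst z \<in> {fst p - \<rho>, fst p + \<rho>} \<or> snd z \<in> {snd p - \<rho>, snd p + \<rho>}"
    using z unfolding mem_square by (auto simp: abs_if split: if_splits)
qed

lemma square_in_open:
  assumes "open V" "p \<in> V"
  obtains \<rho> where "0 < \<rho>" "square p \<rho> \<subseteq> V"
proof -
  obtain e where e: "e > 0" "ball p e \<subseteq> V" using assms openE by blast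
  have "square p (e / 4) \<subseteq> V"
  proof
    fix z assume "z \<in> square p (e / 4)"
    then have "\<bar>fst (z - p)\<bar> \<le> e / 4" "\<bar>snd (z - p)\<bar> \<le> e / 4" by (auto simp: mem_square)
    then have "norm (z - p) \<le> e / 4 + e / 4" using norm_Pair_le[of "fst (z - p)" "snd (z - p)"] by (simp del: fst_diff snd_diff)
    then have "z \<in> ball p e" using e(1) by (simp add: dist_norm norm_minus_commute)
    then show "z \<in> V" using e by blast
  qed
  then show thesis using that[of "e / 4"] e(1) by simp
qed

text \<open>Choose a square around \<open>p\<close> whose frontier contains only finitely many
  points of the level of \<open>p\<close>. The finitely many orbits through them avoid
  \<open>p\<close>, hence also some smaller square. If the level misses the frontier of the smaller
  square, its interior is a well. Otherwise an orbit on that level starts there, cannot reach the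
  larger frontier, and encloses a well.\<close>

lemma center_well:
  assumes c: "center (hamiltonian_vf H) p" and V: "open V" "p \<in> V"
  shows "\<exists>W\<subseteq>V. well (evalp H) W"
proof -
  let ?X = "hamiltonian_vf H"
  obtain U \<P> where U: "open U" "p \<in> U" "\<And>S. S \<in> \<P> \<Longrightarrow> periodic_orbit ?X S" "U - {p} = \<Union>\<P>"
    using c unfolding center_def by blast
  have reg: "vf_at ?X z \<noteq> 0" if "z \<in> U - {p}" for z
    using that U(3) periodic_orbit_regular unfolding U(4) by blast
  define k where "k = evalp H p"
  define P where "P = H - mono_xy 0 0 k"
  have evP: "eval_xy P x y = eval_xy H x y - k" for x y by (simp add: P_def eval_xy_diff eval_xy_mono)
  obtain \<rho>0 where \<rho>0: "0 < \<rho>0" "square p \<rho>0 \<subseteq> U \<inter> V" using square_in_open[of "U \<inter> V" p] U V by auto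
  have sub: "square p \<rho> \<subseteq> square p \<rho>'" if "\<rho> \<le> \<rho>'" for \<rho> \<rho>' using that by (auto simp: mem_square)
  have P0: "P \<noteq> 0"
  proof
    assume "P = 0"
    then have H: "H = mono_xy 0 0 k" by (simp add: P_def)
    have z: "p + (\<rho>0, 0) \<in> U - {p}" using \<rho>0 by (cases p) (auto simp: mem_square subset_iff)
    have "vf_at ?X z = 0" for z
      unfolding H hamiltonian_vf_def vf_at_def deriv_x_mono_xy deriv_y_mono_xy by (simp add: mono_xy_def zero_prod_def)
    then show False using reg[OF z] by blast
  qed
  define A where "A = {x. infinite {y. eval_xy P x y = 0}}"
  define B where "B = {y. infinite {x. eval_xy P x y = 0}}"
  have finAB: "finite A" "finite B" unfolding A_def B_def using P0 by (rule finite_vertical_zero_lines finite_horizontal_zero_lines)+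
  \<comment> \<open>Half side lengths for which a side would lie on a line with infinitely many
    zeros of \<open>P\<close>.\<close>
  define bad where "bad = (\<lambda>x. x - fst p) ` A \<union> (\<lambda>x. fst p - x) ` A \<union> (\<lambda>y. y - snd p) ` B \<union> (\<lambda>y. snd p - y) ` B"
  have "finite bad" using finAB by (simp add: bad_def)
  then have "infinite ({0<..<\<rho>0} - bad)" using \<rho>0(1) by (intro Diff_infinite_finite) auto
  then obtain \<rho> where \<rho>: "0 < \<rho>" "\<rho> < \<rho>0" "\<rho> \<notin> bad" by (metis DiffE equals0I finite.emptyI greaterThanLessThan_iff)
  have nA: "fst p + \<rho> \<notin> A" "fst p - \<rho> \<notin> A" "snd p + \<rho> \<notin> B" "snd p - \<rho> \<notin> B"
    using \<rho>(3) by (force simp: bad_def image_iff)+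
  define Z where "Z = {z \<in> frontier (square p \<rho>). evalp P z = 0}"
  have finZ: "finite Z"
  proof -
    define v where "v x = Pair x ` {y. eval_xy P x y = 0}" for x
    define h where "h y = (\<lambda>x. (x, y)) ` {x. eval_xy P x y = 0}" for y
    have "Z \<subseteq> v (fst p + \<rho>) \<union> v (fst p - \<rho>) \<union> h (snd p + \<rho>) \<union> h (snd p - \<rho>)"
    proof
      fix z assume z: "z \<in> Z"
      have vh: "z \<in> v (fst z)" "z \<in> h (snd z)" using z by (auto simp: Z_def v_def h_def image_iff prod_eq_iff)
      have "z \<in> frontier (square p \<rho>)" using z by (simp add: Z_def)
      from frontier_square(2)[OF this] show "z \<in> v (fst p + \<rho>) \<union> v (fst p - \<rho>) \<union> h (snd p + \<rho>) \<union> h (snd p - \<rho>)"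
        using vh by auto
    qed
    moreover have "finite (v (fst p + \<rho>) \<union> v (fst p - \<rho>) \<union> h (snd p + \<rho>) \<union> h (snd p - \<rho>))"
      using nA by (simp add: A_def B_def v_def h_def)
    ultimately show ?thesis by (rule finite_subset)
  qed
  have sqU: "square p \<rho> \<subseteq> U \<inter> V" using sub[of \<rho> \<rho>0] \<rho> \<rho>0 by auto
  have p_frontier: "p \<notin> frontier (square p r)" if "0 < r" for r using frontier_square(2)[of p p r] that by auto
  have "\<forall>z\<in>Z. \<exists>S. S \<in> \<P> \<and> z \<in> S"
  proof
    fix z assume "z \<in> Z"
    then have "z \<in> U - {p}" using p_frontier[OF \<rho>(1)] frontier_square(1)[of z p \<rho>] sqU by (auto simp: Z_def)
    then show "\<exists>S. S \<in> \<P> \<and> z \<in> S" unfolding U(4) by blast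
  qed
  then obtain Orb where Orb: "\<And>z. z \<in> Z \<Longrightarrow> Orb z \<in> \<P> \<and> z \<in> Orb z" by metis
  have clOrb: "closed (\<Union>z\<in>Z. Orb z)" using finZ Orb U(3) periodic_orbit_compact compact_imp_closed
    by (intro closed_UN) blast+
  have pOrb: "p \<notin> (\<Union>z\<in>Z. Orb z)" using Orb U(4) by blast
  obtain \<rho>1 where \<rho>1: "0 < \<rho>1" "square p \<rho>1 \<subseteq> - (\<Union>z\<in>Z. Orb z)"
    by (rule square_in_open[of "- (\<Union>z\<in>Z. Orb z)" p]) (use pOrb open_Compl[OF clOrb] in auto)
  define r where "r = min \<rho> \<rho>1"
  have r: "0 < r" "r \<le> \<rho>" "square p r \<subseteq> - (\<Union>z\<in>Z. Orb z)" using \<rho> \<rho>1 sub[of r \<rho>1] by (auto simp: r_def)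
  have sqV: "square p r \<subseteq> U \<inter> V" using sub[OF r(2)] sqU by blast
  show ?thesis
  proof (cases "\<exists>q\<in>frontier (square p r). evalp P q = 0")
    case False
    have conn: "connected (evalp P ` frontier (square p r))"
      unfolding square_def
      by (intro connected_continuous_image continuous_on_eval_xy connected_frontier_simple
          convex_connected convex_box connected_complement_bounded_convex bounded_cbox) auto
    let ?W = "box (p - (r, r)) (p + (r, r))"
    have pW: "p \<in> ?W" using r(1) by (cases p) (auto simp: mem_box Basis_prod_def inner_Pair)
    then have "?W \<noteq> {}" by blast
    then have cl: "closure ?W - ?W = frontier (square p r)"
      unfolding square_def frontier_cbox by (simp add: closure_box)
    have "(\<forall>z\<in>frontier (square p r). 0 < evalp P z) \<or> (\<forall>z\<in>frontier (square p r). evalp P z < 0)"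
    proof (rule ccontr)
      assume "\<not> ?thesis"
      then obtain z w where zw: "z \<in> frontier (square p r)" "w \<in> frontier (square p r)" "evalp P z \<le> 0" "0 \<le> evalp P w" by force
      then have "0 \<in> evalp P ` frontier (square p r)"
        using connectedD_interval[OF conn, of "evalp P z" "evalp P w" 0] by blast
      then show False using False by auto
    qed
    then have "well (evalp H) ?W" unfolding well_def cl using pW
      by (auto simp: evP k_def open_box bounded_box)
    moreover have "?W \<subseteq> V" using sqV box_subset_cbox[of "p - (r, r)" "p + (r, r)"] unfolding square_def by blast
    ultimately show ?thesis by blast
  next
    case True
    then obtain q where q: "q \<in> frontier (square p r)" "evalp P q = 0" by blast
    have qs: "q \<in> square p r" using q(1) by (rule frontier_square)
    have "q \<in> U - {p}" using qs sqV p_frontier[OF r(1)] q(1) by blast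
    then obtain S where S: "S \<in> \<P>" "q \<in> S" unfolding U(4) by blast
    have per: "periodic_orbit ?X S" using U(3) S by blast
    \<comment> \<open>At a common point \<open>S\<close> would be one of the selected orbits, all of
      which avoid the smaller square, although \<open>q\<close> lies in it.\<close>
    have "S \<inter> frontier (square p \<rho>) = {}"
    proof (rule ccontr)
      assume "S \<inter> frontier (square p \<rho>) \<noteq> {}"
      then obtain z where z: "z \<in> S" "z \<in> frontier (square p \<rho>)" by blast
      have "evalp P z = 0" using hamiltonian_constant_on_orbit[OF per z(1) S(2)] q(2) by (simp add: evP)
      then have "z \<in> Z" using z by (simp add: Z_def)
      then have "S = Orb z" using periodic_orbit_eq[OF per _ z(1)] Orb U(3) by blast
      then show False using r(3) qs S(2) \<open>z \<in> Z\<close> by blast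
    qed
    moreover have "connected S"
    proof -
      obtain \<gamma> where "solution ?X \<gamma>" "S = range \<gamma>" using per by (auto simp: periodic_orbit_def solution_def)
      then show ?thesis using solution_continuous connected_continuous_image connected_UNIV by blast
    qed
    moreover have "S \<inter> square p \<rho> \<noteq> {}" using S(2) qs sub[OF r(2)] by blast
    ultimately have "S \<subseteq> square p \<rho>" using connected_Int_frontier[of S "square p \<rho>"] by blast
    then have "\<exists>W\<subseteq>square p \<rho>. well (evalp H) W"
      using per reg sqU by (intro periodic_orbit_well[of H S "square p \<rho>" p]) (auto simp: square_def)
    then show ?thesis using sqU by blast
  qed
qed

lemma finite_centers_wells:
  assumes "finite C" "C \<subseteq> centers (hamiltonian_vf H)"
  obtains \<W> where "wells (evalp H) \<W>" "card \<W> = card C"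
proof -
  have "\<exists>e>0. \<forall>p\<in>C. \<forall>q\<in>C. p \<noteq> q \<longrightarrow> e \<le> dist p q"
  proof -
    have "finite {dist p q | p q. p \<in> C \<and> q \<in> C \<and> p \<noteq> q}" (is "finite ?D")
      by (rule finite_subset[of _ "(\<lambda>(p, q). dist p q) ` (C \<times> C)"]) (use assms(1) in auto)
    then show ?thesis
      by (intro exI[of _ "Min (insert 1 ?D)"]) (auto simp: Min_gr_iff intro!: Min_le)
  qed
  then obtain e where e: "e > 0" "\<And>p q. p \<in> C \<Longrightarrow> q \<in> C \<Longrightarrow> p \<noteq> q \<Longrightarrow> e \<le> dist p q" by blast
  have "\<forall>p\<in>C. \<exists>W. W \<subseteq> ball p (e / 2) \<and> well (evalp H) W"
    using center_well[of H _ "ball _ (e / 2)"] assms(2) e(1) by (auto simp: centers_def)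
  then obtain f where f: "\<And>p. p \<in> C \<Longrightarrow> f p \<subseteq> ball p (e / 2) \<and> well (evalp H) (f p)" by metis
  have dis: "f p \<inter> f q = {}" if "p \<in> C" "q \<in> C" "p \<noteq> q" for p q
  proof -
    have "ball p (e / 2) \<inter> ball q (e / 2) = {}" using e(2)[OF that] by (intro disjoint_ballI) simp
    then show ?thesis using f that by blast
  qed
  have ne: "f p \<noteq> {}" if "p \<in> C" for p using f[OF that] by (auto simp: well_def)
  have "inj_on f C" using dis ne unfolding inj_on_def by (metis inf.idem)
  then have "card (f ` C) = card C" by (rule card_image)
  moreover have "wells (evalp H) (f ` C)" unfolding wells_def pairwise_def disjnt_def using assms(1) f dis by blast
  ultimately show thesis using that by blast
qed

section \<open>Extrema are centers\<close>

lemma hamiltonian_vf_minus: "vf_at (hamiltonian_vf (- H)) z = - vf_at (hamiltonian_vf H) z"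
  by (simp add: vf_at_def hamiltonian_vf_def deriv_x_minus deriv_y_minus eval_xy_minus)

lemma periodic_orbit_reverse:
  assumes "periodic_orbit (hamiltonian_vf (- H)) S"
  shows "periodic_orbit (hamiltonian_vf H) S"
proof -
  obtain \<gamma> T where \<gamma>: "\<And>t. (\<gamma> has_vector_derivative vf_at (hamiltonian_vf (- H)) (\<gamma> t)) (at t)"
    "0 < T" "\<And>t. \<gamma> (t + T) = \<gamma> t" "\<exists>t. \<gamma> t \<noteq> \<gamma> 0" "S = range \<gamma>"
    using assms unfolding periodic_orbit_def by blast
  let ?\<delta> = "\<lambda>t. \<gamma> (- t)"
  have "(?\<delta> has_vector_derivative vf_at (hamiltonian_vf H) (?\<delta> t)) (at t)" for t
  proof -
    have "(uminus has_vector_derivative - 1) (at t)"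
      by (auto intro!: derivative_eq_intros simp: has_vector_derivative_def)
    from vector_diff_chain_at[OF this \<gamma>(1)] show ?thesis by (simp add: o_def hamiltonian_vf_minus)
  qed
  moreover have "?\<delta> (t + T) = ?\<delta> t" for t using \<gamma>(3)[of "- t - T"] by simp
  moreover have "\<exists>t. ?\<delta> t \<noteq> ?\<delta> 0" using \<gamma>(4) by (metis minus_minus neg_0_equal_iff_equal minus_zero)
  moreover have "S = range ?\<delta>" unfolding \<gamma>(5) by (auto simp: image_iff) (metis minus_minus)
  ultimately show ?thesis unfolding periodic_orbit_def using \<gamma>(2) by blast
qed

lemma center_reverse: "center (hamiltonian_vf (- H)) p \<Longrightarrow> center (hamiltonian_vf H) p"
  unfolding center_def critical_point_def using periodic_orbit_reverse
  by (metis hamiltonian_vf_minus neg_equal_0_iff_equal)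

section \<open>Level curves in polar coordinates\<close>

lemma cos_sin_sphere: "(cos t, sin t) \<in> sphere (0 :: real \<times> real) 1"
  by (simp add: norm_Pair)

lemma sphere_cos_sin:
  assumes "(z :: real \<times> real) \<in> sphere 0 1"
  obtains t where "z = (cos t, sin t)"
proof -
  obtain x y where z: "z = (x, y)" by (cases z)
  then have "x\<^sup>2 + y\<^sup>2 = 1" using assms by (simp add: norm_Pair)
  then show thesis using sincos_total_2pi[of x y] that z by metis
qed

text \<open>Here (c, s) is the unit radial vector, (u, v) the gradient and D the angular velocity.
  The identities turn the motion in polar coordinates into x' = - H_y, y' = H_x.\<close>

lemma rotating_frame_identities:
  fixes c s u v r D :: real
  assumes "c * c + s * s = 1" "r * D = u * c + v * s"
  shows "0 + (- (v * c - u * s) * c + - s * D * r) = - v" "0 + (- (v * c - u * s) * s + c * D * r) = u"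
  using assms by algebra+

text \<open>The time along the level curve \<open>\<rho> = r(t)\<close> is an antiderivative of \<open>r / N\<close>, where \<open>N\<close> is the radial derivative of \<open>H\<close>.\<close>

lemma polar_level_curve_periodic_orbit:
  fixes H :: poly_xy and a b :: real and r :: "real \<Rightarrow> real"
  defines "U \<equiv> \<lambda>t \<rho>. eval_xy (deriv_x H) (a + \<rho> * cos t) (b + \<rho> * sin t)"
  defines "V \<equiv> \<lambda>t \<rho>. eval_xy (deriv_y H) (a + \<rho> * cos t) (b + \<rho> * sin t)"
  defines "N \<equiv> \<lambda>t. U t (r t) * cos t + V t (r t) * sin t"
  assumes r: "\<And>t. 0 < r t" "\<And>t. r (t + 2 * pi) = r t" and N: "\<And>t. 0 < N t"
    and dr: "\<And>t. (r has_real_derivative - (r t * (V t (r t) * cos t - U t (r t) * sin t)) / N t) (at t)"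
  shows "periodic_orbit (hamiltonian_vf H) (range (\<lambda>t. (a + r t * cos t, b + r t * sin t)))"
proof -
  define q where "q t = r t / N t" for t
  have cr: "isCont r t" for t using dr[of t] by (rule DERIV_isCont)
  then have cr': "continuous_on UNIV r" by (simp add: continuous_at_imp_continuous_on)
  have "continuous_on UNIV N" unfolding N_def U_def V_def
    by (intro continuous_intros cr')
  then have "continuous_on UNIV q" unfolding q_def using N
    by (intro continuous_intros cr') (auto simp: less_imp_neq[symmetric])
  then have cq: "isCont q t" for t by (simp add: continuous_on_eq_continuous_at)
  have q0: "0 < q t" for t using r N by (simp add: q_def)
  have qp: "q (t + 2 * pi) = q t" for t by (simp add: q_def N_def U_def V_def r(2))
  obtain \<tau> where \<tau>v: "\<forall>t\<in>einterval (-\<infinity>) \<infinity>. (\<tau> has_vector_derivative q t) (at t)"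
    using einterval_antiderivative[of "-\<infinity>" "\<infinity>" q] cq by auto
  then have \<tau>: "(\<tau> has_real_derivative q t) (at t)" for t
    by (simp add: has_real_derivative_iff_has_vector_derivative einterval_def)
  have mono: "\<tau> s < \<tau> t" if "s < t" for s t
    using DERIV_pos_imp_increasing[OF that, of \<tau>] \<tau> q0 by blast
  \<comment> \<open>The period is the time of one turn. The integrand \<open>q\<close> is periodic
    in the angle, so every turn takes the same time.\<close>
  define T where "T = \<tau> (2 * pi) - \<tau> 0"
  have T: "0 < T" using mono[of 0 "2 * pi"] by (simp add: T_def)
  have shift: "\<tau> (t + 2 * pi) = \<tau> t + T" for t
  proof -
    have d: "((\<lambda>t. \<tau> (t + 2 * pi) - \<tau> t) has_real_derivative 0) (at t)" for t
    proof -
      have "((\<lambda>t. \<tau> (t + 2 * pi)) has_real_derivative q (t + 2 * pi)) (at t)"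
        using \<tau>[of "t + 2 * pi"] by (simp add: DERIV_shift)
      from DERIV_diff[OF this \<tau>] show ?thesis by (simp add: qp)
    qed
    have "\<tau> (t + 2 * pi) - \<tau> t = \<tau> (0 + 2 * pi) - \<tau> 0"
      using DERIV_isconst_all[of "\<lambda>t. \<tau> (t + 2 * pi) - \<tau> t" t 0] d by blast
    then show ?thesis by (simp add: T_def)
  qed
  have shiftn: "\<tau> (t + of_nat k * (2 * pi)) = \<tau> t + of_nat k * T" for t k
  proof (induction k)
    case (Suc k)
    have "t + of_nat (Suc k) * (2 * pi) = (t + of_nat k * (2 * pi)) + 2 * pi" by (simp add: algebra_simps)
    then have "\<tau> (t + of_nat (Suc k) * (2 * pi)) = \<tau> (t + of_nat k * (2 * pi)) + T" by (simp only: shift)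
    then show ?case using Suc by (simp add: algebra_simps)
  qed simp
  have surj: "\<exists>t. \<tau> t = s" for s
  proof -
    obtain k where k: "\<bar>s - \<tau> 0\<bar> < of_nat k * T" using reals_Archimedean3[OF T] by blast
    have lo: "\<tau> (- (of_nat k * (2 * pi))) \<le> s" using shiftn[of "- (of_nat k * (2 * pi))" k] k by simp
    have hi: "s \<le> \<tau> (of_nat k * (2 * pi))" using shiftn[of 0 k] k by simp
    have "continuous_on {- (of_nat k * (2 * pi))..of_nat k * (2 * pi)} \<tau>"
      using \<tau> by (meson DERIV_isCont continuous_at_imp_continuous_on)
    then show ?thesis using IVT'[of \<tau> _ s, OF lo hi] by fastforce
  qed
  define \<Theta> where "\<Theta> = inv \<tau>"
  have inj: "inj \<tau>" using mono by (metis injI linorder_neqE less_irrefl)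
  have \<Theta>\<tau>: "\<Theta> (\<tau> t) = t" for t unfolding \<Theta>_def using inj by simp
  have \<tau>\<Theta>: "\<tau> (\<Theta> s) = s" for s using surj[of s] \<Theta>\<tau> by auto
  have d\<Theta>: "(\<Theta> has_real_derivative inverse (q (\<Theta> s))) (at s)" for s
  proof -
    have "(\<Theta> has_derivative (\<lambda>h. inverse (q (\<Theta> s)) * h)) (at (\<tau> (\<Theta> s)))"
    proof (rule has_derivative_inverse_strong[where S = UNIV and f = \<tau> and x = "\<Theta> s" and f' = "\<lambda>h. q (\<Theta> s) * h"])
      show "continuous_on UNIV \<tau>" using \<tau> by (meson DERIV_isCont continuous_at_imp_continuous_on)
      show "(\<tau> has_derivative (\<lambda>h. q (\<Theta> s) * h)) (at (\<Theta> s))" using \<tau> by (simp add: has_field_derivative_def)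
      show "(\<lambda>h. q (\<Theta> s) * h) \<circ> (\<lambda>h. inverse (q (\<Theta> s)) * h) = id"
        using q0[of "\<Theta> s"] by (auto simp: fun_eq_iff)
    qed (auto simp: \<Theta>\<tau>)
    then show ?thesis by (simp add: \<tau>\<Theta> has_field_derivative_def)
  qed
  have \<Theta>T: "\<Theta> (s + T) = \<Theta> s + 2 * pi" for s
    using \<Theta>\<tau>[of "\<Theta> s + 2 * pi"] by (simp add: shift \<tau>\<Theta>)
  define \<gamma> where "\<gamma> s = (a + r (\<Theta> s) * cos (\<Theta> s), b + r (\<Theta> s) * sin (\<Theta> s))" for s
  have "(\<gamma> has_vector_derivative vf_at (hamiltonian_vf H) (\<gamma> s)) (at s)" for s
  proof -
    let ?t = "\<Theta> s"
    let ?u = "U ?t (r ?t)" and ?v = "V ?t (r ?t)" and ?c = "cos ?t" and ?s = "sin ?t"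
    let ?D = "inverse (q ?t)" and ?r' = "- (r ?t * (?v * ?c - ?u * ?s)) / N ?t"
    have q': "?D = N ?t / r ?t" by (simp add: q_def)
    have nz: "r ?t \<noteq> 0" "N ?t \<noteq> 0" using r(1)[of ?t] N[of ?t] by auto
    have d1: "((\<lambda>s. r (\<Theta> s)) has_real_derivative ?r' * ?D) (at s)"
      using DERIV_chain2[OF dr d\<Theta>] .
    have rD: "?r' * ?D = - (?v * ?c - ?u * ?s)" using nz by (simp add: q')
    have d1': "((\<lambda>s. r (\<Theta> s)) has_real_derivative - (?v * ?c - ?u * ?s)) (at s)" using d1 unfolding rD .
    have dc: "((\<lambda>s. cos (\<Theta> s)) has_real_derivative - ?s * ?D) (at s)"
      using DERIV_chain2[OF DERIV_cos d\<Theta>] .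
    have ds: "((\<lambda>s. sin (\<Theta> s)) has_real_derivative ?c * ?D) (at s)"
      using DERIV_chain2[OF DERIV_sin d\<Theta>] .
    have sc: "?c * ?c + ?s * ?s = 1" using sin_cos_squared_add3[of ?t] by (simp add: power2_eq_square)
    have rq: "r ?t * ?D = ?u * ?c + ?v * ?s" using nz unfolding q' by (simp add: N_def)
    have X: "((\<lambda>s. a + r (\<Theta> s) * cos (\<Theta> s)) has_real_derivative - ?v) (at s)"
    proof -
      have "((\<lambda>s. a + r (\<Theta> s) * cos (\<Theta> s)) has_real_derivative 0 + (- (?v * ?c - ?u * ?s) * ?c + - ?s * ?D * r ?t)) (at s)"
        by (intro DERIV_add DERIV_const DERIV_mult d1' dc)
      then show ?thesis unfolding rotating_frame_identities[OF sc rq] .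
    qed
    have Y: "((\<lambda>s. b + r (\<Theta> s) * sin (\<Theta> s)) has_real_derivative ?u) (at s)"
    proof -
      have "((\<lambda>s. b + r (\<Theta> s) * sin (\<Theta> s)) has_real_derivative 0 + (- (?v * ?c - ?u * ?s) * ?s + ?c * ?D * r ?t)) (at s)"
        by (intro DERIV_add DERIV_const DERIV_mult d1' ds)
      then show ?thesis unfolding rotating_frame_identities[OF sc rq] .
    qed
    show ?thesis unfolding \<gamma>_def vf_at_def hamiltonian_vf_def
      using has_vector_derivative_Pair[OF X[unfolded has_real_derivative_iff_has_vector_derivative] Y[unfolded has_real_derivative_iff_has_vector_derivative]]
      by (simp add: eval_xy_minus U_def V_def)
  qed
  moreover have "\<gamma> (s + T) = \<gamma> s" for s by (simp add: \<gamma>_def \<Theta>T r(2))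
  \<comment> \<open>The points at angles 0 and pi lie on opposite sides of (a, b).\<close>
  moreover have "\<exists>t. \<gamma> t \<noteq> \<gamma> 0"
  proof (rule ccontr)
    assume "\<not> ?thesis"
    then have "\<gamma> (\<tau> 0) = \<gamma> (\<tau> pi)" by metis
    then have "r 0 = - r pi" by (simp add: \<gamma>_def \<Theta>\<tau>)
    then show False using r(1)[of 0] r(1)[of pi] by simp
  qed
  moreover have "range (\<lambda>t. (a + r t * cos t, b + r t * sin t)) = range \<gamma>"
  proof -
    have "range \<Theta> = UNIV" using \<Theta>\<tau> by (rule surjI)
    moreover have "range \<gamma> = (\<lambda>t. (a + r t * cos t, b + r t * sin t)) ` range \<Theta>"
      by (simp add: \<gamma>_def image_image)
    ultimately show ?thesis by simp
  qed
  ultimately show ?thesis unfolding periodic_orbit_def using T by (intro exI[of _ \<gamma>] exI[of _ T]) simp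
qed

lemma definite_quadratic_form_pos:
  fixes A B C x y :: real
  assumes "0 < A" "0 < A * C - B\<^sup>2" "(x, y) \<noteq> (0, 0)"
  shows "0 < A * x\<^sup>2 + 2 * B * x * y + C * y\<^sup>2"
proof -
  have eq: "A * (A * x\<^sup>2 + 2 * B * x * y + C * y\<^sup>2) = (A * x + B * y)\<^sup>2 + (A * C - B\<^sup>2) * y\<^sup>2"
    by (simp add: power2_eq_square algebra_simps)
  have "0 < (A * x + B * y)\<^sup>2 + (A * C - B\<^sup>2) * y\<^sup>2"
  proof (cases "y = 0")
    case True
    then show ?thesis using assms by simp
  next
    case False
    then show ?thesis using assms(2) by (intro add_nonneg_pos) auto
  qed
  then show ?thesis unfolding eq[symmetric] using assms(1) by (simp add: zero_less_mult_iff)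
qed

text \<open>The second radial derivative is positive on the unit circle at radius 0, and by
  compactness for all radii below some \<delta>. So \<open>H\<close> increases strictly along rays,
  and each nearby level above the critical value meets every ray exactly once.\<close>

lemma center_if_positive_definite:
  assumes crit: "evalp (deriv_x H) p = 0" "evalp (deriv_y H) p = 0"
    and pos: "0 < evalp (deriv_x (deriv_x H)) p" and hs: "0 < hess H p"
  shows "center (hamiltonian_vf H) p"
proof -
  obtain a b where p: "p = (a, b)" by (cases p)
  let ?S = "sphere (0 :: real \<times> real) 1"
  define Q where "Q \<rho> e = eval_xy (deriv_x (deriv_x H)) (a + \<rho> * fst e) (b + \<rho> * snd e) * (fst e)\<^sup>2
      + 2 * eval_xy (deriv_x (deriv_y H)) (a + \<rho> * fst e) (b + \<rho> * snd e) * fst e * snd e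
      + eval_xy (deriv_y (deriv_y H)) (a + \<rho> * fst e) (b + \<rho> * snd e) * (snd e)\<^sup>2" for \<rho> :: real and e :: "real \<times> real"
  define F where "F \<rho> e = eval_xy H (a + \<rho> * fst e) (b + \<rho> * snd e) - eval_xy H a b" for \<rho> :: real and e :: "real \<times> real"
  define D where "D \<rho> e = eval_xy (deriv_x H) (a + \<rho> * fst e) (b + \<rho> * snd e) * fst e
      + eval_xy (deriv_y H) (a + \<rho> * fst e) (b + \<rho> * snd e) * snd e" for \<rho> :: real and e :: "real \<times> real"
  have dx: "((\<lambda>\<rho>. a + \<rho> * fst e) has_real_derivative fst e) (at \<rho>)" "((\<lambda>\<rho>. b + \<rho> * snd e) has_real_derivative snd e) (at \<rho>)" for e \<rho>
    by (auto intro!: derivative_eq_intros)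
  have dF: "((\<lambda>\<rho>. F \<rho> e) has_real_derivative D \<rho> e) (at \<rho>)" for \<rho> e
    unfolding F_def D_def using DERIV_diff[OF eval_xy_DERIV[OF dx] DERIV_const] by simp
  have dD: "((\<lambda>\<rho>. D \<rho> e) has_real_derivative Q \<rho> e) (at \<rho>)" for \<rho> e
  proof -
    have "((\<lambda>\<rho>. D \<rho> e) has_real_derivative
      (eval_xy (deriv_x (deriv_x H)) (a + \<rho> * fst e) (b + \<rho> * snd e) * fst e
       + eval_xy (deriv_y (deriv_x H)) (a + \<rho> * fst e) (b + \<rho> * snd e) * snd e) * fst e
      + (eval_xy (deriv_x (deriv_y H)) (a + \<rho> * fst e) (b + \<rho> * snd e) * fst e
       + eval_xy (deriv_y (deriv_y H)) (a + \<rho> * fst e) (b + \<rho> * snd e) * snd e) * snd e) (at \<rho>)"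
      unfolding D_def by (intro DERIV_add DERIV_cmult_right eval_xy_DERIV[OF dx])
    then show ?thesis
      by (rule back_subst[where P = "\<lambda>d. (_ has_real_derivative d) _"])
        (simp add: Q_def deriv_x_y_commute power2_eq_square algebra_simps)
  qed
  have Q0: "0 < Q 0 e" if "e \<in> ?S" for e
  proof -
    have "e \<noteq> (0, 0)" using that by auto
    then show ?thesis using definite_quadratic_form_pos[OF pos, of "evalp (deriv_y (deriv_y H)) p" "evalp (deriv_x (deriv_y H)) p" "fst e" "snd e"] hs
      by (simp add: Q_def hess_def p prod_eq_iff)
  qed
  have "open {x :: real \<times> (real \<times> real). 0 < Q (fst x) (snd x)}"
    unfolding Q_def by (intro open_Collect_less continuous_intros)
  moreover have "{0} \<times> ?S \<subseteq> {x. 0 < Q (fst x) (snd x)}" using Q0 by auto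
  ultimately obtain X where X: "0 \<in> X" "open X" "X \<times> ?S \<subseteq> {x. 0 < Q (fst x) (snd x)}"
    using Elementary_Topology.tube_lemma[of ?S "{x :: real \<times> (real \<times> real). 0 < Q (fst x) (snd x)}" 0] by auto
  obtain \<delta> where \<delta>: "0 < \<delta>" "ball 0 \<delta> \<subseteq> X" using X(1,2) openE by blast
  have Qpos: "0 < Q \<rho> e" if "e \<in> ?S" "\<bar>\<rho>\<bar> < \<delta>" for \<rho> e
  proof -
    have "\<rho> \<in> X" using \<delta>(2) that(2) by auto
    then have "(\<rho>, e) \<in> X \<times> ?S" using that(1) by blast
    then have "(\<rho>, e) \<in> {x. 0 < Q (fst x) (snd x)}" using X(3) by blast
    then show ?thesis by simp
  qed
  have D0: "D 0 e = 0" for e using crit by (simp add: D_def p)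
  have Dpos: "0 < D \<rho> e" if "e \<in> ?S" "0 < \<rho>" "\<rho> < \<delta>" for \<rho> e
  proof -
    have "\<exists>y. DERIV (\<lambda>\<rho>. D \<rho> e) x :> y \<and> 0 < y" if "0 \<le> x" "x \<le> \<rho>" for x
      using dD[of e x] Qpos[OF \<open>e \<in> ?S\<close>, of x] that \<open>\<rho> < \<delta>\<close> by (intro exI[of _ "Q x e"]) simp
    from DERIV_pos_imp_increasing[OF that(2) this] show ?thesis by (simp add: D0)
  qed
  have F0: "F 0 e = 0" for e by (simp add: F_def)
  have Finc: "F \<rho> e < F \<rho>' e" if "e \<in> ?S" "0 \<le> \<rho>" "\<rho> < \<rho>'" "\<rho>' < \<delta>" for \<rho> \<rho>' e
  proof -
    obtain z where z: "\<rho> < z" "z < \<rho>'" "F \<rho>' e - F \<rho> e = (\<rho>' - \<rho>) * D z e"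
      using MVT2[OF \<open>\<rho> < \<rho>'\<close>, of "\<lambda>\<rho>. F \<rho> e" "\<lambda>\<rho>. D \<rho> e"] dF by blast
    have "0 < (\<rho>' - \<rho>) * D z e" using Dpos[OF that(1), of z] z that by simp
    then show ?thesis using z(3) by simp
  qed
  define \<epsilon> where "\<epsilon> = \<delta> / 2"
  have \<epsilon>: "0 < \<epsilon>" "\<epsilon> < \<delta>" using \<delta> by (auto simp: \<epsilon>_def)
  have Sne: "?S \<noteq> {}" using cos_sin_sphere by blast
  have "continuous_on ?S (F \<epsilon>)" unfolding F_def by (intro continuous_intros)
  then obtain e0 where e0: "e0 \<in> ?S" "\<And>e. e \<in> ?S \<Longrightarrow> F \<epsilon> e0 \<le> F \<epsilon> e"
    using continuous_attains_inf[OF compact_sphere Sne, of "F \<epsilon>"] by blast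
  \<comment> \<open>The minimum on the circle of radius \<epsilon>: every level below it is reached
    on each ray before radius \<epsilon>.\<close>
  define m where "m = F \<epsilon> e0"
  have m: "0 < m" using Finc[OF e0(1), of 0 \<epsilon>] \<epsilon> by (simp add: m_def F0)
  define W where "W = {z. dist p z < \<epsilon> \<and> evalp H z - eval_xy H a b < m}"
  have oW: "open W" unfolding W_def
    by (intro open_Collect_conj open_Collect_less continuous_intros)
  have pW: "p \<in> W" using \<epsilon> m by (simp add: W_def p)
  let ?e = "\<lambda>t. (cos t, sin t)"
  have FeW: "(a + \<rho> * cos t, b + \<rho> * sin t) \<in> W - {p}" if "0 < \<rho>" "\<rho> < \<epsilon>" "F \<rho> (?e t) < m" for \<rho> t
  proof -
    have "dist p (a + \<rho> * cos t, b + \<rho> * sin t) = norm (\<rho> *\<^sub>R ?e t)"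
      by (simp add: p dist_norm norm_Pair)
    also have "\<dots> = \<rho>" using cos_sin_sphere[of t] that by (simp only: norm_scaleR) simp
    finally have d: "dist p (a + \<rho> * cos t, b + \<rho> * sin t) = \<rho>" .
    then have "(a + \<rho> * cos t, b + \<rho> * sin t) \<noteq> p" using that by auto
    then show ?thesis using that d by (simp add: W_def F_def)
  qed
  have orbit: "\<exists>S. periodic_orbit (hamiltonian_vf H) S \<and> z \<in> S \<and> S \<subseteq> W - {p}" if z: "z \<in> W - {p}" for z
  proof -
    define \<rho>0 where "\<rho>0 = dist p z"
    have \<rho>0: "0 < \<rho>0" "\<rho>0 < \<epsilon>" using z by (auto simp: \<rho>0_def W_def)
    have "(1 / \<rho>0) *\<^sub>R (z - p) \<in> ?S" using \<rho>0 by (simp add: \<rho>0_def dist_norm norm_minus_commute)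
    then obtain t0 where t0: "(1 / \<rho>0) *\<^sub>R (z - p) = ?e t0" by (rule sphere_cos_sin)
    have "z - p = \<rho>0 *\<^sub>R ((1 / \<rho>0) *\<^sub>R (z - p))" using \<rho>0 by simp
    then have "z = p + \<rho>0 *\<^sub>R ?e t0" unfolding t0 by (simp add: algebra_simps)
    then have z_eq: "z = (a + \<rho>0 * cos t0, b + \<rho>0 * sin t0)" by (simp add: p)
    define c where "c = F \<rho>0 (?e t0)"
    have c: "0 < c" "c < m"
      using Finc[OF cos_sin_sphere, of 0 \<rho>0 t0] \<rho>0 \<epsilon> z by (auto simp: c_def F0 W_def F_def z_eq)
    have "\<exists>\<rho>. 0 < \<rho> \<and> \<rho> < \<epsilon> \<and> F \<rho> (?e t) = c" for t
    proof -
      have "c < F \<epsilon> (?e t)" using e0(2)[OF cos_sin_sphere, of t] c by (simp add: m_def)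
      moreover have "continuous_on {0..\<epsilon>} (\<lambda>\<rho>. F \<rho> (?e t))" unfolding F_def by (intro continuous_intros)
      ultimately obtain \<rho> where "0 \<le> \<rho>" "\<rho> \<le> \<epsilon>" "F \<rho> (?e t) = c"
        using IVT'[of "\<lambda>\<rho>. F \<rho> (?e t)" 0 c \<epsilon>] c \<epsilon> by (auto simp: F0)
      then show ?thesis using c \<open>c < F \<epsilon> (?e t)\<close> by (intro exI[of _ \<rho>]) (auto simp: F0 less_le)
    qed
    then obtain r where r: "\<And>t. 0 < r t \<and> r t < \<epsilon> \<and> F (r t) (?e t) = c" by metis
    have uniq: "\<rho> = \<rho>'" if "0 < \<rho>" "\<rho> < \<delta>" "0 < \<rho>'" "\<rho>' < \<delta>" "F \<rho> (?e t) = F \<rho>' (?e t)" for \<rho> \<rho>' t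
      using Finc[OF cos_sin_sphere, of \<rho> \<rho>' t] Finc[OF cos_sin_sphere, of \<rho>' \<rho> t] that
      by (cases \<rho> \<rho>' rule: linorder_cases) auto
    define U where "U t \<rho> = eval_xy (deriv_x H) (a + \<rho> * cos t) (b + \<rho> * sin t)" for t \<rho>
    define V where "V t \<rho> = eval_xy (deriv_y H) (a + \<rho> * cos t) (b + \<rho> * sin t)" for t \<rho>
    have DUV: "D \<rho> (?e t) = U t \<rho> * cos t + V t \<rho> * sin t" for t \<rho> by (simp add: D_def U_def V_def)
    define \<Omega> where "\<Omega> = (UNIV :: real set) \<times> {0<..<\<delta>}"
    \<comment> \<open>The derivative of the radius comes from the inverse of (t, \<rho>) \<mapsto>
      (t, F), which is injective by monotonicity along rays: the inverse image of height c is the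
      graph of \<open>r\<close>. Below, \<open>?E\<close> and \<open>?N\<close> are the partial
      derivatives of F in the angle and in the radius.\<close>
    define f where "f x = (fst x, F (snd x) (?e (fst x)))" for x :: "real \<times> real"
    define g where "g = inv_into \<Omega> f"
    have injf: "inj_on f \<Omega>"
      by (rule inj_onI) (auto simp: f_def \<Omega>_def intro: uniq)
    have rd: "(r has_real_derivative - (r t * (V t (r t) * cos t - U t (r t) * sin t)) / (U t (r t) * cos t + V t (r t) * sin t)) (at t)" for t
    proof -
      let ?E = "r t * (V t (r t) * cos t - U t (r t) * sin t)" and ?N = "U t (r t) * cos t + V t (r t) * sin t"
      have N0: "?N \<noteq> 0" using Dpos[OF cos_sin_sphere, of "r t" t] r[of t] \<epsilon> by (auto simp: DUV)
      have gd: "(g has_derivative (\<lambda>h. (fst h, (snd h - ?E * fst h) / ?N))) (at (f (t, r t)))"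
      proof (rule has_derivative_inverse_strong[where S = \<Omega> and f = f and x = "(t, r t)" and f' = "\<lambda>h. (fst h, ?E * fst h + ?N * snd h)"])
        show "open \<Omega>" unfolding \<Omega>_def by (intro open_Times) auto
        show "(t, r t) \<in> \<Omega>" using r[of t] \<epsilon> by (auto simp: \<Omega>_def)
        show "continuous_on \<Omega> f" unfolding f_def F_def by (intro continuous_intros)
        show "g (f x) = x" if "x \<in> \<Omega>" for x unfolding g_def using injf that by (rule inv_into_f_f)
        show "(\<lambda>h. (fst h, ?E * fst h + ?N * snd h)) \<circ> (\<lambda>h. (fst h, (snd h - ?E * fst h) / ?N)) = id"
          using N0 by (auto simp: fun_eq_iff)
        have P: "((\<lambda>x :: real \<times> real. (a + snd x * cos (fst x), b + snd x * sin (fst x))) has_derivative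
            (\<lambda>h. (snd h * cos t - r t * sin t * fst h, snd h * sin t + r t * cos t * fst h))) (at (t, r t))"
          by (auto intro!: derivative_eq_intros simp: fun_eq_iff algebra_simps)
        have "((\<lambda>x. F (snd x) (?e (fst x))) has_derivative (\<lambda>h. ?E * fst h + ?N * snd h)) (at (t, r t))"
          unfolding F_def fst_conv snd_conv
          by (rule has_derivative_eq_rhs[OF has_derivative_diff[OF has_derivative_compose[OF P eval_xy_has_derivative[of H]]
                has_derivative_const[of "eval_xy H a b"], unfolded fst_conv snd_conv]])
            (auto simp: fun_eq_iff U_def V_def algebra_simps)
        then show "(f has_derivative (\<lambda>h. (fst h, ?E * fst h + ?N * snd h))) (at (t, r t))"
          unfolding f_def by (intro has_derivative_Pair has_derivative_fst has_derivative_ident)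
      qed
      have fr: "f (s, r s) = (s, c)" for s using r[of s] by (simp add: f_def)
      have gr: "g (s, c) = (s, r s)" for s
      proof -
        have "(s, r s) \<in> \<Omega>" using r[of s] \<epsilon> by (auto simp: \<Omega>_def)
        then show ?thesis using inv_into_f_f[OF injf, of "(s, r s)"] by (simp add: g_def fr)
      qed
      have "((\<lambda>s. (s, c)) has_derivative (\<lambda>h. (h, 0))) (at t)" by (auto intro!: derivative_eq_intros)
      from has_derivative_compose[OF this, of g "\<lambda>h. (fst h, (snd h - ?E * fst h) / ?N)"]
      have "((\<lambda>s. g (s, c)) has_derivative (\<lambda>h. (h, (0 - ?E * h) / ?N))) (at t)" using gd by (simp add: fr)
      then have "((\<lambda>s. (s, r s)) has_derivative (\<lambda>h. (h, (0 - ?E * h) / ?N))) (at t)" by (simp add: gr)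
      from has_derivative_snd[OF this] have "(r has_derivative (\<lambda>h. (0 - ?E * h) / ?N)) (at t)" by simp
      then show ?thesis unfolding has_field_derivative_def
        by (rule has_derivative_eq_rhs) (simp add: fun_eq_iff)
    qed
    have "periodic_orbit (hamiltonian_vf H) (range (\<lambda>t. (a + r t * cos t, b + r t * sin t)))"
    proof (rule polar_level_curve_periodic_orbit[where r = r])
      show "0 < r t" for t using r by blast
      show "r (t + 2 * pi) = r t" for t
        using uniq[of "r (t + 2 * pi)" "r t" t] r[of t] r[of "t + 2 * pi"] \<epsilon> by simp
      show "0 < eval_xy (deriv_x H) (a + r t * cos t) (b + r t * sin t) * cos t + eval_xy (deriv_y H) (a + r t * cos t) (b + r t * sin t) * sin t" for t
        using Dpos[OF cos_sin_sphere, of "r t" t] r[of t] \<epsilon> by (simp add: D_def)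
    qed (use rd in \<open>simp add: U_def V_def\<close>)
    moreover have "z \<in> range (\<lambda>t. (a + r t * cos t, b + r t * sin t))"
    proof -
      have "r t0 = \<rho>0" using uniq[of "r t0" \<rho>0 t0] r[of t0] \<rho>0 \<epsilon> by (simp add: c_def)
      then show ?thesis unfolding z_eq by (intro image_eqI[of _ _ t0]) auto
    qed
    moreover have "range (\<lambda>t. (a + r t * cos t, b + r t * sin t)) \<subseteq> W - {p}"
    proof (rule image_subsetI)
      fix t show "(a + r t * cos t, b + r t * sin t) \<in> W - {p}"
        using FeW[of "r t" t] r[of t] c by simp
    qed
    ultimately show ?thesis by blast
  qed
  have "W - {p} = \<Union>{S. periodic_orbit (hamiltonian_vf H) S \<and> S \<subseteq> W - {p}}" using orbit by blast
  moreover have "critical_point (hamiltonian_vf H) p"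
    using crit by (simp add: critical_point_def vf_at_def hamiltonian_vf_def eval_xy_minus zero_prod_def)
  ultimately show ?thesis unfolding center_def using oW pW
    by (intro conjI exI[of _ W] exI[of _ "{S. periodic_orbit (hamiltonian_vf H) S \<and> S \<subseteq> W - {p}}"]) simp_all
qed

lemma center_if_hess_pos:
  assumes "evalp (deriv_x H) p = 0" "evalp (deriv_y H) p = 0" "0 < hess H p"
  shows "center (hamiltonian_vf H) p"
proof (cases "0 < evalp (deriv_x (deriv_x H)) p")
  case True
  then show ?thesis using center_if_positive_definite assms by blast
next
  case False
  have "evalp (deriv_x (deriv_x H)) p \<noteq> 0" using assms(3) by (auto simp: hess_def)
  then have "center (hamiltonian_vf (- H)) p"
    using False assms by (intro center_if_positive_definite) (auto simp: deriv_x_minus deriv_y_minus eval_xy_minus hess_minus)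
  then show ?thesis by (rule center_reverse)
qed

section \<open>Wells near infinity\<close>

lemma well_cong:
  assumes eq: "\<And>z. z \<in> closure W \<Longrightarrow> h z = h' z"
  shows "well h W \<longleftrightarrow> well h' W"
proof -
  have "(\<exists>q\<in>W. (\<forall>z\<in>closure W - W. h q < h z) \<or> (\<forall>z\<in>closure W - W. h z < h q)) \<longleftrightarrow>
      (\<exists>q\<in>W. (\<forall>z\<in>closure W - W. h' q < h' z) \<or> (\<forall>z\<in>closure W - W. h' z < h' q))"
  proof (rule bex_cong[OF refl])
    fix q assume "q \<in> W"
    then have "h q = h' q" using eq closure_subset[of W] by blast
    then show "((\<forall>z\<in>closure W - W. h q < h z) \<or> (\<forall>z\<in>closure W - W. h z < h q)) =
      ((\<forall>z\<in>closure W - W. h' q < h' z) \<or> (\<forall>z\<in>closure W - W. h' z < h' q))"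
      using eq by simp
  qed
  then show ?thesis by (simp add: well_def)
qed

lemma well_cmult: "(0::real) < a \<Longrightarrow> well (\<lambda>z. a * h z) W \<longleftrightarrow> well h W"
  by (simp add: well_def)

lemma well_scale:
  assumes W: "well (\<lambda>z. h (c *\<^sub>R z)) W" and c: "c \<noteq> 0"
  shows "well h ((\<lambda>z. c *\<^sub>R z) ` W)"
proof -
  obtain q where q: "open W" "bounded W" "q \<in> W"
    "(\<forall>z\<in>closure W - W. h (c *\<^sub>R q) < h (c *\<^sub>R z)) \<or> (\<forall>z\<in>closure W - W. h (c *\<^sub>R z) < h (c *\<^sub>R q))"
    using W by (auto simp: well_def)
  have "closure ((\<lambda>z. c *\<^sub>R z) ` W) = (\<lambda>z. c *\<^sub>R z) ` closure W" by (rule closure_scaleR[symmetric])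
  moreover have "(\<lambda>z. c *\<^sub>R z) ` closure W - (\<lambda>z. c *\<^sub>R z) ` W = (\<lambda>z. c *\<^sub>R z) ` (closure W - W)"
    using c by (intro image_set_diff[symmetric]) (auto simp: inj_on_def)
  ultimately have cl: "closure ((\<lambda>z. c *\<^sub>R z) ` W) - (\<lambda>z. c *\<^sub>R z) ` W = (\<lambda>z. c *\<^sub>R z) ` (closure W - W)" by simp
  show ?thesis unfolding well_def cl
    using q c by (intro conjI open_scaling bounded_scaling) auto
qed

text \<open>In the coordinates x and t = y / x the function is x^d (g + x k) with k < 0. On the
  truncated cone it is small near the vertex, nonpositive at the far end and below \<open>v0\<close>
  on the two sides, while it takes the value \<open>v0\<close> inside.\<close>

lemma cone_well_aux:
  fixes g k :: "real poly" and d :: nat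
  assumes d: "1 \<le> d" and t0: "\<alpha> < t0" "t0 < \<beta>" and k: "\<And>t. \<alpha> \<le> t \<Longrightarrow> t \<le> \<beta> \<Longrightarrow> poly k t < 0"
    and x0: "0 < x0" and v0: "v0 = x0 ^ d * (poly g t0 + x0 * poly k t0)" "0 < v0"
    and ends: "\<And>\<tau> x. \<tau> \<in> {\<alpha>, \<beta>} \<Longrightarrow> 0 < x \<Longrightarrow> x ^ d * (poly g \<tau> + x * poly k \<tau>) < v0"
  obtains R \<eta> where "well (\<lambda>z. fst z ^ d * (poly g (snd z / fst z) + fst z * poly k (snd z / fst z))) R"
    "0 < \<eta>" "\<And>z. z \<in> R \<Longrightarrow> \<eta> \<le> fst z" "\<And>z. z \<in> R \<Longrightarrow> \<alpha> < snd z / fst z \<and> snd z / fst z < \<beta>"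
proof -
  have comp: "compact {\<alpha>..\<beta>}" "{\<alpha>..\<beta>} \<noteq> {}" using t0 by auto
  obtain tg where tg: "\<And>t. \<alpha> \<le> t \<Longrightarrow> t \<le> \<beta> \<Longrightarrow> \<bar>poly g t\<bar> \<le> \<bar>poly g tg\<bar>"
  proof -
    have "continuous_on {\<alpha>..\<beta>} (\<lambda>t. \<bar>poly g t\<bar>)" by (intro continuous_intros)
    from continuous_attains_sup[OF comp this] obtain x where "\<forall>y\<in>{\<alpha>..\<beta>}. \<bar>poly g y\<bar> \<le> \<bar>poly g x\<bar>" by blast
    then show thesis by (intro that[of x]) auto
  qed
  define Gm where "Gm = \<bar>poly g tg\<bar> + 1"
  have Gm: "0 < Gm" "\<And>t. \<alpha> \<le> t \<Longrightarrow> t \<le> \<beta> \<Longrightarrow> poly g t \<le> Gm"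
    using tg by (auto simp: Gm_def) (smt (verit) tg)
  obtain tk where tk: "\<alpha> \<le> tk" "tk \<le> \<beta>" "\<And>t. \<alpha> \<le> t \<Longrightarrow> t \<le> \<beta> \<Longrightarrow> poly k t \<le> poly k tk"
  proof -
    have "continuous_on {\<alpha>..\<beta>} (poly k)" by (intro continuous_intros)
    from continuous_attains_sup[OF comp this] obtain x where "x \<in> {\<alpha>..\<beta>}" "\<forall>y\<in>{\<alpha>..\<beta>}. poly k y \<le> poly k x" by blast
    then show thesis by (intro that[of x]) auto
  qed
  define km where "km = - poly k tk"
  have km: "0 < km" "\<And>t. \<alpha> \<le> t \<Longrightarrow> t \<le> \<beta> \<Longrightarrow> poly k t \<le> - km" using k tk by (auto simp: km_def)
  \<comment> \<open>From \<open>x1\<close> at most 1 follows x^d at most x at the near end; the last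
    bound then makes the value there at most \<open>v0 / 2\<close>.\<close>
  define x1 where "x1 = min (x0 / 2) (min 1 (v0 / (2 * Gm)))"
  have x1: "0 < x1" "x1 < x0" "x1 \<le> 1" "x1 \<le> v0 / (2 * Gm)" using x0 v0(2) Gm(1) by (auto simp: x1_def)
  \<comment> \<open>Beyond \<open>Gm / km\<close> the negative term outweighs g; the factor 2 keeps
    the test point strictly inside.\<close>
  define x2 where "x2 = max (2 * x0) (Gm / km)"
  have x2: "x0 < x2" "Gm / km \<le> x2" using x0 by (auto simp: x2_def)
  define F where "F z = fst z ^ d * (poly g (snd z / fst z) + fst z * poly k (snd z / fst z))" for z :: "real \<times> real"
  define R where "R = {z :: real \<times> real. x1 < fst z \<and> fst z < x2 \<and> \<alpha> * fst z < snd z \<and> snd z < \<beta> * fst z}"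
  have oR: "open R" unfolding R_def by (intro open_Collect_conj open_Collect_less continuous_intros)
  have bR: "bounded R"
  proof -
    have "norm z \<le> x2 + (\<bar>\<alpha>\<bar> + \<bar>\<beta>\<bar>) * x2" if z: "z \<in> R" for z
    proof -
      have p: "0 < fst z" "fst z < x2" using z x1 by (auto simp: R_def)
      have "\<bar>\<alpha> * fst z\<bar> \<le> \<bar>\<alpha>\<bar> * x2" "\<bar>\<beta> * fst z\<bar> \<le> \<bar>\<beta>\<bar> * x2"
        using p by (auto simp: abs_mult intro!: mult_left_mono)
      then have "\<bar>snd z\<bar> \<le> (\<bar>\<alpha>\<bar> + \<bar>\<beta>\<bar>) * x2" using z by (auto simp: R_def distrib_right)
      moreover have "norm z \<le> \<bar>fst z\<bar> + \<bar>snd z\<bar>" using norm_Pair_le[of "fst z" "snd z"] by simp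
      ultimately show ?thesis using p by linarith
    qed
    then show ?thesis unfolding bounded_iff by blast
  qed
  have clR: "closure R \<subseteq> {z. x1 \<le> fst z \<and> fst z \<le> x2 \<and> \<alpha> * fst z \<le> snd z \<and> snd z \<le> \<beta> * fst z}"
    by (intro closure_minimal closed_Collect_conj closed_Collect_le continuous_intros) (auto simp: R_def)
  have q: "(x0, x0 * t0) \<in> R" using x1 x2 x0 t0 by (auto simp: R_def)
  have Fq: "F (x0, x0 * t0) = v0" using x0 by (simp add: F_def v0)
  have bd: "F z < v0" if z: "z \<in> closure R - R" for z
  proof -
    define x where "x = fst z"
    define t where "t = snd z / fst z"
    have x: "x1 \<le> x" "x \<le> x2" "0 < x" using z clR x1 by (auto simp: x_def)
    have t: "\<alpha> \<le> t" "t \<le> \<beta>" using z clR x unfolding t_def x_def[symmetric] by (auto simp: x_def field_simps)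
    have Fz: "F z = x ^ d * (poly g t + x * poly k t)" by (simp add: F_def x_def t_def)
    have "\<not> (x1 < x \<and> x < x2 \<and> \<alpha> < t \<and> t < \<beta>)"
      using z x unfolding R_def t_def x_def by (auto simp: field_simps)
    then consider "x = x1" | "x = x2" | "t \<in> {\<alpha>, \<beta>}" using x t by fastforce
    then show ?thesis
    proof cases
      case 1
      have "x * poly k t \<le> 0" using x k[OF t] by (simp add: mult_nonneg_nonpos less_imp_le)
      then have le: "poly g t + x * poly k t \<le> Gm" using Gm(2)[OF t] by linarith
      have "F z \<le> x ^ d * Gm" unfolding Fz using le x by (intro mult_left_mono) auto
      also have "\<dots> \<le> x * Gm"
      proof -
        have "x ^ d \<le> x ^ 1" using d x 1 x1 by (intro power_decreasing) auto
        then show ?thesis using Gm(1) by simp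
      qed
      also have "\<dots> \<le> v0 / 2" using 1 x1(4) Gm(1) by (simp add: field_simps)
      also have "\<dots> < v0" using v0(2) by simp
      finally show ?thesis .
    next
      case 2
      have "x * poly k t \<le> x * (- km)" using km(2)[OF t] x by (intro mult_left_mono) auto
      also have "\<dots> \<le> - Gm" using x2(2) 2 km(1) by (simp add: field_simps)
      finally have "poly g t + x * poly k t \<le> 0" using Gm(2)[OF t] by linarith
      then have "F z \<le> 0" unfolding Fz using x by (simp add: mult_nonneg_nonpos)
      then show ?thesis using v0(2) by simp
    next
      case 3
      then show ?thesis unfolding Fz using ends x by blast
    qed
  qed
  have "\<forall>z\<in>closure R - R. F z < F (x0, x0 * t0)" unfolding Fq using bd by blast
  then have "well F R" unfolding well_def using oR bR q by blast
  moreover have "\<alpha> < snd z / fst z \<and> snd z / fst z < \<beta>" if "z \<in> R" for z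
    using that x1 by (auto simp: R_def field_simps)
  moreover have "x1 \<le> fst z" if "z \<in> R" for z using that by (simp add: R_def)
  ultimately show thesis using that[of R x1] x1(1) unfolding F_def by blast
qed

text \<open>For x different from 0, the sum of a form of degree d and one of degree d + 1, given by
  their affine polynomials.\<close>

definition two_form :: "nat \<Rightarrow> real poly \<Rightarrow> real poly \<Rightarrow> real \<times> real \<Rightarrow> real" where
  "two_form d g k z = fst z ^ d * poly g (snd z / fst z) + fst z ^ Suc d * poly k (snd z / fst z)"

text \<open>Neither g nor k needs a particular sign: a global sign makes g positive at
  \<open>t0\<close>, and reflection in the origin reverses the relative sign of two terms of
  consecutive degrees. The region may therefore lie in x < 0, whence the absolute value in the lower
  bound by \<eta>.\<close>

lemma cone_well:
  fixes g k :: "real poly" and d :: nat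
  assumes d: "1 \<le> d" and t0: "\<alpha> < t0" "t0 < \<beta>" and k: "\<And>t. \<alpha> \<le> t \<Longrightarrow> t \<le> \<beta> \<Longrightarrow> poly k t \<noteq> 0"
    and x0: "0 < x0" and v0: "v0 = x0 ^ d * (\<bar>poly g t0\<bar> - x0 * \<bar>poly k t0\<bar>)" "0 < v0"
    and ends: "\<And>\<tau> x. \<tau> \<in> {\<alpha>, \<beta>} \<Longrightarrow> 0 < x \<Longrightarrow> x ^ d * (\<bar>poly g \<tau>\<bar> - x * \<bar>poly k \<tau>\<bar>) < v0"
  obtains R \<eta> where "well (two_form d g k) R"
    "0 < \<eta>" "\<And>z. z \<in> R \<Longrightarrow> \<eta> \<le> \<bar>fst z\<bar>" "\<And>z. z \<in> R \<Longrightarrow> \<alpha> < snd z / fst z \<and> snd z / fst z < \<beta>"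
proof -
  define \<mu> where "\<mu> = sgn (poly g t0)"
  define \<kappa> where "\<kappa> = - sgn (poly k t0)"
  have g0: "poly g t0 \<noteq> 0"
  proof
    assume "poly g t0 = 0"
    then have "v0 = - (x0 ^ d * (x0 * \<bar>poly k t0\<bar>))" using v0(1) by simp
    then show False using v0(2) x0 by (simp add: mult_less_0_iff)
  qed
  have k0: "poly k t0 \<noteq> 0" using k t0 by auto
  have mk: "\<mu> = 1 \<or> \<mu> = -1" "\<kappa> = 1 \<or> \<kappa> = -1" using g0 k0 by (auto simp: \<mu>_def \<kappa>_def sgn_if)
  have kneg: "poly (smult \<kappa> k) t = - \<bar>poly k t\<bar>" if t: "\<alpha> \<le> t" "t \<le> \<beta>" for t
  proof -
    have "0 < poly k t0 * poly k t"
    proof (rule ccontr)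
      assume "\<not> ?thesis"
      then have neg: "poly k t0 * poly k t < 0" using k[OF t] k0 by (auto simp: not_less le_less)
      have "t \<noteq> t0" using neg by (auto simp: mult_less_0_iff)
      then have "\<exists>u. min t t0 < u \<and> u < max t t0 \<and> poly k u = 0"
        using neg poly_IVT[of "min t t0" "max t t0" k] by (auto simp: min_def max_def mult.commute)
      then obtain u where u: "min t t0 < u" "u < max t t0" "poly k u = 0" by blast
      then have "\<alpha> \<le> u" "u \<le> \<beta>" using t t0 by (auto simp: min_def max_def split: if_splits)
      then show False using u(3) k by blast
    qed
    then show ?thesis by (auto simp: \<kappa>_def sgn_if zero_less_mult_iff)
  qed
  have mg: "poly (smult \<mu> g) t0 = \<bar>poly g t0\<bar>" by (simp add: \<mu>_def abs_sgn mult.commute)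
  have mle: "poly (smult \<mu> g) t \<le> \<bar>poly g t\<bar>" for t using mk by auto
  obtain R \<eta> where R: "well (\<lambda>z. fst z ^ d * (poly (smult \<mu> g) (snd z / fst z) + fst z * poly (smult \<kappa> k) (snd z / fst z))) R"
    "0 < \<eta>" "\<And>z. z \<in> R \<Longrightarrow> \<eta> \<le> fst z" "\<And>z. z \<in> R \<Longrightarrow> \<alpha> < snd z / fst z \<and> snd z / fst z < \<beta>"
  proof (rule cone_well_aux[OF d t0, of "smult \<kappa> k" x0 v0 "smult \<mu> g"])
    show "poly (smult \<kappa> k) t < 0" if "\<alpha> \<le> t" "t \<le> \<beta>" for t using kneg[OF that] k[OF that] by simp
    show "v0 = x0 ^ d * (poly (smult \<mu> g) t0 + x0 * poly (smult \<kappa> k) t0)" using v0(1) mg kneg[of t0] t0 by simp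
    show "x ^ d * (poly (smult \<mu> g) \<tau> + x * poly (smult \<kappa> k) \<tau>) < v0" if "\<tau> \<in> {\<alpha>, \<beta>}" "0 < x" for \<tau> x
    proof -
      have "x ^ d * (poly (smult \<mu> g) \<tau> + x * poly (smult \<kappa> k) \<tau>) \<le> x ^ d * (\<bar>poly g \<tau>\<bar> - x * \<bar>poly k \<tau>\<bar>)"
        using mle[of \<tau>] kneg[of \<tau>] that t0 by (intro mult_left_mono) auto
      also have "\<dots> < v0" using ends that by blast
      finally show ?thesis .
    qed
  qed (use x0 v0 in auto)
  show thesis
  proof (cases "\<kappa> = \<mu>")
    case True
    have "(\<lambda>z. fst z ^ d * (poly (smult \<mu> g) (snd z / fst z) + fst z * poly (smult \<kappa> k) (snd z / fst z))) = (\<lambda>z. \<mu> * two_form d g k z)"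
      by (simp add: two_form_def True algebra_simps)
    then have "well (\<lambda>z. \<mu> * two_form d g k z) R" using R(1) by simp
    then have "well (two_form d g k) R" using mk(1) by (auto simp: well_uminus)
    then show thesis using that[of R \<eta>] R by force
  next
    case False
    then have \<kappa>: "\<kappa> = - \<mu>" using mk by auto
    have eq: "(\<lambda>z. fst z ^ d * (poly (smult \<mu> g) (snd z / fst z) + fst z * poly (smult \<kappa> k) (snd z / fst z)))
       = (\<lambda>z. (\<mu> * (-1) ^ d) * two_form d g k ((-1) *\<^sub>R z))"
    proof
      fix z :: "real \<times> real"
      have m: "(- fst z) ^ d = (-1) ^ d * fst z ^ d" by (rule power_minus)
      have mm: "(-1::real) ^ d * (-1) ^ d = 1" by (simp flip: power_mult_distrib)
      have "(\<mu> * (-1) ^ d) * two_form d g k ((-1) *\<^sub>R z)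
        = \<mu> * ((-1) ^ d * (-1) ^ d) * (fst z ^ d * poly g (snd z / fst z) - fst z * fst z ^ d * poly k (snd z / fst z))"
        by (simp add: two_form_def m algebra_simps)
      then show "fst z ^ d * (poly (smult \<mu> g) (snd z / fst z) + fst z * poly (smult \<kappa> k) (snd z / fst z))
        = (\<mu> * (-1) ^ d) * two_form d g k ((-1) *\<^sub>R z)"
        unfolding mm \<kappa> by (simp add: algebra_simps)
    qed
    have "\<mu> * (-1) ^ d = 1 \<or> \<mu> * (-1) ^ d = -1" using mk(1) by (cases "even d") auto
    then have "well (\<lambda>z. two_form d g k ((-1) *\<^sub>R z)) R" using R(1) unfolding eq by (auto simp: well_uminus)
    then have "well (two_form d g k) ((\<lambda>z. (-1) *\<^sub>R z) ` R)" by (rule well_scale) simp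
    then show thesis using that[of "(\<lambda>z. (-1) *\<^sub>R z) ` R" \<eta>] R(2-4) by force
  qed
qed

lemma cone_well_zero_ends:
  fixes g k :: "real poly" and d :: nat
  assumes d: "1 \<le> d" and t0: "\<alpha> < t0" "t0 < \<beta>" and k: "\<And>t. \<alpha> \<le> t \<Longrightarrow> t \<le> \<beta> \<Longrightarrow> poly k t \<noteq> 0"
    and g: "poly g \<alpha> = 0" "poly g \<beta> = 0" "poly g t0 \<noteq> 0"
  obtains R \<eta> where "well (two_form d g k) R"
    "0 < \<eta>" "\<And>z. z \<in> R \<Longrightarrow> \<eta> \<le> \<bar>fst z\<bar>" "\<And>z. z \<in> R \<Longrightarrow> \<alpha> < snd z / fst z \<and> snd z / fst z < \<beta>"
proof -
  have k0: "poly k t0 \<noteq> 0" using k t0 by auto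
  \<comment> \<open>Half of the positive zero of |g| - x |k| on the middle ray, so that the value
    there is positive.\<close>
  define x0 where "x0 = \<bar>poly g t0\<bar> / (2 * \<bar>poly k t0\<bar>)"
  have x0: "0 < x0" using k0 g by (simp add: x0_def)
  have v0: "0 < x0 ^ d * (\<bar>poly g t0\<bar> - x0 * \<bar>poly k t0\<bar>)" using x0 g k0 by (simp add: x0_def)
  have "x ^ d * (\<bar>poly g \<tau>\<bar> - x * \<bar>poly k \<tau>\<bar>) < x0 ^ d * (\<bar>poly g t0\<bar> - x0 * \<bar>poly k t0\<bar>)" if "\<tau> \<in> {\<alpha>, \<beta>}" "0 < x" for \<tau> x
  proof -
    have "x ^ d * (\<bar>poly g \<tau>\<bar> - x * \<bar>poly k \<tau>\<bar>) \<le> 0" using that g by auto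
    then show ?thesis using v0 by linarith
  qed
  from cone_well[OF d t0 k x0 refl v0 this] show thesis using that by blast
qed

text \<open>On a side ray the function is positive only for x < |g| / |k|, where it is at most (|g|
  / |k|)^d |g|. It suffices to exceed this at one point of the middle ray, with abscissa
  \<open>M\<close>.\<close>

lemma cone_well_spike:
  fixes g k :: "real poly" and d :: nat
  assumes d: "1 \<le> d" and t0: "\<alpha> < t0" "t0 < \<beta>" and k: "\<And>t. \<alpha> \<le> t \<Longrightarrow> t \<le> \<beta> \<Longrightarrow> poly k t \<noteq> 0"
    and M: "0 < M" "0 < M ^ d * (\<bar>poly g t0\<bar> - M * \<bar>poly k t0\<bar>)"
    and ends: "\<And>\<tau>. \<tau> \<in> {\<alpha>, \<beta>} \<Longrightarrow> (\<bar>poly g \<tau>\<bar> / \<bar>poly k \<tau>\<bar>) ^ d * \<bar>poly g \<tau>\<bar> < M ^ d * (\<bar>poly g t0\<bar> - M * \<bar>poly k t0\<bar>)"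
  obtains R \<eta> where "well (two_form d g k) R"
    "0 < \<eta>" "\<And>z. z \<in> R \<Longrightarrow> \<eta> \<le> \<bar>fst z\<bar>" "\<And>z. z \<in> R \<Longrightarrow> \<alpha> < snd z / fst z \<and> snd z / fst z < \<beta>"
proof -
  have "x ^ d * (\<bar>poly g \<tau>\<bar> - x * \<bar>poly k \<tau>\<bar>) < M ^ d * (\<bar>poly g t0\<bar> - M * \<bar>poly k t0\<bar>)" if \<tau>: "\<tau> \<in> {\<alpha>, \<beta>}" and x: "0 < x" for \<tau> x
  proof (cases "\<bar>poly g \<tau>\<bar> - x * \<bar>poly k \<tau>\<bar> \<le> 0")
    case True
    then have "x ^ d * (\<bar>poly g \<tau>\<bar> - x * \<bar>poly k \<tau>\<bar>) \<le> 0" using x by (simp add: mult_nonneg_nonpos)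
    then show ?thesis using M(2) by linarith
  next
    case False
    have k0: "0 < \<bar>poly k \<tau>\<bar>" using k \<tau> t0 by fastforce
    have "x \<le> \<bar>poly g \<tau>\<bar> / \<bar>poly k \<tau>\<bar>" using False k0 by (simp add: field_simps)
    then have "x ^ d \<le> (\<bar>poly g \<tau>\<bar> / \<bar>poly k \<tau>\<bar>) ^ d" using x by (intro power_mono) auto
    moreover have "\<bar>poly g \<tau>\<bar> - x * \<bar>poly k \<tau>\<bar> \<le> \<bar>poly g \<tau>\<bar>" using x by simp
    ultimately have "x ^ d * (\<bar>poly g \<tau>\<bar> - x * \<bar>poly k \<tau>\<bar>) \<le> (\<bar>poly g \<tau>\<bar> / \<bar>poly k \<tau>\<bar>) ^ d * \<bar>poly g \<tau>\<bar>"
      using False x by (intro mult_mono) auto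
    also have "\<dots> < M ^ d * (\<bar>poly g t0\<bar> - M * \<bar>poly k t0\<bar>)" using ends \<tau> by blast
    finally show ?thesis .
  qed
  from cone_well[OF d t0 k M(1) refl M(2) this] show thesis using that by blast
qed

section \<open>Transfer of wells from infinity to the affine plane\<close>

lemma total_degree_le: "bidegree_less (Suc d) p \<Longrightarrow> total_degree p \<le> d"
  unfolding total_degree_def bidegree_less_def by (intro Least_le) auto

lemma homogeneous_part_eq: "x \<noteq> 0 \<Longrightarrow> homogeneous_part d p x y = x ^ d * poly (top_form d p) (y / x)"
proof -
  assume x: "x \<noteq> 0"
  have "homogeneous_part d p x y = (\<Sum>i\<le>d. x ^ d * (coeff (coeff p i) (d - i) * (y / x) ^ i))"
    unfolding homogeneous_part_def
  proof (intro sum.cong refl)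
    fix i assume "i \<in> {..d}"
    then have "x ^ d = x ^ (d - i) * x ^ i" by (simp flip: power_add)
    then show "coeff (coeff p i) (d - i) * x ^ (d - i) * y ^ i = x ^ d * (coeff (coeff p i) (d - i) * (y / x) ^ i)"
      using x by (simp add: power_divide)
  qed
  also have "\<dots> = x ^ d * poly (top_form d p) (y / x)"
    by (simp add: top_form_def poly_sum poly_monom sum_distrib_left)
  finally show ?thesis .
qed

lemma eval_form_xy: "eval_xy (form_xy d p) x y = (\<Sum>i\<le>d. coeff p i * x ^ (d - i) * y ^ i)"
  by (simp add: form_xy_def eval_xy_sum eval_xy_mono)

lemma eval_form_xy_eq:
  assumes "degree p \<le> d" "x \<noteq> 0"
  shows "eval_xy (form_xy d p) x y = x ^ d * poly p (y / x)"
proof -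
  have "eval_xy (form_xy d p) x y = homogeneous_part d (form_xy d p) x y"
    unfolding eval_form_xy homogeneous_part_def
  proof (intro sum.cong refl)
    fix i assume "i \<in> {..d}"
    then have "coeff (coeff (form_xy d p) i) (d - i) = coeff p i"
      using arg_cong[OF top_form_form_xy[OF assms(1)], of "\<lambda>p. coeff p i"] by (simp add: coeff_top_form)
    then show "coeff p i * x ^ (d - i) * y ^ i = coeff (coeff (form_xy d p) i) (d - i) * x ^ (d - i) * y ^ i" by simp
  qed
  then show ?thesis using assms by (simp add: homogeneous_part_eq top_form_form_xy)
qed

lemma eval_form_xy_scale: "eval_xy (form_xy d p) (c * x) (c * y) = c ^ d * eval_xy (form_xy d p) x y"
  unfolding eval_form_xy sum_distrib_left
proof (intro sum.cong refl)
  fix i assume "i \<in> {..d}"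
  then have "c ^ d = c ^ (d - i) * c ^ i" by (simp flip: power_add)
  then show "coeff p i * (c * x) ^ (d - i) * (c * y) ^ i = c ^ d * (coeff p i * x ^ (d - i) * y ^ i)"
    by (simp add: power_mult_distrib)
qed

text \<open>
  Adding a small multiple \<open>w K\<close> of a form of degree \<open>d + 1\<close> keeps the wells of \<open>G\<close>. In the rescaled
  variables \<open>z / w\<close> the limit \<open>w \<rightarrow> 0\<close> is the sum of \<open>K\<close> and the leading form of \<open>G\<close>, whose
  wells are therefore wells of \<open>G + w K\<close> near infinity.
\<close>

lemma wells_near_infinity:
  assumes G: "bidegree_less (Suc d) G" and W: "wells (evalp G) \<W>" and k: "degree k \<le> Suc d"
    and R: "\<And>i. i < N \<Longrightarrow> well (two_form d (top_form d G) k) (R i)"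
      "\<And>i. i < N \<Longrightarrow> 0 < \<eta> i" "\<And>i z. i < N \<Longrightarrow> z \<in> R i \<Longrightarrow> \<eta> i \<le> \<bar>fst z\<bar>"
      "\<And>i z. i < N \<Longrightarrow> z \<in> R i \<Longrightarrow> lo i < snd z / fst z \<and> snd z / fst z < hi i"
    and disj: "\<And>i j. i < N \<Longrightarrow> j < N \<Longrightarrow> i \<noteq> j \<Longrightarrow> hi i \<le> lo j \<or> hi j \<le> (lo i :: real)"
  obtains w \<W>' where "0 < w" "wells (evalp (G + mono_xy 0 0 w * form_xy (Suc d) k)) \<W>'" "card \<W>' = card \<W> + N"
proof -
  define H where "H w = G + mono_xy 0 0 w * form_xy (Suc d) k" for w
  \<comment> \<open>Equal to w^d times \<open>H w\<close> at z / w for w > 0, and continuous down to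
    w = 0, where the leading form of \<open>G\<close> remains.\<close>
  define \<Phi> where "\<Phi> w z = homogenize d G (fst z) (snd z) w + evalp (form_xy (Suc d) k) z" for w z
  have evH: "evalp (H w) z = evalp G z + w * evalp (form_xy (Suc d) k) z" for w z
    by (simp add: H_def eval_xy_add eval_xy_mult eval_xy_mono)
  \<comment> \<open>\<open>two_form\<close> represents the sum of forms only off x = 0; the bound by
    \<eta> keeps the closed regions away from that line.\<close>
  have R0: "fst z \<noteq> 0" if "i < N" "z \<in> closure (R i)" for i z
  proof -
    have "closure (R i) \<subseteq> {z. \<eta> i \<le> \<bar>fst z\<bar>}"
      using R(3)[OF that(1)] by (intro closure_minimal closed_Collect_le continuous_intros) auto
    then show ?thesis using R(2) that by force
  qed
  have "well (\<Phi> 0) (R i)" if "i < N" for i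
  proof -
    have "\<Phi> 0 z = two_form d (top_form d G) k z" if "z \<in> closure (R i)" for z
      using R0[OF \<open>i < N\<close> that] k unfolding \<Phi>_def two_form_def homogenize_equator
      by (simp add: homogeneous_part_eq eval_form_xy_eq)
    then show ?thesis using R(1)[OF that] well_cong[of "R i" "\<Phi> 0"] by blast
  qed
  moreover have c\<Phi>: "continuous_on UNIV (\<lambda>p. \<Phi> (fst p) (snd p))"
    unfolding \<Phi>_def homogenize_def by (intro continuous_intros)
  ultimately have "\<forall>\<^sub>F w in nhds 0. well (\<Phi> w) (R i)" if "i < N" for i
    using well_stable[OF c\<Phi>] that by blast
  then have "\<forall>\<^sub>F w in nhds 0. \<forall>i\<in>{..<N}. well (\<Phi> w) (R i)" by (intro eventually_ball_finite) auto
  then have e1: "\<forall>\<^sub>F w in at_right 0. \<forall>i\<in>{..<N}. well (\<Phi> w) (R i)"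
    by (rule filter_leD[rotated]) (simp add: at_within_le_nhds)
  have "continuous_on UNIV (\<lambda>p. evalp (H (fst p)) (snd p))" unfolding evH by (intro continuous_intros)
  moreover have "wells (evalp (H 0)) \<W>" using W unfolding evH by simp
  ultimately have "\<forall>\<^sub>F w in nhds 0. wells (evalp (H w)) \<W>" by (rule wells_stable)
  then have e2: "\<forall>\<^sub>F w in at_right 0. wells (evalp (H w)) \<W>"
    by (rule filter_leD[rotated]) (simp add: at_within_le_nhds)
  \<comment> \<open>The old wells stay in a fixed ball, and the rescaled new ones move out of it as
    w tends to 0. Together with the disjoint cones this gives pairwise disjoint wells.\<close>
  have "bounded (\<Union>\<W>)" using W by (auto simp: wells_def well_def)
  then obtain B where B: "\<And>z. z \<in> \<Union>\<W> \<Longrightarrow> norm z \<le> B" unfolding bounded_iff by blast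
  have "\<forall>\<^sub>F w in at_right 0. \<forall>i\<in>{..<N}. \<bar>B\<bar> * w < \<eta> i"
  proof (intro eventually_ball_finite ballI)
    fix i assume "i \<in> {..<N}"
    have "((\<lambda>w. \<bar>B\<bar> * w) \<longlongrightarrow> \<bar>B\<bar> * 0) (at_right 0)" by (intro tendsto_intros)
    then show "\<forall>\<^sub>F w in at_right 0. \<bar>B\<bar> * w < \<eta> i"
      by (rule order_tendstoD(2)) (use R(2) \<open>i \<in> {..<N}\<close> in simp)
  qed simp
  with e1 e2 have "\<forall>\<^sub>F w in at_right 0. (\<forall>i\<in>{..<N}. well (\<Phi> w) (R i)) \<and> wells (evalp (H w)) \<W> \<and> (\<forall>i\<in>{..<N}. \<bar>B\<bar> * w < \<eta> i)"
    by eventually_elim auto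
  then obtain w where w: "0 < w" "\<And>i. i < N \<Longrightarrow> well (\<Phi> w) (R i)" "wells (evalp (H w)) \<W>" "\<And>i. i < N \<Longrightarrow> \<bar>B\<bar> * w < \<eta> i"
    by (rule eventually_at_right_witness) auto
  define S where "S i = (\<lambda>z. (1 / w) *\<^sub>R z) ` R i" for i
  have wS: "well (evalp (H w)) (S i)" if "i < N" for i
  proof -
    have "\<Phi> w z = w ^ d * evalp (H w) ((1 / w) *\<^sub>R z)" for z
    proof -
      have "evalp (form_xy (Suc d) k) z = w ^ Suc d * eval_xy (form_xy (Suc d) k) (fst z / w) (snd z / w)"
        using eval_form_xy_scale[of "Suc d" k w "fst z / w" "snd z / w"] w(1) by simp
      then show ?thesis unfolding \<Phi>_def evH
        using homogenize_eq[OF total_degree_le[OF G], of w] w(1) by (simp add: algebra_simps)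
    qed
    then have "\<Phi> w = (\<lambda>z. w ^ d * evalp (H w) ((1 / w) *\<^sub>R z))" by (rule ext)
    then have "well (\<lambda>z. w ^ d * evalp (H w) ((1 / w) *\<^sub>R z)) (R i)" using w(2)[OF that] by (simp only:)
    then have "well (\<lambda>z. evalp (H w) ((1 / w) *\<^sub>R z)) (R i)" using well_cmult[of "w ^ d"] w(1) by simp
    then show ?thesis unfolding S_def using well_scale[of "evalp (H w)" "1 / w"] w(1) by simp
  qed
  have S_cone: "lo i < snd z / fst z \<and> snd z / fst z < hi i" if "i < N" "z \<in> S i" for i z
    using that R(4) w(1) by (auto simp: S_def)
  have S_far: "B < norm z" if iN: "i < N" and zS: "z \<in> S i" for i z
  proof -
    obtain y where y: "y \<in> R i" "z = (1 / w) *\<^sub>R y" using zS unfolding S_def by blast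
    have "\<bar>B\<bar> * w < \<bar>fst y\<bar>" using R(3)[OF iN y(1)] w(4)[OF iN] by linarith
    also have "\<bar>fst y\<bar> \<le> norm y" using norm_fst_le[of "fst y" "snd y"] by simp
    finally have "\<bar>B\<bar> < norm y / w" using w(1) by (simp add: field_simps)
    then show ?thesis using w(1) by (simp add: y(2))
  qed
  have dis: "S i \<inter> S j = {}" if "i < N" "j < N" "i \<noteq> j" for i j
    using S_cone[OF that(1)] S_cone[OF that(2)] disj[OF that] by fastforce
  have ne: "S i \<noteq> {}" if "i < N" for i using wS[OF that] by (auto simp: well_def)
  have inj: "inj_on S {..<N}" using dis ne unfolding inj_on_def by (metis inf.idem lessThan_iff)
  have disW: "W \<inter> S i = {}" if "W \<in> \<W>" "i < N" for W i
    using S_far[OF that(2)] B that(1) by fastforce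
  have "wells (evalp (H w)) (\<W> \<union> S ` {..<N})"
    unfolding wells_def pairwise_def disjnt_def
  proof (intro conjI ballI impI)
    show "finite (\<W> \<union> S ` {..<N})" using w(3) by (simp add: wells_def)
    show "well (evalp (H w)) V" if "V \<in> \<W> \<union> S ` {..<N}" for V using that w(3) wS by (auto simp: wells_def)
    fix V V' assume V: "V \<in> \<W> \<union> S ` {..<N}" "V' \<in> \<W> \<union> S ` {..<N}" "V \<noteq> V'"
    consider "V \<in> \<W>" "V' \<in> \<W>" | j where "V \<in> \<W>" "j < N" "V' = S j" | i where "i < N" "V = S i" "V' \<in> \<W>"
      | i j where "i < N" "V = S i" "j < N" "V' = S j"
      using V(1,2) by blast
    then show "V \<inter> V' = {}"
    proof cases
      case 1
      then show ?thesis using w(3) V(3) by (simp add: wells_def pairwise_def disjnt_def)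
    next
      case (2 j)
      then show ?thesis using disW by simp
    next
      case (3 i)
      then show ?thesis using disW[of V' i] by (simp add: Int_commute)
    next
      case (4 i j)
      then show ?thesis using dis[of i j] V(3) by blast
    qed
  qed
  moreover have "card (\<W> \<union> S ` {..<N}) = card \<W> + N"
  proof -
    have "\<W> \<inter> S ` {..<N} = {}" using disW ne by fastforce
    then show ?thesis using w(3) inj by (subst card_Un_disjoint) (auto simp: wells_def card_image)
  qed
  ultimately show thesis using that[of w] w(1) by (simp add: H_def)
qed

section \<open>Hamiltonians with many extrema\<close>

text \<open>The \<open>r\<close> distinct real zeros B, ..., B + r - 1 are followed by
  \<open>k\<close> conjugate pairs with real parts B + r, B + r + 1, ... and imaginary parts of
  modulus \<eta>. The exponent \<open>e\<close> repeats the zero B, which adjusts the parity of the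
  degree without a new real zero.\<close>

definition step_poly :: "real \<Rightarrow> nat \<Rightarrow> nat \<Rightarrow> nat \<Rightarrow> real \<Rightarrow> real poly" where
  "step_poly B e r k \<eta> = [:- B, 1:] ^ e * (\<Prod>i<r. [:- (B + real i), 1:])
     * (\<Prod>j<k. [:(B + real (r + j))\<^sup>2 + \<eta>\<^sup>2, - 2 * (B + real (r + j)), 1:])"

lemma poly_linear_factor: "poly [:- a, 1:] t = t - a" for a t :: "'a :: comm_ring_1"
  by simp

lemma poly_step_poly:
  "poly (step_poly B e r k \<eta>) t = (t - B) ^ e * (\<Prod>i<r. t - (B + real i)) * (\<Prod>j<k. (t - (B + real (r + j)))\<^sup>2 + \<eta>\<^sup>2)"
proof -
  have quad: "poly [:c\<^sup>2 + \<eta>\<^sup>2, - 2 * c, 1:] t = (t - c)\<^sup>2 + \<eta>\<^sup>2" for c by (simp add: power2_eq_square algebra_simps)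
  show ?thesis unfolding step_poly_def poly_mult poly_power poly_prod poly_linear_factor quad by (rule refl)
qed

lemma degree_step_poly: "degree (step_poly B e r k \<eta>) = e + r + 2 * k"
  and step_poly_nonzero: "step_poly B e r k \<eta> \<noteq> 0"
proof -
  let ?E = "[:- B, 1:] ^ e" and ?R = "\<Prod>i<r. [:- (B + real i), 1:]"
    and ?K = "\<Prod>j<k. [:(B + real (r + j))\<^sup>2 + \<eta>\<^sup>2, - 2 * (B + real (r + j)), 1:]"
  have nz: "?E \<noteq> 0" "?R \<noteq> 0" "?K \<noteq> 0" by auto
  then show "step_poly B e r k \<eta> \<noteq> 0" unfolding step_poly_def by simp
  have "degree ?E = e" "degree ?R = r" "degree ?K = 2 * k"
    by (simp_all add: degree_power_eq degree_prod_eq_sum_degree)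
  then show "degree (step_poly B e r k \<eta>) = e + r + 2 * k"
    unfolding step_poly_def using nz by (simp add: degree_mult_eq)
qed

lemma step_poly_not_root:
  assumes "t < B \<or> B + real r - 1 < t" "0 < e \<longrightarrow> 0 < r" "\<eta> \<noteq> 0 \<or> (\<forall>l<k. t \<noteq> B + real (r + l))"
  shows "poly (step_poly B e r k \<eta>) t \<noteq> 0"
proof -
  have n1: "(t - B) ^ e \<noteq> 0" using assms(1,2) by (cases "e = 0") auto
  have "t - (B + real i) \<noteq> 0" if "i < r" for i
  proof -
    have "real i \<le> real r - 1" using that by linarith
    then show ?thesis using assms(1) by auto
  qed
  then have n2: "(\<Prod>i<r. t - (B + real i)) \<noteq> 0" unfolding prod_zero_iff[OF finite_lessThan] by blast
  have "(t - (B + real (r + j)))\<^sup>2 + \<eta>\<^sup>2 \<noteq> 0" if "j < k" for j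
    using assms(3) that by (auto simp: sum_power2_eq_zero_iff)
  then have n3: "(\<Prod>j<k. (t - (B + real (r + j)))\<^sup>2 + \<eta>\<^sup>2) \<noteq> 0" unfolding prod_zero_iff[OF finite_lessThan] by blast
  show ?thesis unfolding poly_step_poly mult_eq_0_iff using n1 n2 n3 by blast
qed

lemma step_poly_roots:
  assumes "0 < e \<longrightarrow> 0 < r" "\<eta> \<noteq> 0"
  shows "{t. poly (step_poly B e r k \<eta>) t = 0} = (\<lambda>i. B + real i) ` {..<r}"
proof (intro equalityI subsetI)
  fix t assume "t \<in> {t. poly (step_poly B e r k \<eta>) t = 0}"
  moreover have "(t - (B + real (r + j)))\<^sup>2 + \<eta>\<^sup>2 \<noteq> 0" for j
    using assms(2) by (simp add: sum_power2_eq_zero_iff)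
  ultimately have "(t - B) ^ e = 0 \<or> (\<exists>i<r. t = B + real i)"
    by (auto simp: poly_step_poly simp del: of_nat_add)
  then show "t \<in> (\<lambda>i. B + real i) ` {..<r}" using assms(1) by (auto simp: image_iff)
qed (auto simp: poly_step_poly)

lemma step_poly_tendsto: "((\<lambda>\<eta>. poly (step_poly B e r k \<eta>) t) \<longlongrightarrow> poly (step_poly B e r k 0) t) (at_right 0)"
  unfolding poly_step_poly by (intro tendsto_intros)

text \<open>
  As \<open>\<eta> \<rightarrow> 0\<close> the zeros \<open>c \<plusminus> \<i> \<eta>\<close> of the form approach the real axis and \<open>|g|^(d + 1) / |k|^d\<close> blows up at \<open>c\<close>
  while staying bounded at \<open>c \<plusminus> 1/3\<close>.
\<close>

lemma spike_exists:
  fixes g :: "real poly"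
  assumes d: "1 \<le> d" and r: "0 < e \<longrightarrow> 0 < r" and j: "j < k" and g: "poly g (B + real (r + j)) \<noteq> 0"
  defines "c \<equiv> B + real (r + j)"
  shows "\<exists>M>0. \<forall>\<^sub>F \<eta> in at_right 0. 0 < M ^ d * (\<bar>poly g c\<bar> - M * \<bar>poly (step_poly B e r k \<eta>) c\<bar>) \<and>
     (\<forall>\<tau>\<in>{c - 1/3, c + 1/3}. (\<bar>poly g \<tau>\<bar> / \<bar>poly (step_poly B e r k \<eta>) \<tau>\<bar>) ^ d * \<bar>poly g \<tau>\<bar>
        < M ^ d * (\<bar>poly g c\<bar> - M * \<bar>poly (step_poly B e r k \<eta>) c\<bar>))"
proof -
  let ?K = "\<lambda>\<eta>. poly (step_poly B e r k \<eta>)"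
  let ?A = "\<lambda>\<tau> \<eta>. (\<bar>poly g \<tau>\<bar> / \<bar>?K \<eta> \<tau>\<bar>) ^ d * \<bar>poly g \<tau>\<bar>"
  define C where "C = \<bar>poly g c\<bar>"
  have C: "0 < C" using g by (simp add: C_def c_def)
  have Kc: "?K 0 c = 0" unfolding poly_step_poly c_def using j by auto
  \<comment> \<open>An offset of 1/3 from the unit grid avoids all limiting zeros, and it keeps the
    cones around neighbouring pairs disjoint.\<close>
  have K\<tau>: "?K 0 \<tau> \<noteq> 0" if "\<tau> \<in> {c - 1/3, c + 1/3}" for \<tau>
  proof (rule step_poly_not_root)
    show "\<tau> < B \<or> B + real r - 1 < \<tau>" using that by (auto simp: c_def)
    have "\<tau> \<noteq> B + real (r + l)" for l
    proof
      assume "\<tau> = B + real (r + l)"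
      then have "3 * real j - 1 = 3 * real l \<or> 3 * real j + 1 = 3 * real l" using that by (auto simp: c_def)
      then have "real_of_int (3 * int j - 1) = real_of_int (3 * int l) \<or> real_of_int (3 * int j + 1) = real_of_int (3 * int l)" by simp
      then have "3 * int j - 1 = 3 * int l \<or> 3 * int j + 1 = 3 * int l" by (simp only: of_int_eq_iff)
      then show False by presburger
    qed
    then show "0 \<noteq> (0::real) \<or> (\<forall>l<k. \<tau> \<noteq> B + real (r + l))" by blast
  qed (rule r)
  define a1 where "a1 = ?A (c - 1/3) 0"
  define a2 where "a2 = ?A (c + 1/3) 0"
  \<comment> \<open>In the limit the middle value is at least M C = C + a1 + a2, which exceeds both
    limiting side bounds \<open>a1\<close> and \<open>a2\<close>.\<close>
  define M where "M = 1 + (a1 + a2) / C"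
  have A0: "0 \<le> a1" "0 \<le> a2" by (simp_all add: a1_def a2_def)
  have M: "1 \<le> M" using C A0 by (simp add: M_def)
  have "M \<le> M ^ d" using M d power_increasing[of 1 d M] by simp
  then have le: "M * C \<le> M ^ d * C" using C by simp
  have "M * C = C + (a1 + a2)" using C by (simp add: M_def distrib_right)
  then have lt: "a1 < M ^ d * C" "a2 < M ^ d * C" using le C A0 by linarith+
  have big: "?A \<tau> 0 < M ^ d * (C - M * \<bar>?K 0 c\<bar>)" if "\<tau> \<in> {c - 1/3, c + 1/3}" for \<tau>
  proof -
    have "M ^ d * (C - M * \<bar>?K 0 c\<bar>) = M ^ d * C" unfolding Kc by simp
    moreover have "?A \<tau> 0 = a1 \<or> ?A \<tau> 0 = a2" using that unfolding a1_def a2_def by blast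
    ultimately show ?thesis using lt by metis
  qed
  have tv: "((\<lambda>\<eta>. M ^ d * (C - M * \<bar>?K \<eta> c\<bar>)) \<longlongrightarrow> M ^ d * (C - M * \<bar>?K 0 c\<bar>)) (at_right 0)"
    by (intro tendsto_intros step_poly_tendsto)
  have tA: "((\<lambda>\<eta>. ?A \<tau> \<eta>) \<longlongrightarrow> ?A \<tau> 0) (at_right 0)" if "\<tau> \<in> {c - 1/3, c + 1/3}" for \<tau>
    using K\<tau>[OF that] by (intro tendsto_intros step_poly_tendsto) auto
  have "\<forall>\<^sub>F \<eta> in at_right 0. 0 < M ^ d * (C - M * \<bar>?K \<eta> c\<bar>)"
    by (rule order_tendstoD(1)[OF tv]) (use C M in \<open>simp add: Kc\<close>)
  moreover have "\<forall>\<^sub>F \<eta> in at_right 0. \<forall>\<tau>\<in>{c - 1/3, c + 1/3}. ?A \<tau> \<eta> < M ^ d * (C - M * \<bar>?K \<eta> c\<bar>)"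
  proof (intro eventually_ball_finite ballI)
    fix \<tau> assume \<tau>: "\<tau> \<in> {c - 1/3, c + 1/3}"
    have "((\<lambda>\<eta>. M ^ d * (C - M * \<bar>?K \<eta> c\<bar>) - ?A \<tau> \<eta>) \<longlongrightarrow> M ^ d * (C - M * \<bar>?K 0 c\<bar>) - ?A \<tau> 0) (at_right 0)"
      by (intro tendsto_diff tv tA \<tau>)
    then have "\<forall>\<^sub>F \<eta> in at_right 0. 0 < M ^ d * (C - M * \<bar>?K \<eta> c\<bar>) - ?A \<tau> \<eta>"
      by (rule order_tendstoD(1)) (use big[OF \<tau>] in simp)
    then show "\<forall>\<^sub>F \<eta> in at_right 0. ?A \<tau> \<eta> < M ^ d * (C - M * \<bar>?K \<eta> c\<bar>)" by eventually_elim simp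
  qed simp
  ultimately have "\<forall>\<^sub>F \<eta> in at_right 0. 0 < M ^ d * (C - M * \<bar>?K \<eta> c\<bar>) \<and>
      (\<forall>\<tau>\<in>{c - 1/3, c + 1/3}. ?A \<tau> \<eta> < M ^ d * (C - M * \<bar>?K \<eta> c\<bar>))" by eventually_elim blast
  then show ?thesis using M unfolding C_def by (intro exI[of _ M]) auto
qed

text \<open>The zeros of the new leading form have real parts from s + d on, to the right of those
  of the old one. Thus the new form has no zero over the d - 1 old gaps, each of which gives a well;
  every conjugate pair gives another.\<close>

lemma chain_step:
  assumes G: "bidegree_less (Suc d) G" and d: "1 \<le> d"
    and top: "top_form d G = smult c (\<Prod>i<d. [:- (s + real i), 1:])" "c \<noteq> 0"
    and W: "wells (evalp G) \<W>" and er: "e + r + 2 * k = Suc d" "0 < e \<longrightarrow> 0 < r"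
  obtains H \<epsilon> \<eta> \<W>' where "bidegree_less (Suc (Suc d)) H" "top_form (Suc d) H = smult \<epsilon> (step_poly (s + real d) e r k \<eta>)"
    "\<epsilon> \<noteq> 0" "\<eta> \<noteq> 0" "wells (evalp H) \<W>'" "card \<W>' = card \<W> + ((d - 1) + k)"
proof -
  let ?g = "top_form d G"
  define B where "B = s + real d"
  define C where "C j = B + real (r + j)" for j
  have pg: "poly ?g t = c * (\<Prod>i<d. t - (s + real i))" for t
    unfolding top(1) poly_smult poly_prod poly_linear_factor by (rule refl)
  have g0: "poly ?g t \<noteq> 0" if "\<And>i. i < d \<Longrightarrow> t \<noteq> s + real i" for t
    unfolding pg using top(2) that by auto
  have gC: "poly ?g (C j) \<noteq> 0" for j
  proof (rule g0)
    fix i assume "i < d"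
    then have "s + real i < C j" by (simp add: C_def B_def)
    then show "C j \<noteq> s + real i" by simp
  qed
  define good where "good j M \<eta> \<longleftrightarrow> 0 < M ^ d * (\<bar>poly ?g (C j)\<bar> - M * \<bar>poly (step_poly B e r k \<eta>) (C j)\<bar>) \<and>
     (\<forall>\<tau>\<in>{C j - 1/3, C j + 1/3}. (\<bar>poly ?g \<tau>\<bar> / \<bar>poly (step_poly B e r k \<eta>) \<tau>\<bar>) ^ d * \<bar>poly ?g \<tau>\<bar>
        < M ^ d * (\<bar>poly ?g (C j)\<bar> - M * \<bar>poly (step_poly B e r k \<eta>) (C j)\<bar>))" for j M \<eta>
  have "\<exists>M>0. \<forall>\<^sub>F \<eta> in at_right 0. good j M \<eta>" if "j < k" for j
    using spike_exists[OF d er(2) that gC[of j, unfolded C_def]] unfolding good_def C_def .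
  then obtain M where M: "\<And>j. j < k \<Longrightarrow> 0 < M j" "\<And>j. j < k \<Longrightarrow> \<forall>\<^sub>F \<eta> in at_right 0. good j (M j) \<eta>" by metis
  have "\<forall>\<^sub>F \<eta> in at_right 0. \<forall>j\<in>{..<k}. good j (M j) \<eta>" using M(2) by (intro eventually_ball_finite) auto
  then obtain \<eta> where \<eta>: "0 < \<eta>" "\<And>j. j < k \<Longrightarrow> good j (M j) \<eta>" by (rule eventually_at_right_witness) auto
  let ?K = "step_poly B e r k \<eta>"
  have Knz: "poly ?K t \<noteq> 0" if "t < B \<or> B + real r - 1 < t" for t
    using that er(2) \<eta>(1) by (intro step_poly_not_root) auto
  \<comment> \<open>The first d - 1 indices number the gaps, the remaining k the conjugate
    pairs.\<close>
  define lo where "lo i = (if i < d - 1 then s + real i else C (i - (d - 1)) - 1/3)" for i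
  define hi where "hi i = (if i < d - 1 then s + real i + 1 else C (i - (d - 1)) + 1/3)" for i
  have ex: "\<exists>R h. well (two_form d ?g ?K) R \<and> 0 < h \<and> (\<forall>z\<in>R. h \<le> \<bar>fst z\<bar>) \<and> (\<forall>z\<in>R. lo i < snd z / fst z \<and> snd z / fst z < hi i)"
    if i: "i < (d - 1) + k" for i
  proof (cases "i < d - 1")
    case True
    have z1: "poly ?g (s + real i) = 0" unfolding pg using True by auto
    have z2: "poly ?g (s + real i + 1) = 0" unfolding pg
    proof -
      have "Suc i \<in> {..<d}" "s + real i + 1 - (s + real (Suc i)) = 0" using True by auto
      then have "(\<Prod>l<d. s + real i + 1 - (s + real l)) = 0" using prod_zero_iff[of "{..<d}"] by blast
      then show "c * (\<Prod>l<d. s + real i + 1 - (s + real l)) = 0" by simp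
    qed
    have z3: "poly ?g (s + real i + 1/2) \<noteq> 0"
    proof (rule g0)
      fix l
      show "s + real i + 1/2 \<noteq> s + real l"
      proof
        assume "s + real i + 1/2 = s + real l"
        then have "real_of_int (2 * int i + 1) = real_of_int (2 * int l)" by simp
        then have "2 * int i + 1 = 2 * int l" by (simp only: of_int_eq_iff)
        then show False by presburger
      qed
    qed
    have kn: "poly ?K t \<noteq> 0" if "s + real i \<le> t" "t \<le> s + real i + 1" for t
    proof (rule Knz)
      have "real i + 1 < real d" using True by linarith
      then show "t < B \<or> B + real r - 1 < t" using that by (simp add: B_def)
    qed
    obtain R h where "well (two_form d ?g ?K) R" "0 < h" "\<And>z. z \<in> R \<Longrightarrow> h \<le> \<bar>fst z\<bar>"
      "\<And>z. z \<in> R \<Longrightarrow> s + real i < snd z / fst z \<and> snd z / fst z < s + real i + 1"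
      by (rule cone_well_zero_ends[OF d, of "s + real i" "s + real i + 1/2" "s + real i + 1" ?K ?g])
        (use kn z1 z2 z3 in auto)
    moreover have "lo i = s + real i" "hi i = s + real i + 1" using True by (simp_all add: lo_def hi_def)
    ultimately show ?thesis by metis
  next
    case False
    define j where "j = i - (d - 1)"
    have j: "j < k" using False i by (simp add: j_def)
    have kn: "poly ?K t \<noteq> 0" if "C j - 1/3 \<le> t" "t \<le> C j + 1/3" for t
      using that by (intro Knz) (simp add: C_def)
    have gj: "good j (M j) \<eta>" using \<eta>(2) j by blast
    obtain R h where "well (two_form d ?g ?K) R" "0 < h" "\<And>z. z \<in> R \<Longrightarrow> h \<le> \<bar>fst z\<bar>"
      "\<And>z. z \<in> R \<Longrightarrow> C j - 1/3 < snd z / fst z \<and> snd z / fst z < C j + 1/3"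
      by (rule cone_well_spike[OF d, of "C j - 1/3" "C j" "C j + 1/3" ?K "M j" ?g])
        (use kn M(1)[OF j] gj in \<open>auto simp: good_def\<close>)
    moreover have "lo i = C j - 1/3" "hi i = C j + 1/3" using False by (simp_all add: lo_def hi_def j_def)
    ultimately show ?thesis by metis
  qed
  then obtain R h where R: "\<And>i. i < (d - 1) + k \<Longrightarrow> well (two_form d ?g ?K) (R i)" "\<And>i. i < (d - 1) + k \<Longrightarrow> 0 < h i"
    "\<And>i z. i < (d - 1) + k \<Longrightarrow> z \<in> R i \<Longrightarrow> h i \<le> \<bar>fst z\<bar>"
    "\<And>i z. i < (d - 1) + k \<Longrightarrow> z \<in> R i \<Longrightarrow> lo i < snd z / fst z \<and> snd z / fst z < hi i"
    by metis
  have ord: "hi i \<le> lo j" if "i < j" for i j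
  proof -
    consider "j < d - 1" | "i < d - 1" "\<not> j < d - 1" | "\<not> i < d - 1" by blast
    then show ?thesis
    proof cases
      case 1
      have "real i + 1 \<le> real j" using that by linarith
      then show ?thesis using 1 that by (simp add: lo_def hi_def)
    next
      case 2
      have "real i + 1 \<le> real d - 1" using 2 by linarith
      then show ?thesis using 2 by (simp add: lo_def hi_def C_def B_def)
    next
      case 3
      have "real (i - (d - 1)) + 1 \<le> real (j - (d - 1))" using 3 that by linarith
      then show ?thesis using 3 that by (simp add: lo_def hi_def C_def)
    qed
  qed
  have dK: "degree ?K \<le> Suc d" using er(1) by (simp add: degree_step_poly)
  obtain w \<W>' where w: "0 < w" "wells (evalp (G + mono_xy 0 0 w * form_xy (Suc d) ?K)) \<W>'" "card \<W>' = card \<W> + ((d - 1) + k)"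
    by (rule wells_near_infinity[OF G W dK R]) (use ord in \<open>auto simp: neq_iff\<close>)
  let ?H = "G + mono_xy 0 0 w * form_xy (Suc d) ?K"
  have "top_form (Suc d) (mono_xy 0 0 w * form_xy (Suc d) ?K) = smult w (top_form (Suc d) (form_xy (Suc d) ?K))"
    by (rule poly_eqI) (simp add: coeff_top_form mono_xy_0_mult_coeff)
  then have t: "top_form (Suc d) ?H = smult w ?K"
    using top_form_eq_0[OF G, of "Suc d"] top_form_form_xy[OF dK] by (simp add: top_form_add)
  have b: "bidegree_less (Suc (Suc d)) ?H"
    using G by (intro bidegree_less_add bidegree_less_scale bidegree_less_form_xy) (auto elim: bidegree_less_mono)
  show thesis by (rule that[unfolded B_def[symmetric], OF b t _ _ w(2,3)]) (use w(1) \<eta>(1) in auto)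
qed

text \<open>The count (d - 1) (d - 2) / 2 is the number of bounded regions of d lines in general
  position. It grows by d - 1, the number of gaps, from d to d + 1. The condition on s keeps the
  zeros nonnegative, so that they move to the positive axis in the next step.\<close>

lemma line_arrangement_wells:
  assumes "1 \<le> d"
  shows "\<exists>G c s \<W>. bidegree_less (Suc d) G \<and> top_form d G = smult c (\<Prod>i<d. [:- (s + real i), 1:]) \<and> c \<noteq> 0 \<and> 0 \<le> s \<and>
     wells (evalp G) \<W> \<and> 2 * card \<W> + (d - 1) = (d - 1) * (d - 1)"
  using assms
proof (induction d rule: dec_induct)
  case base
  have "top_form 1 (mono_xy 1 0 1) = smult 1 (\<Prod>i<1. [:- (0 + real i), 1:])"
    by (simp add: top_form_mono_xy monom_Suc monom_0)
  then show ?case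
    by (intro exI[of _ "mono_xy 1 0 1"] exI[of _ 1] exI[of _ 0] exI[of _ "{}"])
      (simp add: bidegree_less_mono_xy wells_def)
next
  case (step d)
  then obtain G c s \<W> where G: "bidegree_less (Suc d) G" "top_form d G = smult c (\<Prod>i<d. [:- (s + real i), 1:])" "c \<noteq> 0" "0 \<le> s"
    "wells (evalp G) \<W>" "2 * card \<W> + (d - 1) = (d - 1) * (d - 1)" by blast
  obtain H \<epsilon> \<eta> \<W>' where H: "bidegree_less (Suc (Suc d)) H" "top_form (Suc d) H = smult \<epsilon> (step_poly (s + real d) 0 (Suc d) 0 \<eta>)"
    "\<epsilon> \<noteq> 0" "\<eta> \<noteq> 0" "wells (evalp H) \<W>'" "card \<W>' = card \<W> + ((d - 1) + 0)"
    by (rule chain_step[OF G(1) step.hyps(1) G(2,3,5), of 0 "Suc d" 0]) auto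
  have "step_poly (s + real d) 0 (Suc d) 0 \<eta> = (\<Prod>i<Suc d. [:- ((s + real d) + real i), 1:])"
    by (simp add: step_poly_def)
  moreover have "2 * card \<W>' + (Suc d - 1) = (Suc d - 1) * (Suc d - 1)"
  proof -
    obtain d' where "d = Suc d'" using step.hyps(1) by (cases d) auto
    then show ?thesis using G(6) H(6) by simp
  qed
  ultimately show ?case using H G(4)
    by (intro exI[of _ H] exI[of _ \<epsilon>] exI[of _ "s + real d"] exI[of _ \<W>']) simp
qed

text \<open>The final step uses the prescribed zeros instead of equidistant simple ones; the total
  is n (n - 1) / 2 + k, where 2 k = n + 1 - r - e.\<close>

lemma many_wells_equal_degrees:
  assumes n: "1 \<le> n" and er: "e + r + 2 * k = Suc n" "0 < e \<longrightarrow> 0 < r"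
  obtains H \<epsilon> \<eta> B \<W> where "bidegree_less (Suc (Suc n)) H" "top_form (Suc n) H = smult \<epsilon> (step_poly B e r k \<eta>)"
    "\<epsilon> \<noteq> 0" "\<eta> \<noteq> 0" "0 < B" "wells (evalp H) \<W>" "2 * card \<W> + n = n * n + 2 * k"
proof -
  obtain G c s \<W> where G: "bidegree_less (Suc n) G" "top_form n G = smult c (\<Prod>i<n. [:- (s + real i), 1:])" "c \<noteq> 0" "0 \<le> s"
    "wells (evalp G) \<W>" "2 * card \<W> + (n - 1) = (n - 1) * (n - 1)" using line_arrangement_wells[OF n] by blast
  obtain H \<epsilon> \<eta> \<W>' where H: "bidegree_less (Suc (Suc n)) H" "top_form (Suc n) H = smult \<epsilon> (step_poly (s + real n) e r k \<eta>)"
    "\<epsilon> \<noteq> 0" "\<eta> \<noteq> 0" "wells (evalp H) \<W>'" "card \<W>' = card \<W> + ((n - 1) + k)"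
    by (rule chain_step[OF G(1) n G(2,3,5) er])
  have "2 * card \<W>' + n = n * n + 2 * k"
  proof -
    obtain n' where "n = Suc n'" using n by (cases n) auto
    then show ?thesis using G(6) H(6) by simp
  qed
  then show thesis using that[of H \<epsilon> "s + real n" \<eta> \<W>'] H G(4) n by simp
qed

section \<open>Separated Hamiltonians\<close>

definition lift_y :: "real poly \<Rightarrow> poly_xy" where
  "lift_y p = map_poly (\<lambda>c. [:c:]) p"

lemma coeff_lift_y: "coeff (coeff (lift_y p) i) j = (if j = 0 then coeff p i else 0)"
  by (simp add: lift_y_def coeff_map_poly coeff_pCons split: nat.split)

lemma eval_lift_y: "eval_xy (lift_y p) x y = poly p y"
  by (induction p) (auto simp: lift_y_def map_poly_pCons eval_xy_pCons)

lemma eval_const_y: "eval_xy [:p:] x y = poly p x"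
  by (simp add: eval_xy_def)

lemma antiderivative_poly: "\<exists>q. pderiv q = (p :: real poly)"
proof (induction p)
  case 0
  then show ?case by (intro exI[of _ 0]) simp
next
  case (pCons a p)
  define q where "q = (\<Sum>i\<le>degree (pCons a p). monom (coeff (pCons a p) i / real (Suc i)) (Suc i))"
  have "pderiv q = pCons a p"
  proof (rule poly_eqI)
    fix i
    have "coeff q (Suc i) = (if i \<le> degree (pCons a p) then coeff (pCons a p) i / real (Suc i) else 0)"
      unfolding q_def coeff_sum by (simp add: if_distrib cong: if_cong)
    then show "coeff (pderiv q) i = coeff (pCons a p) i" by (auto simp: coeff_pderiv coeff_eq_0 simp del: coeff_pCons_Suc of_nat_Suc)
  qed
  then show ?case by blast
qed

lemma pderiv_consecutive_roots_sign:
  "i < m \<Longrightarrow> 0 < (-1) ^ (m + i + 1) * poly (pderiv (\<Prod>l<m. [:- real l, 1:])) (real i)"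
proof (induction m)
  case 0
  then show ?case by simp
next
  case (Suc m)
  let ?q = "\<Prod>l<m. [:- real l, 1:]"
  have d: "poly (pderiv (\<Prod>l<Suc m. [:- real l, 1:])) x = poly (pderiv ?q) x * (x - real m) + poly ?q x" for x
  proof -
    have "pderiv [:- real m, 1:] = 1" by (simp add: pderiv_pCons)
    then show ?thesis
      unfolding prod.lessThan_Suc pderiv_mult by (simp only: poly_add poly_mult poly_linear_factor poly_1) (simp add: algebra_simps)
  qed
  show ?case
  proof (cases "i = m")
    case True
    have "0 < poly ?q (real m)" unfolding poly_prod poly_linear_factor by (rule prod_pos) auto
    moreover have "even (Suc m + i + 1)" using True by simp
    ultimately show ?thesis unfolding d using True by simp
  next
    case False
    then have i: "i < m" using Suc.prems by simp
    then have "poly ?q (real i) = 0" by (simp add: poly_prod)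
    then have eq: "(-1) ^ (Suc m + i + 1) * poly (pderiv (\<Prod>l<Suc m. [:- real l, 1:])) (real i)
      = ((-1) ^ (m + i + 1) * poly (pderiv ?q) (real i)) * (real m - real i)" unfolding d by (simp add: algebra_simps)
    show ?thesis unfolding eq using i by (intro mult_pos_pos Suc.IH) auto
  qed
qed

text \<open>On a checkerboard the colour of the corner (0, 0) takes up at least half of the
  squares.\<close>

lemma card_even_pairs:
  "n * m \<le> 2 * card {(i, j). i < m \<and> j < n \<and> even (i + j :: nat)}"
proof -
  have row: "2 * card {j. j < n \<and> even (i + j)} = (if odd n then (if even i then n + 1 else n - 1) else n)" for i
  proof (induction n)
    case 0
    then show ?case by simp
  next
    case (Suc n)
    have "{j. j < Suc n \<and> even (i + j)} = (if even (i + n) then insert n {j. j < n \<and> even (i + j)} else {j. j < n \<and> even (i + j)})"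
      by (auto simp: less_Suc_eq)
    then show ?case using Suc by (auto split: if_splits)
  qed
  have "{(i, j). i < m \<and> j < n \<and> even (i + j)} = Sigma {..<m} (\<lambda>i. {j. j < n \<and> even (i + j)})" by auto
  then have "2 * card {(i, j). i < m \<and> j < n \<and> even (i + j)} = (\<Sum>i<m. 2 * card {j. j < n \<and> even (i + j)})"
    by (simp add: sum_distrib_left)
  also have "\<dots> = (\<Sum>i<m. if odd n then (if even i then n + 1 else n - 1) else n)" by (simp only: row)
  also have "\<dots> = n * m + (if odd n \<and> odd m then 1 else 0)"
    by (induction m) (auto elim: oddE)
  finally show ?thesis by simp
qed

text \<open>For A(x) + B(y) with integer critical abscissas and ordinates the critical points form
  an m by n grid. The Hessian determinant is A'' B'', whose sign alternates like a checkerboard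
  because second derivatives alternate at consecutive zeros.\<close>

lemma many_critical_points_unequal_degrees:
  assumes m: "1 \<le> m" "m < n"
  obtains H Z where "total_degree H = n + 1" "total_degree (deriv_x H) = m" "total_degree (deriv_y H) = n"
    "finite Z" "n * m \<le> 2 * card Z" "\<And>z. z \<in> Z \<Longrightarrow> evalp (deriv_x H) z = 0" "\<And>z. z \<in> Z \<Longrightarrow> evalp (deriv_y H) z = 0"
    "\<And>z. z \<in> Z \<Longrightarrow> 0 < hess H z"
proof -
  define q where "q k = (\<Prod>l<k. [:- real l, 1:])" for k
  have dq: "degree (q k) = k" for k by (simp add: q_def degree_prod_eq_sum_degree)
  have lq: "coeff (q k) k = 1" for k
  proof -
    have "lead_coeff (q k) = 1" unfolding q_def lead_coeff_prod by simp
    then show ?thesis by (simp add: dq)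
  qed
  have rq: "poly (q k) (real i) = 0" if "i < k" for i k
    unfolding q_def by (simp add: poly_prod) (use that in blast)
  \<comment> \<open>This sign makes the points with i + j even the extrema, that is the colour with
    at least half of the points.\<close>
  define b :: real where "b = (-1) ^ (n + m)"
  have b0: "b \<noteq> 0" by (simp add: b_def)
  obtain A where A: "pderiv A = q m" using antiderivative_poly by blast
  obtain B where B: "pderiv B = smult b (q n)" using antiderivative_poly by blast
  define H where "H = [:A:] + lift_y B"
  have dx: "deriv_x H = [:q m:]"
  proof (intro poly_eqI)
    fix i j
    show "coeff (coeff (deriv_x H) i) j = coeff (coeff [:q m:] i) j"
      by (simp add: H_def coeff_deriv_x coeff_lift_y coeff_pCons A[symmetric] coeff_pderiv split: nat.split)
  qed
  have dy: "deriv_y H = lift_y (smult b (q n))"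
    by (intro poly_eqI) (simp add: H_def coeff_deriv_y coeff_lift_y B[symmetric] coeff_pderiv)
  have dxx: "deriv_x (deriv_x H) = [:pderiv (q m):]"
    unfolding dx by (intro poly_eqI) (simp add: coeff_deriv_x coeff_pCons coeff_pderiv split: nat.split)
  have dxy: "deriv_x (deriv_y H) = 0"
    unfolding dy by (intro poly_eqI) (simp add: coeff_deriv_x coeff_lift_y)
  have dyy: "deriv_y (deriv_y H) = lift_y (smult b (pderiv (q n)))"
    unfolding dy by (intro poly_eqI) (simp add: coeff_deriv_y coeff_lift_y coeff_pderiv)
  have tx: "total_degree (deriv_x H) = m"
    unfolding dx
    by (rule total_degree_eqI[where i = 0 and j = m]) (auto simp: bidegree_less_def coeff_pCons lq dq coeff_eq_0 split: nat.split)
  have ty: "total_degree (deriv_y H) = n"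
    unfolding dy using b0
    by (intro total_degree_eqI[where i = n and j = 0]) (auto simp: bidegree_less_def coeff_lift_y lq dq coeff_eq_0)
  have cA: "coeff A (Suc j) = coeff (q m) j / real (Suc j)" for j
    using arg_cong[OF A, of "\<lambda>p. coeff p j"] by (simp add: coeff_pderiv field_simps del: of_nat_Suc)
  have cB: "coeff B (Suc j) = b * coeff (q n) j / real (Suc j)" for j
    using arg_cong[OF B, of "\<lambda>p. coeff p j"] by (simp add: coeff_pderiv field_simps del: of_nat_Suc)
  have A0: "coeff A j = 0" if "n + 1 < j" for j using that m by (cases j) (auto simp: cA coeff_eq_0 dq)
  have B0: "coeff B j = 0" if "n + 1 < j" for j using that by (cases j) (auto simp: cB coeff_eq_0 dq)
  have tH: "total_degree H = n + 1"
  proof (rule total_degree_eqI[where i = "n + 1" and j = 0])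
    show "bidegree_less (Suc (n + 1)) H"
      by (auto simp: bidegree_less_def H_def coeff_lift_y coeff_pCons A0 B0 split: nat.split)
    show "coeff (coeff H (n + 1)) 0 \<noteq> 0" using b0 by (simp add: H_def coeff_lift_y cB lq)
  qed simp
  define Z where "Z = (\<lambda>(i, j). (real i, real j)) ` {(i, j). i < m \<and> j < n \<and> even (i + j)}"
  have "inj_on (\<lambda>(i, j). (real i, real j)) {(i, j). i < m \<and> j < n \<and> even (i + j)}" by (auto simp: inj_on_def)
  then have cZ: "card Z = card {(i, j). i < m \<and> j < n \<and> even (i + j)}" unfolding Z_def by (rule card_image)
  have "finite {(i, j). i < m \<and> j < n \<and> even (i + j)}" by (rule finite_subset[of _ "{..<m} \<times> {..<n}"]) auto
  then have finZ: "finite Z" by (simp add: Z_def)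
  have hs: "0 < hess H z" if zZ: "z \<in> Z" for z
  proof -
    obtain i j where z: "z = (real i, real j)" "i < m" "j < n" "even (i + j)" using zZ by (auto simp: Z_def)
    let ?a = "poly (pderiv (q m)) (real i)" and ?c = "poly (pderiv (q n)) (real j)"
    have h1: "hess H z = b * (?a * ?c)" by (simp add: hess_def dxx dxy dyy eval_const_y eval_lift_y z(1))
    have h2: "0 < ((-1) ^ (m + i + 1) * ?a) * ((-1) ^ (n + j + 1) * ?c)"
      using pderiv_consecutive_roots_sign[OF z(2)] pderiv_consecutive_roots_sign[OF z(3)] unfolding q_def by (rule mult_pos_pos)
    have h3: "((-1) ^ (m + i + 1) * ?a) * ((-1) ^ (n + j + 1) * ?c) = b * (?a * ?c)"
    proof -
      have "(-1::real) ^ (m + i + 1) * (-1) ^ (n + j + 1) = (-1) ^ (n + m + (i + j) + 2)" by (simp flip: power_add add: ac_simps)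
      also have "\<dots> = (-1) ^ (n + m) * (-1) ^ (i + j) * (-1) ^ 2" by (simp only: power_add)
      also have "(-1::real) ^ (i + j) = 1" using z(4) by (simp only: minus_one_power_iff if_True)
      also have "(-1) ^ (n + m) * 1 * (-1) ^ 2 = b" by (simp add: b_def)
      finally have e: "(-1::real) ^ (m + i + 1) * (-1) ^ (n + j + 1) = b" .
      have "((-1) ^ (m + i + 1) * ?a) * ((-1) ^ (n + j + 1) * ?c) = ((-1) ^ (m + i + 1) * (-1) ^ (n + j + 1)) * (?a * ?c)" by (simp only: mult_ac)
      then show ?thesis unfolding e .
    qed
    show ?thesis using h2 unfolding h1 h3 .
  qed
  show thesis
  proof (rule that[OF tH tx ty finZ _ _ _ hs])
    show "n * m \<le> 2 * card Z" unfolding cZ by (rule card_even_pairs)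
    show "evalp (deriv_x H) z = 0" "evalp (deriv_y H) z = 0" if "z \<in> Z" for z
      using that by (auto simp: Z_def dx dy eval_const_y eval_lift_y rq)
  qed
qed

section \<open>Infinite critical points and the main theorem\<close>

lemma homogeneous_part_x0: "homogeneous_part n p 0 v = coeff (coeff p n) 0 * v ^ n"
proof -
  have "homogeneous_part n p 0 v = (\<Sum>i\<le>n. if i = n then coeff (coeff p n) 0 * v ^ n else 0)"
    unfolding homogeneous_part_def by (intro sum.cong refl) (auto simp: power_0_left)
  then show ?thesis by simp
qed

text \<open>Euler's identity again: on leading forms y H_y + x H_x is (n + 1) times the leading form
  of \<open>H\<close>. The direction x = 0 is treated apart because it is invisible in the affine
  coordinate.\<close>

lemma hamiltonian_equator:
  fixes H :: poly_xy and n :: nat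
  defines "P \<equiv> top_form (Suc n) H"
  shows "- v * homogeneous_part n (- deriv_y H) u v + u * homogeneous_part n (deriv_x H) u v
    = real (Suc n) * (if u = 0 then coeff P (Suc n) * v ^ Suc n else u ^ Suc n * poly P (v / u))"
proof (cases "u = 0")
  case True
  then show ?thesis
    by (simp add: homogeneous_part_x0 coeff_deriv_y P_def coeff_top_form algebra_simps)
next
  case False
  have v: "v = (v / u) * u" using False by simp
  have "homogeneous_part n (- deriv_y H) u v = u ^ n * (- poly (pderiv P) (v / u))"
    using False by (simp add: homogeneous_part_eq top_form_minus top_form_deriv_y P_def)
  moreover have "homogeneous_part n (deriv_x H) u v = u ^ n * (real (Suc n) * poly P (v / u) - (v / u) * poly (pderiv P) (v / u))"
    using False by (simp add: homogeneous_part_eq top_form_deriv_x P_def)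
  moreover have "- v * (u ^ n * (- D)) + u * (u ^ n * (c * p - (v / u) * D)) = c * (u ^ Suc n * p)" for D c p
    using False by (simp add: algebra_simps)
  ultimately show ?thesis using False by (simp only: if_False)
qed

text \<open>Every zero t of the leading form gives the antipodal pair in the direction (1, t); a
  deficit in degree means a zero at infinity and gives the pair in the direction x = 0.\<close>

lemma card_infinite_critical_points:
  assumes deg: "vf_degree (hamiltonian_vf H) = n" and P: "top_form (Suc n) H \<noteq> 0"
  shows "finite (infinite_critical_points (hamiltonian_vf H)) \<and>
    card (infinite_critical_points (hamiltonian_vf H)) =
      2 * (card {t. poly (top_form (Suc n) H) t = 0} + (if degree (top_form (Suc n) H) < Suc n then 1 else 0))"
proof -
  define P where "P = top_form (Suc n) H"
  define Z where "Z = {t. poly P t = 0}"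
  have finZ: "finite Z" unfolding Z_def using P by (intro poly_roots_finite) (simp add: P_def)
  define f where "f = (\<lambda>(t, \<sigma>). (\<sigma> / sqrt (1 + t\<^sup>2), \<sigma> * t / sqrt (1 + t\<^sup>2), 0 :: real))"
  define S where "S = (if degree P < Suc n then {(0, 1, 0), (0, -1, 0)} else {} :: (real \<times> real \<times> real) set)"
  have I: "infinite_critical_points (hamiltonian_vf H) =
     {(u, v, w). u\<^sup>2 + v\<^sup>2 = 1 \<and> w = 0 \<and> (if u = 0 then coeff P (Suc n) * v ^ Suc n else u ^ Suc n * poly P (v / u)) = 0}"
    using hamiltonian_equator[of _ n H] unfolding infinite_critical_points_eq deg P_def
    by (simp add: hamiltonian_vf_def del: of_nat_Suc)
  have low: "degree P < Suc n \<longleftrightarrow> coeff P (Suc n) = 0"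
  proof
    assume "coeff P (Suc n) = 0"
    then have "degree P \<noteq> Suc n" using P by (metis P_def leading_coeff_0_iff)
    then show "degree P < Suc n" using degree_top_form[of "Suc n" H] by (simp add: P_def)
  qed (rule coeff_eq_0)
  have sq: "0 < sqrt (1 + t\<^sup>2)" "(sqrt (1 + t\<^sup>2))\<^sup>2 = 1 + t\<^sup>2" for t :: real
    by (auto simp: add_pos_nonneg)
  have "infinite_critical_points (hamiltonian_vf H) = f ` (Z \<times> {1, -1}) \<union> S"
  proof (intro equalityI subsetI)
    fix x assume x: "x \<in> infinite_critical_points (hamiltonian_vf H)"
    obtain u v where uv: "x = (u, v, 0)" "u\<^sup>2 + v\<^sup>2 = 1"
      "(if u = 0 then coeff P (Suc n) * v ^ Suc n else u ^ Suc n * poly P (v / u)) = 0"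
      using x unfolding I by blast
    show "x \<in> f ` (Z \<times> {1, -1}) \<union> S"
    proof (cases "u = 0")
      case True
      then have "v\<^sup>2 = 1" using uv by simp
      then have "v = 1 \<or> v = -1" by (simp add: power2_eq_1_iff)
      moreover from this have "coeff P (Suc n) = 0" using uv(3) True by auto
      ultimately show ?thesis using True uv(1) low by (auto simp: S_def)
    next
      case False
      define t where "t = v / u"
      have t: "t \<in> Z" using uv(3) False by (simp add: Z_def t_def)
      have "1 + t\<^sup>2 = (1 / \<bar>u\<bar>)\<^sup>2" using uv(2) False by (simp add: t_def field_simps)
      then have "sqrt (1 + t\<^sup>2) = 1 / \<bar>u\<bar>" by (simp add: real_sqrt_unique)
      then have "f (t, sgn u) = x" using False uv(1) by (simp add: f_def t_def sgn_if abs_if)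
      moreover have "sgn u \<in> {1, -1}" using False by (simp add: sgn_if)
      ultimately show ?thesis using t by blast
    qed
  next
    fix x assume "x \<in> f ` (Z \<times> {1, -1}) \<union> S"
    then consider t \<sigma> where "t \<in> Z" "\<sigma> \<in> {1, -1}" "x = f (t, \<sigma>)" | "x \<in> S" by auto
    then show "x \<in> infinite_critical_points (hamiltonian_vf H)"
    proof cases
      case (1 t \<sigma>)
      have s2: "\<sigma>\<^sup>2 = 1" "\<sigma> \<noteq> 0" using 1(2) by auto
      have "(\<sigma> / sqrt (1 + t\<^sup>2))\<^sup>2 + (\<sigma> * t / sqrt (1 + t\<^sup>2))\<^sup>2 = (1 + t\<^sup>2) / (1 + t\<^sup>2)"
        unfolding power_divide power_mult_distrib sq(2) s2(1) by (simp only: mult_1_left add_divide_distrib)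
      also have "\<dots> = 1" using sq(2)[of t] sq(1)[of t] by (metis divide_self_if less_irrefl power_zero_numeral zero_eq_power2)
      finally have n1: "(\<sigma> / sqrt (1 + t\<^sup>2))\<^sup>2 + (\<sigma> * t / sqrt (1 + t\<^sup>2))\<^sup>2 = 1" .
      have "\<sigma> / sqrt (1 + t\<^sup>2) \<noteq> 0" "(\<sigma> * t / sqrt (1 + t\<^sup>2)) / (\<sigma> / sqrt (1 + t\<^sup>2)) = t"
        using sq(1)[of t] s2(2) by (auto simp: less_imp_neq[symmetric])
      then show ?thesis unfolding I 1(3) f_def using n1 1(1) by (simp add: Z_def)
    next
      case 2
      then show ?thesis using low unfolding I S_def by (auto split: if_splits)
    qed
  qed
  moreover have "card (f ` (Z \<times> {1, -1}) \<union> S) = card (f ` (Z \<times> {1, -1})) + card S"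
  proof (rule card_Un_disjoint)
    show "f ` (Z \<times> {1, -1}) \<inter> S = {}"
      using sq(1) by (auto simp: f_def S_def split: if_splits)
  qed (use finZ in \<open>auto simp: S_def\<close>)
  moreover have "card (f ` (Z \<times> {1, -1})) = card (Z \<times> {1, -1 :: real})"
  proof (rule card_image, rule inj_onI, clarify)
    fix t \<sigma> t' \<sigma>' assume s: "\<sigma> \<in> {1, -1 :: real}" "\<sigma>' \<in> {1, -1}" "f (t, \<sigma>) = f (t', \<sigma>')"
    have e: "\<sigma> / sqrt (1 + t\<^sup>2) = \<sigma>' / sqrt (1 + t'\<^sup>2)" "\<sigma> * t / sqrt (1 + t\<^sup>2) = \<sigma>' * t' / sqrt (1 + t'\<^sup>2)"
      using s(3) by (auto simp: f_def)
    have nz: "\<sigma> / sqrt (1 + t\<^sup>2) \<noteq> 0" using s(1) sq(1)[of t] by (auto simp: less_imp_neq[symmetric])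
    have "t * (\<sigma> / sqrt (1 + t\<^sup>2)) = t' * (\<sigma>' / sqrt (1 + t'\<^sup>2))" using e(2) by (simp add: mult.commute)
    then have tt: "t = t'" using nz unfolding e(1)[symmetric] by simp
    then have "\<sigma> = \<sigma>'" using e(1) sq(1)[of t] by (simp add: less_imp_neq[symmetric])
    then show "t = t' \<and> \<sigma> = \<sigma>'" using tt by simp
  qed
  ultimately show ?thesis using finZ unfolding P_def[symmetric] Z_def[symmetric]
    by (auto simp: card_cartesian_product S_def)
qed

lemma total_degree_minus: "total_degree (- p) = total_degree p"
  by (simp add: total_degree_def)

lemma top_form_nonzero:
  assumes "i + j = d" "coeff (coeff p i) j \<noteq> 0"
  shows "top_form d p \<noteq> 0"
proof -
  have "coeff (top_form d p) i = coeff (coeff p i) j" using assms(1) by (auto simp: coeff_top_form)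
  then show ?thesis using assms(2) by auto
qed

lemma hamiltonian_fields_cases:
  assumes "X \<in> hamiltonian_fields n m r" "m \<le> n"
  obtains H where "X = hamiltonian_vf H" "bidegree_less (Suc (Suc n)) H" "bidegree_less (Suc n) (deriv_y H)"
    "bidegree_less (Suc m) (deriv_x H)" "top_form (Suc n) H \<noteq> 0"
    "r = card {t. poly (top_form (Suc n) H) t = 0} + (if degree (top_form (Suc n) H) < Suc n then 1 else 0)"
proof -
  obtain H where H: "total_degree H = n + 1" "X = hamiltonian_vf H" using assms(1) by (auto simp: hamiltonian_fields_def)
  have d: "total_degree (deriv_y H) = n" "total_degree (deriv_x H) = m"
    using assms(1) H(2) by (auto simp: hamiltonian_fields_def fields_of_degrees_def hamiltonian_vf_def total_degree_minus)
  have vd: "vf_degree (hamiltonian_vf H) = n"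
    using d assms(2) by (simp add: vf_degree_def hamiltonian_vf_def total_degree_minus)
  obtain i j where ij: "i + j = Suc n" "coeff (coeff H i) j \<noteq> 0" using total_degree_top[of H n] H(1) by auto
  then have P: "top_form (Suc n) H \<noteq> 0" by (rule top_form_nonzero)
  have "card (infinite_critical_points X) = 2 * r" using assms(1) by (simp add: hamiltonian_fields_def)
  then have "r = card {t. poly (top_form (Suc n) H) t = 0} + (if degree (top_form (Suc n) H) < Suc n then 1 else 0)"
    using card_infinite_critical_points[OF vd P] H(2) by simp
  then show thesis using that[OF H(2)] bidegree_less_total_degree[of H] bidegree_less_total_degree[of "deriv_y H"]
      bidegree_less_total_degree[of "deriv_x H"] d H(1) P by simp
qed

lemma linear_perturbation:
  fixes a b :: real
  defines "L \<equiv> mono_xy 0 1 a + mono_xy 1 0 b"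
  shows "bidegree_less 2 L" "deriv_x (H + L) = deriv_x H + mono_xy 0 0 a" "deriv_y (H + L) = deriv_y H + mono_xy 0 0 b"
proof -
  show "bidegree_less 2 L" unfolding L_def by (intro bidegree_less_add bidegree_less_mono_xy) auto
  have "mono_xy i j 0 = 0" for i j by (simp add: mono_xy_def)
  then show "deriv_x (H + L) = deriv_x H + mono_xy 0 0 a" "deriv_y (H + L) = deriv_y H + mono_xy 0 0 b"
    by (simp_all add: L_def deriv_x_add deriv_y_add deriv_x_mono_xy deriv_y_mono_xy)
qed

lemma form_xy_add: "form_xy d (p + q) = form_xy d p + form_xy d q"
  by (simp add: form_xy_def mono_xy_def add_monom[symmetric] sum.distrib)

lemma form_xy_smult: "eval_xy (form_xy d (smult c p)) x y = c * eval_xy (form_xy d p) x y"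
  by (simp add: eval_form_xy sum_distrib_left mult_ac)

lemma wells_stable_at_right:
  assumes "wells (evalp H) \<W>"
  shows "\<forall>\<^sub>F e in at_right 0. wells (\<lambda>z. evalp H z + e * evalp L z) \<W>"
proof -
  have "continuous_on UNIV (\<lambda>p. evalp H (snd p) + fst p * evalp L (snd p))" by (intro continuous_intros)
  then have "\<forall>\<^sub>F e in nhds 0. wells (\<lambda>z. evalp H z + e * evalp L z) \<W>"
    using wells_stable[of "\<lambda>e z. evalp H z + e * evalp L z" 0] assms by simp
  then show ?thesis by (rule filter_leD[rotated]) (simp add: at_within_le_nhds)
qed

text \<open>Replacing the leading form by a squarefree one of full degree costs neither wells nor
  real zeros, the zero in the direction x = 0 becoming a finite one. A linear perturbation then
  leads to nondegenerate extrema.\<close>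

lemma centers_bound_equal:
  assumes X: "X \<in> hamiltonian_fields n n r" and n: "1 \<le> n" and C: "finite C" "C \<subseteq> centers X"
  shows "2 * card C + r \<le> n * n + 1"
proof -
  obtain H where H: "X = hamiltonian_vf H" "bidegree_less (Suc (Suc n)) H" "top_form (Suc n) H \<noteq> 0"
    "r = card {t. poly (top_form (Suc n) H) t = 0} + (if degree (top_form (Suc n) H) < Suc n then 1 else 0)"
    using hamiltonian_fields_cases[OF X order_refl] by metis
  let ?P = "top_form (Suc n) H"
  obtain \<W> where W: "wells (evalp H) \<W>" "card \<W> = card C" using finite_centers_wells[OF C(1)] C(2) H(1) by metis
  \<comment> \<open>Exchanges the leading form for \<open>p\<close> and leaves all terms of lower
    degree in place.\<close>
  define H1 where "H1 p = H + form_xy (Suc n) (p - ?P)" for p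
  have zero: "form_xy (Suc n) 0 = 0" by (simp add: form_xy_def mono_xy_def)
  obtain p where p: "wells (evalp (H1 p)) \<W>" "degree p = Suc n" "rsquarefree (cpoly p)" "r \<le> card {t. poly p t = 0}"
  proof (rule perturb_to_squarefree[where P = ?P and N = "Suc n" and S = "\<lambda>p. wells (evalp (H1 p)) \<W>"])
    show "?P \<noteq> 0" "degree ?P \<le> Suc n" by (simp_all add: H(3) degree_top_form)
    show "wells (evalp (H1 ?P)) \<W>" using W(1) by (simp add: H1_def zero)
    fix p L assume S: "wells (evalp (H1 p)) \<W>"
    have "evalp (H1 (p + smult e L)) = (\<lambda>z. evalp (H1 p) z + e * evalp (form_xy (Suc n) L) z)" for e
    proof
      fix z
      have "p + smult e L - ?P = (p - ?P) + smult e L" by simp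
      then show "evalp (H1 (p + smult e L)) z = evalp (H1 p) z + e * evalp (form_xy (Suc n) L) z"
        unfolding H1_def by (simp only: form_xy_add eval_xy_add form_xy_smult add.assoc)
    qed
    then show "\<forall>\<^sub>F e in at_right 0. wells (evalp (H1 (p + smult e L))) \<W>"
      using wells_stable_at_right[OF S, of "form_xy (Suc n) L"] by simp
  qed (use n H(4) in auto)
  obtain a b Z where Z: "finite Z" "card Z = card \<W>"
    "\<And>z. z \<in> Z \<Longrightarrow> evalp (deriv_x (H1 p + (mono_xy 0 1 a + mono_xy 1 0 b))) z = 0"
    "\<And>z. z \<in> Z \<Longrightarrow> evalp (deriv_y (H1 p + (mono_xy 0 1 a + mono_xy 1 0 b))) z = 0"
    "\<And>z. z \<in> Z \<Longrightarrow> 0 < hess (H1 p + (mono_xy 0 1 a + mono_xy 1 0 b)) z"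
    by (rule wells_nondegenerate_critical_points[OF p(1)], rule that)
  define H2 where "H2 = H1 p + (mono_xy 0 1 a + mono_xy 1 0 b)"
  have t: "top_form (Suc n) H2 = p"
  proof -
    have "degree (p - ?P) \<le> Suc n" using p(2) degree_top_form[of "Suc n" H] by (intro degree_diff_le) auto
    moreover have "top_form (Suc n) (mono_xy 0 1 a + mono_xy 1 0 b) = 0"
      using linear_perturbation(1) n by (intro top_form_eq_0) auto
    ultimately show ?thesis by (simp add: H2_def H1_def top_form_add[of _ "H + _"] top_form_add[of _ H] top_form_form_xy)
  qed
  have bd: "bidegree_less (Suc (Suc n)) H2" unfolding H2_def H1_def
    using H(2) linear_perturbation(1)[of a b] by (intro bidegree_less_add[of _ "H + _"] bidegree_less_add[of _ H] bidegree_less_form_xy) (auto elim: bidegree_less_mono)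
  have "2 * card Z + card {t. poly (top_form (Suc n) H2) t = 0} \<le> n * n + 1"
    by (rule extrema_bound_equal[OF bd n _ _ Z(1) Z(3-5)[folded H2_def]]) (simp_all only: t p(2,3))
  then show ?thesis using p(4) Z(2) W(2) unfolding t by simp
qed

text \<open>\<open>H_x\<close> has no part of degree n, so Euler's identity leaves t P' = (n + 1) P,
  which only multiples of t^(n + 1) satisfy.\<close>

lemma top_form_unequal_degrees:
  assumes "bidegree_less (Suc m) (deriv_x H)" "m < n" "top_form (Suc n) H \<noteq> 0"
  obtains a where "a \<noteq> 0" "top_form (Suc n) H = monom a (Suc n)"
proof -
  let ?P = "top_form (Suc n) H"
  have "top_form n (deriv_x H) = 0" using assms(1,2) by (intro top_form_eq_0) auto
  then have e: "smult (of_nat (Suc n)) ?P = pCons 0 (pderiv ?P)" by (simp add: top_form_deriv_x)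
  have c: "coeff ?P i = 0" if "i \<noteq> Suc n" for i
  proof -
    have "of_nat (Suc n) * coeff ?P i = of_nat i * coeff ?P i"
      using arg_cong[OF e, of "\<lambda>p. coeff p i"] by (cases i) (auto simp: coeff_pderiv simp del: of_nat_Suc)
    then show ?thesis using that by (simp del: of_nat_Suc)
  qed
  have eq: "?P = monom (coeff ?P (Suc n)) (Suc n)" by (rule poly_eqI) (use c in simp)
  then have "coeff ?P (Suc n) \<noteq> 0" using assms(3) by (metis monom_eq_0)
  then show thesis using that eq by blast
qed

lemma centers_bound_greater:
  assumes X: "X \<in> hamiltonian_fields n m r" and m: "1 \<le> m" "m < n" and C: "finite C" "C \<subseteq> centers X"
  shows "2 * card C \<le> n * m + 1"
proof -
  obtain H where H: "X = hamiltonian_vf H" "bidegree_less (Suc n) (deriv_y H)" "bidegree_less (Suc m) (deriv_x H)" "top_form (Suc n) H \<noteq> 0"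
    using hamiltonian_fields_cases[OF X less_imp_le[OF m(2)]] by metis
  obtain \<W> where W: "wells (evalp H) \<W>" "card \<W> = card C" using finite_centers_wells[OF C(1)] C(2) H(1) by metis
  obtain c where c: "c \<noteq> 0" "top_form (Suc n) H = monom c (Suc n)" using top_form_unequal_degrees[OF H(3) m(2) H(4)] by blast
  \<comment> \<open>Since m + 1 <= n, this changes neither the leading form y^(n + 1) nor the bound
    m for the degree of \<open>H_x\<close>. It makes the coefficient of x^m in \<open>H_x\<close>
    nonzero, so that the leading forms of the derivatives become coprime.\<close>
  define H1 where "H1 e = H + mono_xy 0 (Suc m) e" for e
  have "\<forall>\<^sub>F e in at_right 0. wells (\<lambda>z. evalp H z + e * evalp (mono_xy 0 (Suc m) 1) z) \<W>"
    using W(1) by (rule wells_stable_at_right)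
  moreover have "\<forall>\<^sub>F e in at_right 0. e \<noteq> - coeff (coeff H 0) (Suc m)" by (rule eventually_neq_at_within)
  ultimately have "\<forall>\<^sub>F e in at_right 0. wells (evalp (H1 e)) \<W> \<and> coeff (coeff (H1 e) 0) (Suc m) \<noteq> 0"
    by eventually_elim (auto simp: H1_def eval_xy_add eval_xy_mono coeff_mono_xy add_eq_0_iff)
  then obtain e where e: "wells (evalp (H1 e)) \<W>" "coeff (coeff (H1 e) 0) (Suc m) \<noteq> 0" by (rule eventually_at_right_witness) auto
  obtain a b Z where Z: "finite Z" "card Z = card \<W>"
    "\<And>z. z \<in> Z \<Longrightarrow> evalp (deriv_x (H1 e + (mono_xy 0 1 a + mono_xy 1 0 b))) z = 0"
    "\<And>z. z \<in> Z \<Longrightarrow> evalp (deriv_y (H1 e + (mono_xy 0 1 a + mono_xy 1 0 b))) z = 0"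
    "\<And>z. z \<in> Z \<Longrightarrow> 0 < hess (H1 e + (mono_xy 0 1 a + mono_xy 1 0 b)) z"
    by (rule wells_nondegenerate_critical_points[OF e(1)], rule that)
  define H2 where "H2 = H1 e + (mono_xy 0 1 a + mono_xy 1 0 b)"
  have dx: "deriv_x H2 = deriv_x H + mono_xy 0 m (real (Suc m) * e) + mono_xy 0 0 a"
    unfolding H2_def linear_perturbation by (simp add: H1_def deriv_x_add deriv_x_mono_xy)
  have dy: "deriv_y H2 = deriv_y H + mono_xy 0 0 b"
    unfolding H2_def linear_perturbation by (simp add: H1_def deriv_y_add deriv_y_mono_xy) (simp add: mono_xy_def)
  have "2 * card Z \<le> n * m + 1"
  proof (rule extrema_bound_greater[where H = H2 and l = "real (Suc n) * c"])
    show "1 \<le> m" "m \<le> n" using m by auto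
    show "bidegree_less (Suc n) (deriv_y H2)" unfolding dy using H(2) by (intro bidegree_less_add bidegree_less_mono_xy) auto
    show "bidegree_less (Suc m) (deriv_x H2)" unfolding dx using H(3) by (intro bidegree_less_add bidegree_less_mono_xy) auto
    have "top_form n (deriv_y H2) = top_form n (deriv_y H)" unfolding dy top_form_add using m by (simp add: top_form_mono_xy)
    also have "\<dots> = monom (real (Suc n) * c) n" by (simp add: top_form_deriv_y c(2) pderiv_monom del: of_nat_Suc)
    finally show "top_form n (deriv_y H2) = monom (real (Suc n) * c) n" .
    show "real (Suc n) * c \<noteq> 0" using c(1) by (simp del: of_nat_Suc)
    have "coeff (top_form m (deriv_x H2)) 0 = real (Suc m) * coeff (coeff (H1 e) 0) (Suc m)"
      unfolding dx using m by (simp add: coeff_top_form coeff_deriv_x coeff_mono_xy H1_def algebra_simps)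
    then show "coeff (top_form m (deriv_x H2)) 0 \<noteq> 0" using e(2) by (simp del: of_nat_Suc)
    show "finite Z" by (rule Z(1))
    show "evalp (deriv_x H2) z = 0" "evalp (deriv_y H2) z = 0" "0 < hess H2 z" if "z \<in> Z" for z
      using Z(3-5)[OF that] unfolding H2_def .
  qed
  then show ?thesis using Z(2) W(2) by simp
qed

section \<open>Realization of the bounds\<close>

lemma odd_degree_real_root:
  assumes "odd (degree p)"
  shows "\<exists>x :: real. poly p x = 0"
proof -
  have p0: "p \<noteq> 0" using assms by auto
  define q where "q = pcompose p [:0, -1:]"
  have lq: "lead_coeff q = - lead_coeff p" unfolding q_def using assms by (subst lead_coeff_comp) auto
  then have q0: "q \<noteq> 0" using p0 by auto
  obtain a where a: "\<forall>x\<ge>a. 0 < lead_coeff p * poly p x" using poly_sign_at_top[OF p0] by blast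
  obtain b where b: "\<forall>x\<ge>b. 0 < lead_coeff q * poly q x" using poly_sign_at_top[OF q0] by blast
  define x where "x = max 1 (max a b)"
  have 1: "0 < lead_coeff p * poly p x" using a by (simp add: x_def)
  have "0 < lead_coeff q * poly q x" using b by (simp add: x_def)
  then have 2: "lead_coeff p * poly p (- x) < 0" unfolding lq by (simp add: q_def poly_pcompose)
  have "poly p (- x) * poly p x < 0" using 1 2 by (auto simp: zero_less_mult_iff mult_less_0_iff)
  moreover have "- x < x" by (simp add: x_def)
  ultimately show ?thesis using poly_IVT[of "- x" x p] by blast
qed

lemma hamiltonian_fieldsI:
  assumes "total_degree H = n + 1" "total_degree (deriv_x H) = m" "total_degree (deriv_y H) = n" "m \<le> n" "top_form (Suc n) H \<noteq> 0"
    "r = card {t. poly (top_form (Suc n) H) t = 0} + (if degree (top_form (Suc n) H) < Suc n then 1 else 0)"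
  shows "hamiltonian_vf H \<in> hamiltonian_fields n m r"
proof -
  have "vf_degree (hamiltonian_vf H) = n"
    using assms by (simp add: vf_degree_def hamiltonian_vf_def total_degree_minus)
  from card_infinite_critical_points[OF this assms(5)] show ?thesis
    using assms by (auto simp: hamiltonian_fields_def fields_of_degrees_def hamiltonian_vf_def total_degree_minus)
qed

text \<open>The construction yields (n^2 + 1 - r - e) / 2 wells, where \<open>e\<close> is the
  parity of n + 1 - r; this is the integer part in the bound. The existing field of the hypothesis
  only serves to restrict \<open>r\<close>.\<close>

lemma realization_equal:
  assumes ne: "hamiltonian_fields n n r \<noteq> {}" and n: "1 \<le> n"
  obtains X Z where "X \<in> hamiltonian_fields n n r" "finite Z" "Z \<subseteq> centers X" "n * n \<le> 2 * card Z + r"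
proof -
  obtain G where G: "top_form (Suc n) G \<noteq> 0"
    "r = card {t. poly (top_form (Suc n) G) t = 0} + (if degree (top_form (Suc n) G) < Suc n then 1 else 0)"
    using ne hamiltonian_fields_cases[of _ n n r] by (metis all_not_in_conv order_refl)
  have rn: "r \<le> Suc n" using card_poly_roots_bound[OF G(1)] degree_top_form[of "Suc n" G] G(2) by auto
  define k where "k = (Suc n - r) div 2"
  define e where "e = (Suc n - r) mod 2"
  have ek: "e + r + 2 * k = Suc n" using rn unfolding e_def k_def by presburger
  \<comment> \<open>For e = 1 a real zero must be available for repetition. If r = 0 and n + 1 is
    odd, the leading form of the given field would have full odd degree and no real zero.\<close>
  have er: "0 < e \<longrightarrow> 0 < r"
  proof
    assume "0 < e"
    show "0 < r"
    proof (rule ccontr)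
      assume r0: "\<not> 0 < r"
      then have "odd (Suc n)" using \<open>0 < e\<close> unfolding e_def by (simp only: not_gr0 diff_zero odd_iff_mod_2_eq_one)
      moreover have "degree (top_form (Suc n) G) = Suc n" using r0 G(2) degree_top_form[of "Suc n" G] by (auto split: if_splits)
      ultimately obtain x where "poly (top_form (Suc n) G) x = 0" using odd_degree_real_root by metis
      then have "{t. poly (top_form (Suc n) G) t = 0} \<noteq> {}" by blast
      then have "0 < card {t. poly (top_form (Suc n) G) t = 0}" using poly_roots_finite[OF G(1)] by (simp add: card_gt_0_iff)
      then show False using r0 G(2) by simp
    qed
  qed
  obtain H \<epsilon> \<eta> B \<W> where H: "bidegree_less (Suc (Suc n)) H" "top_form (Suc n) H = smult \<epsilon> (step_poly B e r k \<eta>)"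
    "\<epsilon> \<noteq> 0" "\<eta> \<noteq> 0" "0 < B" "wells (evalp H) \<W>" "2 * card \<W> + n = n * n + 2 * k"
    by (rule many_wells_equal_degrees[OF n ek er])
  obtain a b Z where Z: "finite Z" "card Z = card \<W>"
    "\<And>z. z \<in> Z \<Longrightarrow> evalp (deriv_x (H + (mono_xy 0 1 a + mono_xy 1 0 b))) z = 0"
    "\<And>z. z \<in> Z \<Longrightarrow> evalp (deriv_y (H + (mono_xy 0 1 a + mono_xy 1 0 b))) z = 0"
    "\<And>z. z \<in> Z \<Longrightarrow> 0 < hess (H + (mono_xy 0 1 a + mono_xy 1 0 b)) z"
    by (rule wells_nondegenerate_critical_points[OF H(6)], rule that)
  define H2 where "H2 = H + (mono_xy 0 1 a + mono_xy 1 0 b)"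
  let ?P = "smult \<epsilon> (step_poly B e r k \<eta>)"
  have t: "top_form (Suc n) H2 = ?P"
    using top_form_eq_0[OF linear_perturbation(1), of "Suc n" a b] n by (simp add: H2_def top_form_add[of _ H] H(2))
  have bd: "bidegree_less (Suc (Suc n)) H2" unfolding H2_def
    using H(1) linear_perturbation(1)[of a b] by (intro bidegree_less_add[of _ H]) (auto elim: bidegree_less_mono)
  have dP: "degree ?P = Suc n" using H(3) ek by (simp add: degree_step_poly)
  have P0: "?P \<noteq> 0" using H(3) by (simp add: step_poly_nonzero)
  have top: "coeff (coeff H2 (Suc n)) 0 \<noteq> 0"
  proof -
    have "coeff ?P (Suc n) \<noteq> 0" using P0 dP by (metis leading_coeff_0_iff)
    then show ?thesis unfolding t[symmetric] by (simp add: coeff_top_form)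
  qed
  \<comment> \<open>All real zeros are positive, so 0 is not a zero and the coefficient of x^(n + 1)
    survives; this gives \<open>H_x\<close> its full degree n.\<close>
  have bot: "coeff (coeff H2 0) (Suc n) \<noteq> 0"
  proof -
    have "poly (step_poly B e r k \<eta>) 0 \<noteq> 0" using H(4,5) er by (intro step_poly_not_root) auto
    then have "coeff ?P 0 \<noteq> 0" using H(3) by (simp add: poly_0_coeff_0)
    then show ?thesis unfolding t[symmetric] by (simp add: coeff_top_form)
  qed
  have "card ((\<lambda>i. B + real i) ` {..<r}) = r" by (subst card_image) (auto simp: inj_on_def)
  then have cr: "card {t. poly ?P t = 0} = r" using H(3) step_poly_roots[OF er H(4), of B k] by simp
  have "hamiltonian_vf H2 \<in> hamiltonian_fields n n r"
  proof (rule hamiltonian_fieldsI)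
    show "total_degree H2 = n + 1" by (rule total_degree_eqI[where i = "Suc n" and j = 0]) (use bd top in auto)
    show "total_degree (deriv_x H2) = n"
      by (rule total_degree_eqI[where i = 0 and j = n]) (use bot bidegree_less_deriv_x[OF bd] in \<open>auto simp: coeff_deriv_x simp del: of_nat_Suc\<close>)
    show "total_degree (deriv_y H2) = n"
      by (rule total_degree_eqI[where i = n and j = 0]) (use top bidegree_less_deriv_y[OF bd] in \<open>auto simp: coeff_deriv_y simp del: of_nat_Suc\<close>)
    show "top_form (Suc n) H2 \<noteq> 0" unfolding t by (rule P0)
    show "r = card {u. poly (top_form (Suc n) H2) u = 0} + (if degree (top_form (Suc n) H2) < Suc n then 1 else 0)"
      unfolding t using cr dP by simp
  qed simp
  moreover have "Z \<subseteq> centers (hamiltonian_vf H2)"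
    using Z(3-5) center_if_hess_pos unfolding H2_def[symmetric] by (auto simp: centers_def)
  moreover have "n * n \<le> 2 * card Z + r"
  proof -
    have "e \<le> 1" unfolding e_def by simp
    then show ?thesis using H(7) Z(2) ek by linarith
  qed
  ultimately show thesis using that Z(1) by blast
qed

text \<open>For m < n the leading form is a multiple of t^(n + 1), which forces r = 1; the separated
  Hamiltonian has the same kind of leading form.\<close>

lemma realization_greater:
  assumes ne: "hamiltonian_fields n m r \<noteq> {}" and m: "1 \<le> m" "m < n"
  obtains X Z where "X \<in> hamiltonian_fields n m r" "finite Z" "Z \<subseteq> centers X" "n * m \<le> 2 * card Z"
proof -
  have roots: "card {t. poly (monom a (Suc n)) t = 0} + (if degree (monom a (Suc n)) < Suc n then 1 else 0) = (1::nat)"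
    if "a \<noteq> 0" for a :: real
  proof -
    have "{t. poly (monom a (Suc n)) t = 0} = {0}" using that by (auto simp: poly_monom)
    then show ?thesis using that by (simp add: degree_monom_eq)
  qed
  obtain G where G: "bidegree_less (Suc m) (deriv_x G)" "top_form (Suc n) G \<noteq> 0"
    "r = card {t. poly (top_form (Suc n) G) t = 0} + (if degree (top_form (Suc n) G) < Suc n then 1 else 0)"
    using ne hamiltonian_fields_cases[of _ n m r] m by (metis all_not_in_conv less_imp_le)
  obtain c where "c \<noteq> 0" "top_form (Suc n) G = monom c (Suc n)" using top_form_unequal_degrees[OF G(1) m(2) G(2)] by blast
  then have r: "r = 1" using roots G(3) by simp
  obtain H Z where H: "total_degree H = n + 1" "total_degree (deriv_x H) = m" "total_degree (deriv_y H) = n"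
    "finite Z" "n * m \<le> 2 * card Z" "\<And>z. z \<in> Z \<Longrightarrow> evalp (deriv_x H) z = 0" "\<And>z. z \<in> Z \<Longrightarrow> evalp (deriv_y H) z = 0"
    "\<And>z. z \<in> Z \<Longrightarrow> 0 < hess H z"
    using many_critical_points_unequal_degrees[OF m] by metis
  obtain i j where "i + j = Suc n" "coeff (coeff H i) j \<noteq> 0" using total_degree_top[of H n] H(1) by auto
  then have P: "top_form (Suc n) H \<noteq> 0" by (rule top_form_nonzero)
  have "bidegree_less (Suc m) (deriv_x H)" using bidegree_less_total_degree[of "deriv_x H"] H(2) by simp
  then obtain a where a: "a \<noteq> 0" "top_form (Suc n) H = monom a (Suc n)" using top_form_unequal_degrees[OF _ m(2) P] by blast
  have "hamiltonian_vf H \<in> hamiltonian_fields n m r"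
    using H(1-3) m P roots[OF a(1)] unfolding r by (intro hamiltonian_fieldsI) (auto simp: a(2))
  moreover have "Z \<subseteq> centers (hamiltonian_vf H)" using H(6-8) center_if_hess_pos by (auto simp: centers_def)
  ultimately show thesis using that H(4,5) by blast
qed

lemma finite_card_le_if_finite_subsets:
  assumes "\<And>C. finite C \<Longrightarrow> C \<subseteq> S \<Longrightarrow> card C \<le> (b::nat)"
  shows "finite S \<and> card S \<le> b"
proof -
  have "finite S"
  proof (rule ccontr)
    assume "infinite S"
    then obtain C where "finite C" "card C = Suc b" "C \<subseteq> S" using infinite_arbitrarily_large by metis
    then show False using assms[of C] by simp
  qed
  then show ?thesis using assms by blast
qed

theorem theorem3p1:
  fixes n m r :: nat
  assumes "1 \<le> m" and "m \<le> n"
  shows "(\<forall>X \<in> hamiltonian_fields n m r.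
            finite (centers X) \<and> int (card (centers X)) \<le> center_bound n m r) \<and>
         (hamiltonian_fields n m r \<noteq> {} \<longrightarrow>
           (\<exists>X \<in> hamiltonian_fields n m r.
              finite (centers X) \<and> int (card (centers X)) = center_bound n m r))"
proof -
  have n1: "1 \<le> n" using assms by simp
  have upper: "finite (centers X) \<and> int (card (centers X)) \<le> center_bound n m r" if X: "X \<in> hamiltonian_fields n m r" for X
  proof (cases "n = m")
    case True
    have b: "2 * card C + r \<le> n * n + 1" if "finite C" "C \<subseteq> centers X" for C
      using centers_bound_equal[of X n r C] X True n1 that by simp
    have "card C \<le> n * n + 1" if "finite C" "C \<subseteq> centers X" for C using b[OF that] by simp
    then have fin: "finite (centers X)" using finite_card_le_if_finite_subsets by blast
    have "real (2 * card (centers X) + r) \<le> real (n * n + 1)" using b[OF fin order_refl] by (simp only: of_nat_le_iff)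
    then show ?thesis using fin True by (simp add: center_bound_def le_floor_iff power2_eq_square)
  next
    case False
    have b: "2 * card C \<le> n * m + 1" if "finite C" "C \<subseteq> centers X" for C
      using centers_bound_greater[of X n m r C] X False assms that by simp
    have "card C \<le> n * m + 1" if "finite C" "C \<subseteq> centers X" for C using b[OF that] by simp
    then have fin: "finite (centers X)" using finite_card_le_if_finite_subsets by blast
    have "real (2 * card (centers X)) \<le> real (n * m + 1)" using b[OF fin order_refl] by (simp only: of_nat_le_iff)
    then show ?thesis using fin False by (simp add: center_bound_def le_floor_iff)
  qed
  moreover have "\<exists>X \<in> hamiltonian_fields n m r. finite (centers X) \<and> int (card (centers X)) = center_bound n m r"
    if ne: "hamiltonian_fields n m r \<noteq> {}"
  proof (cases "n = m")
    case True
    obtain X Z where X: "X \<in> hamiltonian_fields n n r" "finite Z" "Z \<subseteq> centers X" "n * n \<le> 2 * card Z + r"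
      using realization_equal[OF ne[unfolded True[symmetric]] n1] by metis
    have u: "finite (centers X)" "int (card (centers X)) \<le> center_bound n m r" using upper[of X] X(1) True by auto
    have "card Z \<le> card (centers X)" using X(3) u(1) by (intro card_mono)
    then have "real (n * n) \<le> real (2 * card (centers X) + r)" using X(4) by (simp only: of_nat_le_iff)
    then have "center_bound n m r \<le> int (card (centers X))"
      using True by (simp add: center_bound_def floor_le_iff power2_eq_square)
    then show ?thesis using u X(1) True by (intro bexI[of _ X]) auto
  next
    case False
    then have "m < n" using assms by simp
    obtain X Z where X: "X \<in> hamiltonian_fields n m r" "finite Z" "Z \<subseteq> centers X" "n * m \<le> 2 * card Z"
      using realization_greater[OF ne assms(1) \<open>m < n\<close>] by metis
    have u: "finite (centers X)" "int (card (centers X)) \<le> center_bound n m r" using upper[of X] X(1) by auto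
    have "card Z \<le> card (centers X)" using X(3) u(1) by (intro card_mono)
    then have "real (n * m) \<le> real (2 * card (centers X))" using X(4) by (simp only: of_nat_le_iff)
    then have "center_bound n m r \<le> int (card (centers X))"
      using False by (simp add: center_bound_def floor_le_iff)
    then show ?thesis using u X(1) by (intro bexI[of _ X]) auto
  qed
  ultimately show ?thesis by blast
qed

end
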